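(* Let $0<d<1/4$ and let $(X_n)_{n\in\mathbb{Z}}$ and $(Y_n)_{n\in\mathbb{Z}}$ be independent processes with the same stochastic structure, satisfying the model assumptions stated in the context with memory parameter $d$. Assume that the process is Gaussian, that $\sigma(j)\sim\lambda j^{2d-1}$ as $j\to\infty$ with $\lambda>0$, that $b_j\sim\delta j^{d-1}$ as $j\to\infty$ with $\delta>0$, and that $\mathbb{E}(\varepsilon_n^4)<+\infty$ for all $n$. Assume also that the spectral density $f$ of the process is bounded below by a positive constant. Let $\widehat{X_k}(1)=\sum_{j=1}^ka_{j,k}X_{k+1-j}$ and $\widehat{X_{T,k}}(1)=\sum_{j=1}^k\widehat{a_{j,k}}X_{k+1-j}$, where $(a_{j,k})$ and $(\widehat{a_{j,k}})$ are the true Yule–Walker coefficients and those estimated from $Y_1,\dots,Y_T$. Then $$\mathbb{E}\Big[\big(\widehat{X_{T,k}}(1)-\widehat{X_k}(1)\big)^2\Big]=\mathrm{O}\Big(\frac kT\Big).$$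
   Context: Asymptotics: the $\mathrm{O}$ is understood as $T\to+\infty$ and then $k\to+\infty$: there is a constant independent of $k$ and $T$ such that for every sufficiently large $k$ the bound holds with this constant for all $T\ge T_0(k)$. Model assumptions: the process is real, weakly stationary, in $L^2$, with mean $0$ and autocovariance function $\sigma$ with $\sum_{k\in\mathbb{Z}}|\sigma(k)|=\infty$. It has representations $X_n=\sum_{j\ge0}b_j\varepsilon_{n-j}$ with $(b_j)$ square-summable and $\varepsilon_n=\sum_{j\ge0}a_jX_{n-j}$ with $(a_j)$ absolutely summable ($a_0=b_0=1$), where $(\varepsilon_n)$ is a white noise of uncorrelated variables with mean $0$ and variance $\sigma_\varepsilon^2$. For every $\eta>0$ there are constants $C_1,C_2$ with $|a_j|\le C_1j^{-d-1+\eta}$, $|b_j|\le C_2j^{d-1+\eta}$ for all $j\ge1$. Yule–Walker coefficients: $(a_{i,k})_{1\le i\le k}$ solves $\sum_{i=1}^ka_{i,k}\sigma(i-j)=\sigma(j)$, $1\le j\le k$. The estimates $(\widehat{a_{i,k}})_{1\le i\le k}$ solve the same equations with each $\sigma(l)$ replaced by the empirical covariance $\widehat{\sigma(l)}=\frac1T\sum_{t=1}^{T-l}Y_tY_{t+l}$, $l\ge0$ (with $\widehat{\sigma(-l)}=\widehat{\sigma(l)}$). *)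

theory Defs
  imports "HOL-Probability.Probability" "HOL-Library.Landau_Symbols"
begin

section \<open>Second-order processes indexed by the integers\<close>

definition L2_var :: "'a measure \<Rightarrow> ('a \<Rightarrow> real) \<Rightarrow> bool" where
  "L2_var M Z \<longleftrightarrow> Z \<in> borel_measurable M \<and> integrable M (\<lambda>\<omega>. (Z \<omega>)\<^sup>2)"

definition covariance :: "'a measure \<Rightarrow> ('a \<Rightarrow> real) \<Rightarrow> ('a \<Rightarrow> real) \<Rightarrow> real" where
  "covariance M U V =
     (\<integral>\<omega>. (U \<omega> - (\<integral>\<omega>. U \<omega> \<partial>M)) * (V \<omega> - (\<integral>\<omega>. V \<omega> \<partial>M)) \<partial>M)"

definition weakly_stationary :: "'a measure \<Rightarrow> (int \<Rightarrow> 'a \<Rightarrow> real) \<Rightarrow> bool" where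
  "weakly_stationary M X \<longleftrightarrow>
     (\<forall>n. L2_var M (X n)) \<and>
     (\<forall>m n. (\<integral>\<omega>. X m \<omega> \<partial>M) = (\<integral>\<omega>. X n \<omega> \<partial>M)) \<and>
     (\<forall>m n h. covariance M (X (m + h)) (X (n + h)) = covariance M (X m) (X n))"

text \<open>Only meant for weakly stationary processes, where the base point 0 is immaterial.\<close>
definition autocov :: "'a measure \<Rightarrow> (int \<Rightarrow> 'a \<Rightarrow> real) \<Rightarrow> int \<Rightarrow> real" where
  "autocov M X h = covariance M (X 0) (X h)"

definition white_noise :: "'a measure \<Rightarrow> (int \<Rightarrow> 'a \<Rightarrow> real) \<Rightarrow> real \<Rightarrow> bool" where
  "white_noise M \<epsilon> v \<longleftrightarrow>
     (\<forall>n. L2_var M (\<epsilon> n) \<and> (\<integral>\<omega>. \<epsilon> n \<omega> \<partial>M) = 0) \<and>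
     (\<forall>m n. covariance M (\<epsilon> m) (\<epsilon> n) = (if m = n then v else 0))"

text \<open>\<open>S\<close> is the sum of the series \<open>Z 0 + Z 1 + \<dots>\<close> in the mean-square sense.\<close>
definition L2_sums :: "'a measure \<Rightarrow> (nat \<Rightarrow> 'a \<Rightarrow> real) \<Rightarrow> ('a \<Rightarrow> real) \<Rightarrow> bool" where
  "L2_sums M Z S \<longleftrightarrow>
     (\<forall>j. L2_var M (Z j)) \<and> L2_var M S \<and>
     (\<lambda>N. \<integral>\<omega>. (S \<omega> - (\<Sum>j<N. Z j \<omega>))\<^sup>2 \<partial>M) \<longlonglongrightarrow> 0"

text \<open>All finite linear combinations are normal; the first disjunct is the degenerate
  (variance zero) normal law.\<close>
definition gaussian_process :: "'a measure \<Rightarrow> (int \<Rightarrow> 'a \<Rightarrow> real) \<Rightarrow> bool" where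
  "gaussian_process M X \<longleftrightarrow>
     (\<forall>n. X n \<in> borel_measurable M) \<and>
     (\<forall>I c. finite I \<longrightarrow>
        (\<exists>\<mu>. AE \<omega> in M. (\<Sum>n\<in>I. c n * X n \<omega>) = \<mu>) \<or>
        (\<exists>\<mu> s. s > 0 \<and>
           distributed M lborel (\<lambda>\<omega>. \<Sum>n\<in>I. c n * X n \<omega>) (normal_density \<mu> s)))"

text \<open>\<open>f\<close> is only determined up to null sets of \<open>{- pi..pi}\<close>, hence the ``almost everywhere''.\<close>
definition spectral_density :: "(int \<Rightarrow> real) \<Rightarrow> (real \<Rightarrow> real) \<Rightarrow> bool" where
  "spectral_density \<sigma> f \<longleftrightarrow>
     set_integrable lborel {- pi..pi} f \<and>
     (AE x in lborel. x \<in> {- pi..pi} \<longrightarrow> 0 \<le> f x) \<and>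
     (\<forall>h. complex_of_real (\<sigma> h) =
        (LINT x:{- pi..pi}|lborel. complex_of_real (f x) * cis (of_int h * x)))"

definition sample_path :: "(int \<Rightarrow> 'a \<Rightarrow> real) \<Rightarrow> 'a \<Rightarrow> int \<Rightarrow> real" where
  "sample_path X \<omega> = (\<lambda>n. X n \<omega>)"

abbreviation path_space :: "(int \<Rightarrow> real) measure" where
  "path_space \<equiv> Pi\<^sub>M UNIV (\<lambda>_. borel)"

section \<open>Long-memory model with memory parameter \<open>d\<close>\<close>

locale long_memory_model = prob_space M
  for M :: "'a measure"
    and X \<epsilon> :: "int \<Rightarrow> 'a \<Rightarrow> real"
    and a b :: "nat \<Rightarrow> real"
    and v d :: real +
  assumes stationary: "weakly_stationary M X"
    and mean_zero: "\<And>n. expectation (X n) = 0"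
    and not_summable_autocov: "\<not> (\<lambda>h. \<bar>autocov M X h\<bar>) summable_on UNIV"
    and noise: "white_noise M \<epsilon> v"
    and a_0: "a 0 = 1"
    and b_0: "b 0 = 1"
    and summable_a: "summable (\<lambda>j. \<bar>a j\<bar>)"
    and summable_b: "summable (\<lambda>j. (b j)\<^sup>2)"
    and moving_average: "\<And>n. L2_sums M (\<lambda>j \<omega>. b j * \<epsilon> (n - int j) \<omega>) (X n)"
    and autoregression: "\<And>n. L2_sums M (\<lambda>j \<omega>. a j * X (n - int j) \<omega>) (\<epsilon> n)"
    and coefficient_bounds: "\<And>\<eta>. \<eta> > 0 \<Longrightarrow> \<exists>C1 C2. \<forall>j\<ge>1.
          \<bar>a j\<bar> \<le> C1 * real j powr (- d - 1 + \<eta>) \<and>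
          \<bar>b j\<bar> \<le> C2 * real j powr (d - 1 + \<eta>)"

section \<open>Yule--Walker prediction\<close>

text \<open>Only the values \<open>c 1, \<dots>, c k\<close> matter.\<close>
definition yule_walker :: "(int \<Rightarrow> real) \<Rightarrow> nat \<Rightarrow> (nat \<Rightarrow> real) \<Rightarrow> bool" where
  "yule_walker \<gamma> k c \<longleftrightarrow>
     (\<forall>j\<in>{1..k}. (\<Sum>i=1..k. c i * \<gamma> (int i - int j)) = \<gamma> (int j))"

text \<open>The sum is empty, and the value 0, for lags \<open>l\<close> with \<open>\<bar>l\<bar> \<ge> T\<close>.\<close>
definition emp_autocov :: "nat \<Rightarrow> (int \<Rightarrow> real) \<Rightarrow> int \<Rightarrow> real" where
  "emp_autocov T y l = (\<Sum>t\<in>{1..int T - \<bar>l\<bar>}. y t * y (t + \<bar>l\<bar>)) / real T"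

definition predictor :: "nat \<Rightarrow> (nat \<Rightarrow> real) \<Rightarrow> (int \<Rightarrow> real) \<Rightarrow> real" where
  "predictor k c x = (\<Sum>j=1..k. c j * x (int k + 1 - int j))"

end

theory Submission
  imports Defs
begin

text \<open>
  Write \<open>\<sigma>\<close> for the common autocovariance function, \<open>\<Delta>\<close> for the vector of differences between
  estimated and true Yule--Walker coefficients of order \<open>k\<close>, and \<open>\<Sigma>\<close> for the Toeplitz matrix
  \<open>(\<sigma> (i - j))\<close>. Since \<open>\<Delta>\<close> is a function of the path of \<open>Y\<close>, it is independent of \<open>X\<close>, and the mean
  square error is the expectation of the Toeplitz form \<open>\<Delta>\<^sup>T \<Sigma> \<Delta>\<close> (\<open>plug_in_error\<close>). Three ideas
  bound it.

  First, the spectral density is at least \<open>m\<close>, so \<open>\<Sigma> \<ge> \<mu>\<close> with \<open>\<mu> = 2 pi m\<close>. If the empirical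
  autocovariances are uniformly close to the true ones, the empirical Toeplitz matrix dominates
  \<open>\<Sigma> / 2\<close>, and \<open>\<Delta>\<^sup>T \<Sigma> \<Delta> \<le> (4 / \<mu>) \<bar>r\<bar>\<^sup>2\<close>, where \<open>r\<close> is the residual of the true coefficients in
  the empirical Yule--Walker equations (\<open>yule_walker_stability\<close>).

  Secondly, on the exceptional event \<open>\<Delta>\<close> is still bounded by a constant that depends on \<open>k\<close> only:
  the empirical sequence is positive definite, so its reflection coefficients have modulus at most 1
  and the Durbin--Levinson recursion gives coefficients of size at most \<open>2 ^ k\<close>. The exceptional event
  is negligible because the fourth moment of an empirical autocovariance error is \<open>O(1 / T\<^sup>2)\<close>; for
  a sum \<open>S\<close> of centred squares of Gaussian variables this fourth moment is obtained
  from Gaussian integration by parts, which yields \<open>E S^4 = 6 E (Q S\<^sup>2)\<close> with a quadratic form \<open>Q\<close>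
  and thus \<open>E S^4 \<le> 36 E Q\<^sup>2\<close> (\<open>sum_squares_fourth_moment\<close>). As \<open>T\<close> tends to infinity for fixed \<open>k\<close>,
  constants that depend on \<open>k\<close> are harmless in front of \<open>1 / T\<^sup>2\<close>.

  Thirdly, each of the \<open>k\<close> entries of \<open>r\<close> has second moment at most \<open>2 B / T + O(1 / T\<^sup>2)\<close>, where \<open>B\<close>
  bounds the squared \<open>l\<^sup>2\<close> norm of the convolution of the absolute prediction error filter
  \<open>(1, - \<alpha> 1, \<dots>, - \<alpha> k)\<close> with \<open>\<bar>\<sigma>\<bar>\<close> (\<open>normal_equation_second_moment\<close>). What remains is that \<open>B\<close> can
  be chosen independently of \<open>k\<close>. The filter is compared with the infinite autoregressive filter
  \<open>a\<close>: the difference \<open>h\<close> satisfies \<open>\<Sum> h\<^sup>2 = O(k powr (- 4 d))\<close>, because the finite predictor is a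
  projection and the tail of the autoregression has small variance (\<open>finite_predictor_coefficients\<close>).
  The convolution of \<open>a\<close> with \<open>\<bar>\<sigma>\<bar>\<close> is bounded since \<open>a\<close> is summable and \<open>\<sigma>\<close> is square-summable for
  \<open>d < 1 / 4\<close>. For the convolution of \<open>h\<close> with \<open>\<bar>\<sigma>\<bar>\<close>, the autocovariances are cut at lag \<open>k\<close>, and the
  growth \<open>k powr (4 d)\<close> of both parts is exactly compensated by the size of \<open>h\<close>
  (\<open>convolution_bound\<close>).
\<close>

section \<open>Sums of powers\<close>

lemma powr_mvt:
  fixes s x y :: real
  assumes "0 < x" "x < y"
  obtains z where "x < z" "z < y" "y powr s - x powr s = (y - x) * (s * z powr (s - 1))"
proof -
  have "\<exists>z>x. z < y \<and> y powr s - x powr s = (y - x) * (s * z powr (s - 1))"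
    using assms by (intro MVT2) (auto intro!: derivative_eq_intros)
  thus ?thesis using that by blast
qed

text \<open>Each summand is at most an increment of \<open>x powr p / p\<close>, by the mean value theorem.\<close>
lemma sum_powr_le:
  fixes p :: real
  assumes p: "0 < p" "p \<le> 1"
  shows "(\<Sum>j=1..k. real j powr (p - 1)) \<le> real k powr p / p"
proof (induction k)
  case (Suc k)
  have "p * real (Suc k) powr (p - 1) \<le> real (Suc k) powr p - real k powr p"
  proof (cases "k = 0")
    case False
    then obtain z where z: "real k < z" "z < real (Suc k)"
      "real (Suc k) powr p - real k powr p = (real (Suc k) - real k) * (p * z powr (p - 1))"
      by (auto intro: powr_mvt[of "real k" "real (Suc k)" p])
    have "real (Suc k) powr (p - 1) \<le> z powr (p - 1)"
      using z p by (intro powr_mono2') auto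
    thus ?thesis using z p by simp
  qed (use p in simp)
  hence "real (Suc k) powr (p - 1) \<le> real (Suc k) powr p / p - real k powr p / p"
    using p by (simp add: field_simps)
  thus ?case using Suc.IH by simp
qed simp

text \<open>As before, but the increments are those of \<open>- x powr (- q) / q\<close>, and the sum telescopes from \<open>n\<close> on.\<close>
lemma sum_powr_tail_le:
  fixes q :: real
  assumes q: "0 < q" and n: "n \<ge> 1"
  shows "(\<Sum>j=Suc n..N. real j powr (- q - 1)) \<le> real n powr (- q) / q"
proof -
  have "(\<Sum>j=Suc n..N. real j powr (- q - 1)) \<le> real n powr (- q) / q - real N powr (- q) / q" if "N \<ge> n"
    using that
  proof (induction N rule: dec_induct)
    case (step N)
    have N: "real N > 0" using step.hyps n by simp
    then obtain z where z: "real N < z" "z < real (Suc N)"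
      "real (Suc N) powr (- q) - real N powr (- q) = (real (Suc N) - real N) * (- q * z powr (- q - 1))"
      by (auto intro: powr_mvt[of "real N" "real (Suc N)" "- q"])
    have "real (Suc N) powr (- q - 1) \<le> z powr (- q - 1)"
      using z N q by (intro powr_mono2') auto
    hence "q * real (Suc N) powr (- q - 1) \<le> real N powr (- q) - real (Suc N) powr (- q)"
    proof -
      have "q * real (Suc N) powr (- q - 1) \<le> q * z powr (- q - 1)"
        using \<open>real (Suc N) powr (- q - 1) \<le> z powr (- q - 1)\<close> q by (intro mult_left_mono) auto
      moreover have "real (Suc N) powr (- q) - real N powr (- q) = - (q * z powr (- q - 1))"
        unfolding z(3) by simp
      ultimately show ?thesis by linarith
    qed
    hence "real (Suc N) powr (- q - 1) \<le> real N powr (- q) / q - real (Suc N) powr (- q) / q"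
      using q by (simp add: field_simps)
    thus ?case using step by simp
  qed simp
  thus ?thesis using q by (cases "N \<ge> n") (auto simp: order_trans)
qed

section \<open>Toeplitz forms and perturbed Yule--Walker systems\<close>

definition toeplitz_form :: "(int \<Rightarrow> real) \<Rightarrow> nat \<Rightarrow> (nat \<Rightarrow> real) \<Rightarrow> real" where
  "toeplitz_form \<gamma> k x = (\<Sum>i=1..k. \<Sum>j=1..k. x i * x j * \<gamma> (int i - int j))"

lemma sum_abs_squared_le: "(\<Sum>i=1..k. \<bar>x i\<bar>)\<^sup>2 \<le> real k * (\<Sum>i=1..k. (x i)\<^sup>2)" for x :: "nat \<Rightarrow> real"
  using Cauchy_Schwarz_ineq_sum[of "\<lambda>_. 1" "\<lambda>i. \<bar>x i\<bar>" "{1..k}"] by simp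

lemma toeplitz_form_abs_le:
  assumes "\<And>i j. i \<in> {1..k} \<Longrightarrow> j \<in> {1..k} \<Longrightarrow> \<bar>\<gamma> (int i - int j)\<bar> \<le> c"
  shows "\<bar>toeplitz_form \<gamma> k x\<bar> \<le> c * (\<Sum>i=1..k. \<bar>x i\<bar>)\<^sup>2"
proof -
  have "\<bar>toeplitz_form \<gamma> k x\<bar> \<le> (\<Sum>i=1..k. \<Sum>j=1..k. \<bar>x i * x j * \<gamma> (int i - int j)\<bar>)"
    unfolding toeplitz_form_def by (intro order_trans[OF sum_abs] sum_mono sum_abs)
  also have "\<dots> \<le> (\<Sum>i=1..k. \<Sum>j=1..k. c * (\<bar>x i\<bar> * \<bar>x j\<bar>))"
    using assms by (intro sum_mono) (simp add: abs_mult mult.commute[of c] mult_left_mono)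
  also have "\<dots> = c * (\<Sum>i=1..k. \<bar>x i\<bar>)\<^sup>2"
    by (simp only: power2_eq_square sum_product) (simp only: sum_distrib_left)
  finally show ?thesis .
qed

text \<open>The difference \<open>x = c - a\<close> satisfies the perturbed equations with the residual \<open>r\<close> as right-hand
  side, so that \<open>toeplitz_form \<gamma>' k x = \<Sum> x j * r j\<close>. Closeness of \<open>\<gamma>'\<close> to \<open>\<gamma>\<close> costs at most half of
  \<open>toeplitz_form \<gamma> k x\<close>, because \<open>(\<Sum> \<bar>x i\<bar>)\<^sup>2 \<le> k * \<Sum> (x i)\<^sup>2\<close>; this is where \<open>\<mu> / (2 k)\<close> comes from.\<close>
lemma yule_walker_stability:
  assumes \<mu>: "\<mu> > 0" and lower: "\<And>x. \<mu> * (\<Sum>i=1..k. (x i)\<^sup>2) \<le> toeplitz_form \<gamma> k x"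
    and close: "\<And>i j. i \<in> {1..k} \<Longrightarrow> j \<in> {1..k} \<Longrightarrow>
      \<bar>\<gamma>' (int i - int j) - \<gamma> (int i - int j)\<bar> \<le> \<mu> / (2 * real k)"
    and yw: "yule_walker \<gamma>' k c"
  shows "toeplitz_form \<gamma> k (\<lambda>i. c i - a i) \<le>
    4 / \<mu> * (\<Sum>j=1..k. (\<gamma>' (int j) - (\<Sum>i=1..k. a i * \<gamma>' (int i - int j)))\<^sup>2)"
proof (cases "k = 0")
  case False
  define x where "x = (\<lambda>i. c i - a i)"
  define r where "r = (\<lambda>j. \<gamma>' (int j) - (\<Sum>i=1..k. a i * \<gamma>' (int i - int j)))"
  define n where "n = (\<Sum>i=1..k. (x i)\<^sup>2)"
  have r: "(\<Sum>i=1..k. x i * \<gamma>' (int i - int j)) = r j" if "j \<in> {1..k}" for j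
    using yw that unfolding yule_walker_def x_def r_def by (simp add: left_diff_distrib sum_subtractf)
  have "toeplitz_form \<gamma> k x - toeplitz_form \<gamma>' k x = toeplitz_form (\<lambda>h. \<gamma> h - \<gamma>' h) k x"
    by (simp add: toeplitz_form_def right_diff_distrib sum_subtractf)
  also have "\<dots> \<le> \<mu> / (2 * real k) * (\<Sum>i=1..k. \<bar>x i\<bar>)\<^sup>2"
    using close by (intro order_trans[OF abs_ge_self toeplitz_form_abs_le]) (auto simp: abs_minus_commute)
  also have "\<dots> \<le> \<mu> / (2 * real k) * (real k * n)"
    unfolding n_def using \<mu> by (intro mult_left_mono sum_abs_squared_le) auto
  also have "\<dots> = \<mu> * n / 2" using False by simp
  also have "\<mu> * n \<le> toeplitz_form \<gamma> k x" unfolding n_def by (rule lower)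
  finally have "toeplitz_form \<gamma> k x \<le> 2 * toeplitz_form \<gamma>' k x" by simp
  also have "toeplitz_form \<gamma>' k x = (\<Sum>j=1..k. x j * r j)"
    unfolding toeplitz_form_def by (subst sum.swap) (simp add: r[symmetric] sum_distrib_left mult_ac)
  also have "2 * \<dots> = (\<Sum>j=1..k. 2 * (x j * r j))" by (simp add: sum_distrib_left)
  also have "\<dots> \<le> (\<Sum>j=1..k. \<mu> / 2 * (x j)\<^sup>2 + 2 / \<mu> * (r j)\<^sup>2)"
  proof (rule sum_mono)
    fix j
    have "0 \<le> (\<mu> * x j - 2 * r j)\<^sup>2 / (2 * \<mu>)" using \<mu> by simp
    also have "\<dots> = \<mu> / 2 * (x j)\<^sup>2 + 2 / \<mu> * (r j)\<^sup>2 - 2 * (x j * r j)"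
      using \<mu> by (simp add: field_simps power2_eq_square)
    finally show "2 * (x j * r j) \<le> \<mu> / 2 * (x j)\<^sup>2 + 2 / \<mu> * (r j)\<^sup>2" by simp
  qed
  also have "\<dots> = \<mu> * n / 2 + 2 / \<mu> * (\<Sum>j=1..k. (r j)\<^sup>2)"
    by (simp add: sum.distrib n_def sum_distrib_left sum_divide_distrib)
  finally have "toeplitz_form \<gamma> k x \<le> \<mu> * n / 2 + 2 / \<mu> * (\<Sum>j=1..k. (r j)\<^sup>2)" .
  moreover have "\<mu> * n \<le> toeplitz_form \<gamma> k x" unfolding n_def by (rule lower)
  ultimately have "toeplitz_form \<gamma> k x \<le> 4 / \<mu> * (\<Sum>j=1..k. (r j)\<^sup>2)" by simp
  thus ?thesis unfolding x_def r_def .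
qed (simp add: toeplitz_form_def)

section \<open>The Durbin--Levinson recursion\<close>

definition pos_def_seq :: "(int \<Rightarrow> real) \<Rightarrow> bool" where
  "pos_def_seq \<gamma> \<longleftrightarrow> (\<forall>n x. (\<exists>i\<in>{1..n}. x i \<noteq> 0) \<longrightarrow> toeplitz_form \<gamma> n x > 0)"

lemma yule_walker_unique:
  assumes "pos_def_seq \<gamma>" "yule_walker \<gamma> k c" "yule_walker \<gamma> k c'" "i \<in> {1..k}"
  shows "c i = c' i"
proof (rule ccontr)
  assume "c i \<noteq> c' i"
  define x where "x = (\<lambda>i. c i - c' i)"
  have "toeplitz_form \<gamma> k x > 0"
  proof -
    have "\<exists>i\<in>{1..k}. x i \<noteq> 0" using assms(4) \<open>c i \<noteq> c' i\<close> by (auto simp: x_def)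
    thus ?thesis using assms(1) unfolding pos_def_seq_def by blast
  qed
  moreover have "toeplitz_form \<gamma> k x = (\<Sum>j=1..k. x j * (\<Sum>i=1..k. x i * \<gamma> (int i - int j)))"
    unfolding toeplitz_form_def by (subst sum.swap) (simp add: sum_distrib_left mult_ac)
  moreover have "(\<Sum>i=1..k. x i * \<gamma> (int i - int j)) = 0" if "j \<in> {1..k}" for j
    using assms(2,3) that unfolding yule_walker_def x_def by (simp add: left_diff_distrib sum_subtractf)
  ultimately show False by simp
qed

definition innovation_var :: "(int \<Rightarrow> real) \<Rightarrow> nat \<Rightarrow> (nat \<Rightarrow> real) \<Rightarrow> real" where
  "innovation_var \<gamma> k c = \<gamma> 0 - (\<Sum>i=1..k. c i * \<gamma> (int i))"

definition reflection :: "(int \<Rightarrow> real) \<Rightarrow> nat \<Rightarrow> (nat \<Rightarrow> real) \<Rightarrow> real" where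
  "reflection \<gamma> k c =
     (\<gamma> (int k + 1) - (\<Sum>i=1..k. c i * \<gamma> (int k + 1 - int i))) / innovation_var \<gamma> k c"

text \<open>This explicit solution of the Yule--Walker system serves two purposes: it shows that the estimates are
  measurable functions of the observed path, and it bounds them.\<close>
primrec durbin_levinson :: "(int \<Rightarrow> real) \<Rightarrow> nat \<Rightarrow> nat \<Rightarrow> real" where
  "durbin_levinson \<gamma> 0 = (\<lambda>_. 0)"
| "durbin_levinson \<gamma> (Suc k) = (\<lambda>i.
     if i = Suc k then reflection \<gamma> k (durbin_levinson \<gamma> k)
     else durbin_levinson \<gamma> k i -
       reflection \<gamma> k (durbin_levinson \<gamma> k) * durbin_levinson \<gamma> k (Suc k - i))"

text \<open>The innovation variance is the value of the Toeplitz form at the prediction error filter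
  \<open>(1, - c 1, \<dots>, - c k)\<close>: the Yule--Walker equations annihilate all rows but the first.\<close>
lemma innovation_var_pos:
  assumes pd: "pos_def_seq \<gamma>" and ev: "\<And>h. \<gamma> (- h) = \<gamma> h" and yw: "yule_walker \<gamma> k c"
  shows "innovation_var \<gamma> k c > 0"
proof -
  define x where "x = (\<lambda>i. if i = 1 then 1 else - c (i - 1))"
  have shift: "(\<Sum>i=1..Suc k. f i) = f 1 + (\<Sum>i=1..k. f (Suc i))" for f :: "nat \<Rightarrow> real"
    by (simp add: sum.atLeast_Suc_atMost sum.shift_bounds_cl_Suc_ivl[symmetric] del: sum.cl_ivl_Suc)
  have row: "(\<Sum>i=1..Suc k. x i * \<gamma> (int i - int j)) = (if j = 1 then innovation_var \<gamma> k c else 0)"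
    if j: "j \<in> {1..Suc k}" for j
  proof (cases "j = 1")
    case True
    thus ?thesis unfolding shift by (auto simp: x_def innovation_var_def sum_negf intro!: sum.cong)
  next
    case False
    then obtain j' where j': "j = Suc j'" "j' \<in> {1..k}" using j by (cases j) auto
    have "(\<Sum>i=1..Suc k. x i * \<gamma> (int i - int j)) = \<gamma> (- int j') - (\<Sum>i=1..k. c i * \<gamma> (int i - int j'))"
      unfolding shift by (auto simp: x_def j' sum_negf intro!: sum.cong)
    also have "\<dots> = 0" using yw j' by (simp add: yule_walker_def ev)
    finally show ?thesis using False by simp
  qed
  have "toeplitz_form \<gamma> (Suc k) x = (\<Sum>j=1..Suc k. x j * (\<Sum>i=1..Suc k. x i * \<gamma> (int i - int j)))"
    unfolding toeplitz_form_def by (subst sum.swap) (simp add: sum_distrib_left mult_ac del: sum.cl_ivl_Suc)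
  also have "\<dots> = (\<Sum>j=1..Suc k. x j * (if j = 1 then innovation_var \<gamma> k c else 0))"
    by (intro sum.cong refl) (simp only: row)
  also have "\<dots> = innovation_var \<gamma> k c"
    unfolding shift by (simp add: x_def)
  finally have "toeplitz_form \<gamma> (Suc k) x = innovation_var \<gamma> k c" .
  moreover have "toeplitz_form \<gamma> (Suc k) x > 0"
  proof -
    have "\<exists>i\<in>{1..Suc k}. x i \<noteq> 0" by (rule bexI[of _ 1]) (auto simp: x_def)
    thus ?thesis using pd unfolding pos_def_seq_def by blast
  qed
  ultimately show ?thesis by simp
qed

lemma sum_reverse: "(\<Sum>i=1..k. f (Suc k - i) (int i)) = (\<Sum>i=1..k. f i (int k + 1 - int i))"
  for f :: "nat \<Rightarrow> int \<Rightarrow> real"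
  by (rule sum.reindex_bij_witness[of _ "\<lambda>i. Suc k - i" "\<lambda>i. Suc k - i"]) (auto simp: of_nat_diff)

lemma durbin_levinson_yule_walker:
  assumes pd: "pos_def_seq \<gamma>" and ev: "\<And>h. \<gamma> (- h) = \<gamma> h"
  shows "yule_walker \<gamma> k (durbin_levinson \<gamma> k)"
proof (induction k)
  case 0
  show ?case by (simp add: yule_walker_def)
next
  case (Suc k)
  let ?c = "durbin_levinson \<gamma> k"
  define \<kappa> where "\<kappa> = reflection \<gamma> k ?c"
  have v: "innovation_var \<gamma> k ?c > 0" by (rule innovation_var_pos[OF pd ev Suc])
  have sum_eq: "(\<Sum>i=1..Suc k. durbin_levinson \<gamma> (Suc k) i * \<gamma> (int i - int j)) =
     (\<Sum>i=1..k. ?c i * \<gamma> (int i - int j)) - \<kappa> * (\<Sum>i=1..k. ?c i * \<gamma> (int k + 1 - int i - int j))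
       + \<kappa> * \<gamma> (int k + 1 - int j)" for j
  proof -
    have "(\<Sum>i=1..k. (?c i - \<kappa> * ?c (Suc k - i)) * \<gamma> (int i - int j)) =
      (\<Sum>i=1..k. ?c i * \<gamma> (int i - int j)) - \<kappa> * (\<Sum>i=1..k. ?c (Suc k - i) * \<gamma> (int i - int j))"
      by (simp add: left_diff_distrib sum_subtractf sum_distrib_left mult.assoc)
    thus ?thesis
      using sum_reverse[of "\<lambda>i h. ?c i * \<gamma> (h - int j)" k]
      by (simp add: \<kappa>_def[symmetric] add.commute)
  qed
  show ?case
    unfolding yule_walker_def
  proof
    fix j assume j: "j \<in> {1..Suc k}"
    have ev': "\<gamma> (int k + 1 - int i - int j) = \<gamma> (int i - (int k + 1 - int j))" for i
      using ev[of "int i - (int k + 1 - int j)"] by (simp add: algebra_simps)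
    show "(\<Sum>i=1..Suc k. durbin_levinson \<gamma> (Suc k) i * \<gamma> (int i - int j)) = \<gamma> (int j)"
    proof (cases "j = Suc k")
      case False
      have "(\<Sum>i=1..k. ?c i * \<gamma> (int i - int (Suc k - j))) = \<gamma> (int (Suc k - j))"
        using False j by (intro Suc[unfolded yule_walker_def, rule_format]) auto
      moreover have "(\<Sum>i=1..k. ?c i * \<gamma> (int i - int j)) = \<gamma> (int j)"
        using Suc False j unfolding yule_walker_def by auto
      ultimately show ?thesis using False j unfolding sum_eq ev' by (simp add: of_nat_diff add.commute)
    next
      case True
      have "\<gamma> (int i - int j) = \<gamma> (int k + 1 - int i)" for i
        using ev[of "int i - int j"] True by (simp add: algebra_simps)
      moreover have "\<kappa> * innovation_var \<gamma> k ?c = \<gamma> (int k + 1) - (\<Sum>i=1..k. ?c i * \<gamma> (int k + 1 - int i))"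
        using v by (simp add: \<kappa>_def reflection_def)
      ultimately show ?thesis unfolding sum_eq ev' using True
        by (simp add: innovation_var_def algebra_simps)
    qed
  qed
qed

text \<open>One step of the recursion multiplies the positive innovation variance by \<open>1 - \<kappa>\<^sup>2\<close>, which must therefore
  be positive.\<close>
lemma reflection_abs_le:
  assumes pd: "pos_def_seq \<gamma>" and ev: "\<And>h. \<gamma> (- h) = \<gamma> h"
  shows "\<bar>reflection \<gamma> k (durbin_levinson \<gamma> k)\<bar> \<le> 1"
proof -
  let ?c = "durbin_levinson \<gamma> k" and ?v = "innovation_var \<gamma> k (durbin_levinson \<gamma> k)"
  define \<kappa> where "\<kappa> = reflection \<gamma> k ?c"
  have v: "?v > 0" by (rule innovation_var_pos[OF pd ev durbin_levinson_yule_walker[OF pd ev]])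
  have v': "innovation_var \<gamma> (Suc k) (durbin_levinson \<gamma> (Suc k)) > 0"
    by (rule innovation_var_pos[OF pd ev durbin_levinson_yule_walker[OF pd ev]])
  have k: "\<kappa> * ?v = \<gamma> (int k + 1) - (\<Sum>i=1..k. ?c i * \<gamma> (int k + 1 - int i))"
    using v by (simp add: \<kappa>_def reflection_def)
  have "(\<Sum>i=1..k. (?c i - \<kappa> * ?c (Suc k - i)) * \<gamma> (int i)) =
      (\<Sum>i=1..k. ?c i * \<gamma> (int i)) - \<kappa> * (\<Sum>i=1..k. ?c (Suc k - i) * \<gamma> (int i))"
    by (simp add: left_diff_distrib sum_subtractf sum_distrib_left mult.assoc)
  hence "innovation_var \<gamma> (Suc k) (durbin_levinson \<gamma> (Suc k)) =
     ?v - \<kappa> * (\<gamma> (int k + 1) - (\<Sum>i=1..k. ?c i * \<gamma> (int k + 1 - int i)))"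
    using sum_reverse[of "\<lambda>i h. ?c i * \<gamma> h" k]
    by (simp add: innovation_var_def \<kappa>_def[symmetric] algebra_simps)
  also have "\<dots> = ?v * (1 - \<kappa>\<^sup>2)" unfolding k[symmetric] by (simp add: algebra_simps power2_eq_square)
  finally have "1 - \<kappa>\<^sup>2 > 0" using v v' by (simp add: zero_less_mult_iff)
  hence "\<bar>\<kappa>\<bar> \<le> 1" by (simp add: abs_square_le_1[symmetric])
  thus ?thesis by (simp add: \<kappa>_def)
qed

text \<open>Each step at most doubles the largest coefficient, because the reflection coefficient has modulus at
  most 1.\<close>
lemma durbin_levinson_bound:
  assumes pd: "pos_def_seq \<gamma>" and ev: "\<And>h. \<gamma> (- h) = \<gamma> h"
  shows "i \<in> {1..k} \<Longrightarrow> \<bar>durbin_levinson \<gamma> k i\<bar> \<le> 2 ^ k"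
proof (induction k arbitrary: i)
  case (Suc k)
  have r: "\<bar>reflection \<gamma> k (durbin_levinson \<gamma> k)\<bar> \<le> 1" by (rule reflection_abs_le[OF pd ev])
  show ?case
  proof (cases "i = Suc k")
    case True
    have "(1::real) \<le> 2 ^ Suc k" by (rule one_le_power) simp
    thus ?thesis using True r by simp
  next
    case False
    hence i: "i \<in> {1..k}" "Suc k - i \<in> {1..k}" using Suc.prems by auto
    have "\<bar>reflection \<gamma> k (durbin_levinson \<gamma> k) * durbin_levinson \<gamma> k (Suc k - i)\<bar> \<le> 1 * 2 ^ k"
      unfolding abs_mult using r Suc.IH[OF i(2)] by (intro mult_mono) auto
    thus ?thesis using Suc.IH[OF i(1)] False by simp
  qed
qed simp

lemma measurable_durbin_levinson:
  assumes [measurable]: "\<And>h. (\<lambda>\<omega>. \<gamma> \<omega> h) \<in> borel_measurable M"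
  shows "(\<lambda>\<omega>. durbin_levinson (\<gamma> \<omega>) k i) \<in> borel_measurable M"
proof (induction k arbitrary: i)
  case (Suc k)
  note [measurable] = Suc
  have [measurable]: "(\<lambda>\<omega>. reflection (\<gamma> \<omega>) k (durbin_levinson (\<gamma> \<omega>) k)) \<in> borel_measurable M"
    unfolding reflection_def innovation_var_def by measurable
  show ?case by (cases "i = Suc k") simp_all
qed simp

section \<open>Positive definiteness of the empirical autocovariances\<close>

text \<open>Written as a sum over pairs of observed times at distance \<open>h\<close>, the empirical autocovariance needs
  no distinction between positive and negative lags.\<close>
lemma emp_autocov_window:
  assumes "T \<ge> 1"
  shows "real T * emp_autocov T y h =
    (\<Sum>q\<in>{1..int T}. if q + h \<in> {1..int T} then y q * y (q + h) else 0)"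
proof -
  have "real T * emp_autocov T y h = (\<Sum>t\<in>{1..int T - \<bar>h\<bar>}. y t * y (t + \<bar>h\<bar>))"
    using assms by (simp add: emp_autocov_def)
  also have "\<dots> = (\<Sum>q\<in>{q \<in> {1..int T}. q + h \<in> {1..int T}}. y q * y (q + h))"
  proof (cases "h \<ge> 0")
    case True
    thus ?thesis by (intro sum.cong) auto
  next
    case False
    thus ?thesis
      by (intro sum.reindex_bij_witness[of _ "\<lambda>q. q + h" "\<lambda>q. q - h"]) (auto simp: mult.commute)
  qed
  also have "\<dots> = (\<Sum>q\<in>{1..int T}. if q + h \<in> {1..int T} then y q * y (q + h) else 0)"
    by (rule sum.inter_filter) simp
  finally show ?thesis .
qed

lemma emp_autocov_even: "emp_autocov T y (- h) = emp_autocov T y h"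
  by (simp add: emp_autocov_def)

text \<open>With \<open>z\<close> the observations extended by zero, \<open>T\<close> times the Toeplitz form is the sum of squares of the
  convolution of \<open>x\<close> with \<open>z\<close>. The product of the first nonzero entry of \<open>x\<close> with \<open>y 1\<close> is one
  of the entries of this convolution.\<close>
lemma emp_autocov_pos_def:
  assumes T: "T \<ge> 1" and y: "y 1 \<noteq> 0"
  shows "pos_def_seq (emp_autocov T y)"
  unfolding pos_def_seq_def
proof (intro allI impI)
  fix n and x :: "nat \<Rightarrow> real" assume ex: "\<exists>i\<in>{1..n}. x i \<noteq> 0"
  define z where "z = (\<lambda>q. if q \<in> {1..int T} then y q else 0)"
  define S where "S = {2..int T + int n}"
  have lag: "real T * emp_autocov T y (int i - int j) = (\<Sum>s\<in>S. z (s - int i) * z (s - int j))"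
    if "i \<in> {1..n}" "j \<in> {1..n}" for i j
  proof -
    have "real T * emp_autocov T y (int i - int j) =
        (\<Sum>q\<in>{1..int T}. z q * z (q + (int i - int j)))"
      unfolding emp_autocov_window[OF T] by (intro sum.cong) (auto simp: z_def)
    also have "\<dots> = (\<Sum>s\<in>{1 + int i..int T + int i}. z (s - int i) * z (s - int j))"
      by (rule sum.reindex_bij_witness[of _ "\<lambda>s. s - int i" "\<lambda>q. q + int i"]) (auto simp: algebra_simps)
    also have "\<dots> = (\<Sum>s\<in>S. z (s - int i) * z (s - int j))"
      using that by (intro sum.mono_neutral_left) (auto simp: S_def z_def)
    finally show ?thesis .
  qed
  have "real T * toeplitz_form (emp_autocov T y) n x =
     (\<Sum>i=1..n. \<Sum>j=1..n. x i * x j * (real T * emp_autocov T y (int i - int j)))"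
    by (simp add: toeplitz_form_def sum_distrib_left mult_ac)
  also have "\<dots> = (\<Sum>i=1..n. \<Sum>j=1..n. \<Sum>s\<in>S. (x i * z (s - int i)) * (x j * z (s - int j)))"
    by (intro sum.cong refl) (simp add: lag sum_distrib_left mult_ac)
  also have "\<dots> = (\<Sum>s\<in>S. \<Sum>i=1..n. \<Sum>j=1..n. (x i * z (s - int i)) * (x j * z (s - int j)))"
    by (simp only: sum.swap[where B = S])
  also have "\<dots> = (\<Sum>s\<in>S. (\<Sum>i=1..n. x i * z (s - int i))\<^sup>2)"
    by (simp add: power2_eq_square sum_product)
  finally have eq: "real T * toeplitz_form (emp_autocov T y) n x = (\<Sum>s\<in>S. (\<Sum>i=1..n. x i * z (s - int i))\<^sup>2)" .
  \<comment> \<open>Entries of \<open>x\<close> before \<open>i0\<close> vanish, and those after it meet \<open>z\<close> at times before 1.\<close>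
  define i0 where "i0 = (LEAST i. i \<in> {1..n} \<and> x i \<noteq> 0)"
  have i0: "i0 \<in> {1..n}" "x i0 \<noteq> 0" unfolding i0_def by (rule LeastI2_ex; use ex in blast)+
  have least: "x i = 0" if "i \<in> {1..n}" "i < i0" for i using not_less_Least[of i] that unfolding i0_def by blast
  have "(\<Sum>i=1..n. x i * z (int i0 + 1 - int i)) = (\<Sum>i=1..n. if i = i0 then x i0 * y 1 else 0)"
  proof (rule sum.cong[OF refl])
    fix i assume i: "i \<in> {1..n}"
    consider "i < i0" | "i = i0" | "i > i0" by linarith
    thus "x i * z (int i0 + 1 - int i) = (if i = i0 then x i0 * y 1 else 0)"
      by cases (use i least T in \<open>auto simp: z_def\<close>)
  qed
  hence "(\<Sum>i=1..n. x i * z (int i0 + 1 - int i)) = x i0 * y 1" using i0 by simp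
  moreover have "int i0 + 1 \<in> S" using i0 T by (auto simp: S_def)
  ultimately have "(\<Sum>s\<in>S. (\<Sum>i=1..n. x i * z (s - int i))\<^sup>2) > 0"
    using i0 y by (intro sum_pos2[of _ "int i0 + 1"]) (auto simp: S_def)
  thus "toeplitz_form (emp_autocov T y) n x > 0" unfolding eq[symmetric] using T by (simp add: zero_less_mult_iff)
qed

section \<open>Moments and integration by parts in a Gaussian space\<close>

text \<open>Random variables with finite moments of all orders form an algebra, which disposes of all questions of
  integrability in the Gaussian computations below.\<close>
definition all_moments :: "'a measure \<Rightarrow> ('a \<Rightarrow> real) \<Rightarrow> bool" where
  "all_moments M F \<longleftrightarrow> F \<in> borel_measurable M \<and> (\<forall>p::nat. integrable M (\<lambda>\<omega>. \<bar>F \<omega>\<bar> ^ p))"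

lemma all_moments_integrable: "all_moments M F \<Longrightarrow> integrable M F"
  unfolding all_moments_def by (rule integrable_abs_cancel) (auto dest!: spec[of _ 1])

lemma (in prob_space) all_moments_const: "all_moments M (\<lambda>_. c)"
  by (simp add: all_moments_def)

lemma abs_add_power_le: "\<bar>x + y\<bar> ^ p \<le> 2 ^ p * (\<bar>x\<bar> ^ p + \<bar>y\<bar> ^ p)" for x y :: real
proof -
  have "\<bar>x + y\<bar> \<le> 2 * max \<bar>x\<bar> \<bar>y\<bar>" by linarith
  hence "\<bar>x + y\<bar> ^ p \<le> (2 * max \<bar>x\<bar> \<bar>y\<bar>) ^ p" by (rule power_mono) simp
  also have "\<dots> = 2 ^ p * (max \<bar>x\<bar> \<bar>y\<bar>) ^ p" by (simp add: power_mult_distrib)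
  also have "(max \<bar>x\<bar> \<bar>y\<bar>) ^ p \<le> \<bar>x\<bar> ^ p + \<bar>y\<bar> ^ p" by (simp add: max_def)
  finally show ?thesis by simp
qed

lemma all_moments_add:
  assumes "all_moments M F" "all_moments M G"
  shows "all_moments M (\<lambda>\<omega>. F \<omega> + G \<omega>)"
  unfolding all_moments_def
proof (intro conjI allI)
  have [measurable]: "F \<in> borel_measurable M" "G \<in> borel_measurable M"
    using assms by (auto simp: all_moments_def)
  show "(\<lambda>\<omega>. F \<omega> + G \<omega>) \<in> borel_measurable M" by measurable
  fix p :: nat
  have "integrable M (\<lambda>\<omega>. 2 ^ p * (\<bar>F \<omega>\<bar> ^ p + \<bar>G \<omega>\<bar> ^ p))"
    using assms by (auto simp: all_moments_def)
  thus "integrable M (\<lambda>\<omega>. \<bar>F \<omega> + G \<omega>\<bar> ^ p)"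
    by (rule Bochner_Integration.integrable_bound) (auto intro!: AE_I2 abs_add_power_le order_trans[OF _ abs_ge_self])
qed

lemma all_moments_mult:
  assumes "all_moments M F" "all_moments M G"
  shows "all_moments M (\<lambda>\<omega>. F \<omega> * G \<omega>)"
  unfolding all_moments_def
proof (intro conjI allI)
  have [measurable]: "F \<in> borel_measurable M" "G \<in> borel_measurable M"
    using assms by (auto simp: all_moments_def)
  show "(\<lambda>\<omega>. F \<omega> * G \<omega>) \<in> borel_measurable M" by measurable
  fix p :: nat
  have 1: "integrable M (\<lambda>\<omega>. \<bar>F \<omega>\<bar> ^ (2*p) + \<bar>G \<omega>\<bar> ^ (2*p))"
    using assms by (auto simp: all_moments_def)
  have 2: "\<bar>x * y\<bar> ^ p \<le> \<bar>x\<bar> ^ (2*p) + \<bar>y\<bar> ^ (2*p)" for x y :: real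
  proof -
    have "u * w \<le> u\<^sup>2 + w\<^sup>2" for u w :: real
      using sum_squares_bound[of u w] zero_le_power2[of u] zero_le_power2[of w]
      by (smt (verit) zero_le_mult_iff mult_2 distrib_right)
    from this[of "\<bar>x\<bar> ^ p" "\<bar>y\<bar> ^ p"] show ?thesis
      by (simp only: abs_mult power_mult_distrib mult.commute[of 2 p] power_mult)
  qed
  show "integrable M (\<lambda>\<omega>. \<bar>F \<omega> * G \<omega>\<bar> ^ p)"
    by (rule Bochner_Integration.integrable_bound[OF 1]) (auto intro!: AE_I2 2 order_trans[OF _ abs_ge_self] simp del: abs_mult)
qed

lemma (in prob_space) all_moments_power: "all_moments M F \<Longrightarrow> all_moments M (\<lambda>\<omega>. F \<omega> ^ n)"
  by (induction n) (auto intro: all_moments_mult all_moments_const)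

lemma (in prob_space) all_moments_sum:
  "(\<And>i. i \<in> I \<Longrightarrow> all_moments M (F i)) \<Longrightarrow> all_moments M (\<lambda>\<omega>. \<Sum>i\<in>I. F i \<omega>)"
  by (induction I rule: infinite_finite_induct) (auto intro: all_moments_add all_moments_const)

lemma (in prob_space) all_moments_scale: "all_moments M F \<Longrightarrow> all_moments M (\<lambda>\<omega>. c * F \<omega>)"
  by (intro all_moments_mult all_moments_const)

lemma (in prob_space) all_moments_diff:
  "all_moments M F \<Longrightarrow> all_moments M G \<Longrightarrow> all_moments M (\<lambda>\<omega>. F \<omega> - G \<omega>)"
  using all_moments_add[OF _ all_moments_scale[of G "-1"]] by simp

lemmas (in prob_space) all_moments_intros =
  all_moments_const all_moments_add all_moments_mult all_moments_power all_moments_sum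
  all_moments_scale all_moments_diff

text \<open>By the binomial theorem the expectation is a polynomial in \<open>s\<close>; its linear coefficient extracts the
  variable \<open>U\<close> from a power. This polarization device turns identities for powers of a single Gaussian
  variable into identities for products of different ones.\<close>
lemma (in prob_space) deriv_expectation_power:
  assumes "all_moments M P" "all_moments M L" "all_moments M U"
  shows "((\<lambda>s. expectation (\<lambda>\<omega>. P \<omega> * (L \<omega> + s * U \<omega>) ^ n))
           has_real_derivative real n * expectation (\<lambda>\<omega>. P \<omega> * U \<omega> * L \<omega> ^ (n - 1))) (at 0)"
proof -
  let ?e = "\<lambda>m. expectation (\<lambda>\<omega>. P \<omega> * U \<omega> ^ m * L \<omega> ^ (n - m))"
  have i: "integrable M (\<lambda>\<omega>. P \<omega> * U \<omega> ^ m * L \<omega> ^ (n - m))" for m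
    by (intro all_moments_integrable all_moments_intros assms)
  have eq: "expectation (\<lambda>\<omega>. P \<omega> * (L \<omega> + s * U \<omega>) ^ n)
      = (\<Sum>m\<le>n. real (n choose m) * ?e m * s ^ m)" for s
  proof -
    have "P \<omega> * (L \<omega> + s * U \<omega>) ^ n
        = (\<Sum>m\<le>n. real (n choose m) * s ^ m * (P \<omega> * U \<omega> ^ m * L \<omega> ^ (n - m)))" for \<omega>
      by (subst add.commute, subst binomial_ring)
         (simp add: sum_distrib_left power_mult_distrib mult_ac)
    hence "expectation (\<lambda>\<omega>. P \<omega> * (L \<omega> + s * U \<omega>) ^ n)
        = (\<Sum>m\<le>n. expectation (\<lambda>\<omega>. real (n choose m) * s ^ m * (P \<omega> * U \<omega> ^ m * L \<omega> ^ (n - m))))"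
      using i by (subst Bochner_Integration.integral_sum[symmetric]) auto
    also have "\<dots> = (\<Sum>m\<le>n. real (n choose m) * ?e m * s ^ m)"
      by (subst Bochner_Integration.integral_mult_right_zero) (simp add: mult_ac)
    finally show ?thesis .
  qed
  have "((\<lambda>s. \<Sum>m\<le>n. real (n choose m) * ?e m * s ^ m) has_real_derivative
      (\<Sum>m\<le>n. real (n choose m) * ?e m * (real m * 0 ^ (m - 1)))) (at 0)"
    by (auto intro!: derivative_eq_intros sum.cong)
  moreover have "(\<Sum>m\<le>n. real (n choose m) * ?e m * (real m * 0 ^ (m - 1))) = real n * ?e 1"
  proof (cases n)
    case (Suc k)
    have "(\<Sum>m\<le>n. real (n choose m) * ?e m * (real m * 0 ^ (m - 1)))
        = (\<Sum>m\<le>n. if m = 1 then real n * ?e 1 else 0)"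
    proof (rule sum.cong[OF refl], goal_cases)
      case (1 m)
      show ?case
      proof (cases "m = 0 \<or> m = 1")
        case False
        hence "m - 1 \<noteq> 0" by auto
        thus ?thesis using False by simp
      qed auto
    qed
    thus ?thesis using Suc by simp
  qed simp
  ultimately show ?thesis unfolding eq by simp
qed

text \<open>A linear space of centred normal variables, including degenerate ones. Only the one-dimensional
  laws of its members are prescribed; joint moments follow by polarization.\<close>
locale gaussian_space = prob_space M for M :: "'a measure" +
  fixes G :: "('a \<Rightarrow> real) set"
  assumes measurable_G: "U \<in> G \<Longrightarrow> U \<in> borel_measurable M"
    and add_G: "U \<in> G \<Longrightarrow> V \<in> G \<Longrightarrow> (\<lambda>\<omega>. U \<omega> + V \<omega>) \<in> G"
    and scale_G: "U \<in> G \<Longrightarrow> (\<lambda>\<omega>. c * U \<omega>) \<in> G"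
    and normal_G: "U \<in> G \<Longrightarrow> (AE \<omega> in M. U \<omega> = 0) \<or>
      (\<exists>s>0. distributed M lborel U (normal_density 0 s))"
begin

lemma moments_G:
  assumes U: "U \<in> G"
  shows "all_moments M U"
    and "expectation U = 0"
    and "expectation (\<lambda>\<omega>. U \<omega> ^ (n + 2)) =
           real (n + 1) * expectation (\<lambda>\<omega>. (U \<omega>)\<^sup>2) * expectation (\<lambda>\<omega>. U \<omega> ^ n)"
proof -
  let ?rec = "expectation (\<lambda>\<omega>. U \<omega> ^ (n + 2)) =
    real (n + 1) * expectation (\<lambda>\<omega>. (U \<omega>)\<^sup>2) * expectation (\<lambda>\<omega>. U \<omega> ^ n)"
  have [measurable]: "U \<in> borel_measurable M" using measurable_G[OF U] .
  consider "AE \<omega> in M. U \<omega> = 0" | s where "s > 0" "distributed M lborel U (normal_density 0 s)"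
    using normal_G[OF U] by auto
  hence "all_moments M U \<and> expectation U = 0 \<and> ?rec"
  proof cases
    case 1
    have "integrable M (\<lambda>\<omega>. \<bar>U \<omega>\<bar> ^ p)" for p
    proof -
      have "AE \<omega> in M. 0 ^ p = \<bar>U \<omega>\<bar> ^ p" using 1 by eventually_elim auto
      thus ?thesis by (subst integrable_cong_AE[of _ _ "\<lambda>_. 0 ^ p"]) auto
    qed
    moreover have "expectation (\<lambda>\<omega>. U \<omega> ^ (n + 1)) = expectation (\<lambda>_. 0)" for n
      by (rule integral_cong_AE) (use 1 in auto)
    from this[of 0] this[of 1] this[of "n+1"] have "expectation U = 0"
        "expectation (\<lambda>\<omega>. (U \<omega>)\<^sup>2) = 0" "expectation (\<lambda>\<omega>. U \<omega> ^ (n + 2)) = 0"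
      by (simp_all add: power2_eq_square)
    ultimately show ?thesis by (simp add: all_moments_def)
  next
    case (2 s)
    have d: "distributed M lborel U (normal_density 0 s)" by fact
    have "integrable M (\<lambda>\<omega>. \<bar>U \<omega>\<bar> ^ p)" for p
      using integrable_normal_moment_abs[OF 2(1), of 0 p]
      by (subst distributed_integrable[OF d, of "\<lambda>x. \<bar>x\<bar> ^ p", symmetric]) auto
    hence am: "all_moments M U" by (auto simp: all_moments_def)
    have e: "expectation (\<lambda>\<omega>. U \<omega> ^ p) = (\<integral>x. normal_density 0 s x * x ^ p \<partial>lborel)" for p
      by (subst distributed_integral[OF d, symmetric]) auto
    have ev: "expectation (\<lambda>\<omega>. U \<omega> ^ (2 * k)) = fact (2 * k) / ((2 / s\<^sup>2)^k * fact k)" for k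
      using integral_normal_moment_even[OF 2(1), of 0 k] by (simp add: e)
    have od: "expectation (\<lambda>\<omega>. U \<omega> ^ (2 * k + 1)) = 0" for k
      using integral_normal_moment_odd[OF 2(1), of 0 k] by (simp only: e diff_0_right)
    have v: "expectation (\<lambda>\<omega>. (U \<omega>)\<^sup>2) = s\<^sup>2"
      using ev[of 1] by simp
    have "?rec"
    proof (cases "even n")
      case True
      then obtain k where n: "n = 2 * k" by (rule evenE)
      have n2: "n + 2 = 2 * (k + 1)" using n by simp
      have f2: "(fact (2 * (k + 1)) :: real) = (2 * (real k + 1)) * (2 * real k + 1) * fact (2 * k)"
        by (simp add: algebra_simps)
      have f1: "(fact (k + 1) :: real) = (real k + 1) * fact k"
        by (simp add: algebra_simps)
      have alg: "(2 * r) * u * F / ((2 / q) * P * (r * f)) = u * q * (F / (P * f))"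
        if "r > 0" "q > 0" "P > 0" "f > 0" for r u F q P f :: real
        using that by (simp add: field_simps)
      have "fact (2 * (k + 1)) / ((2 / s\<^sup>2) ^ (k + 1) * fact (k + 1)) =
          (2 * real k + 1) * s\<^sup>2 * (fact (2 * k) / ((2 / s\<^sup>2) ^ k * fact k))"
        unfolding f1 f2 power_add power_one_right mult.commute[of "(2 / s\<^sup>2) ^ k" "2 / s\<^sup>2"]
        by (rule alg) (use 2(1) in auto)
      moreover have "real (n + 1) = 2 * real k + 1" using n by simp
      ultimately show ?thesis unfolding v n2 ev by (simp only: n ev)
    next
      case False
      then obtain k where n: "n = 2 * k + 1" by (rule oddE)
      have n2: "n + 2 = 2 * (k + 1) + 1" using n by simp
      have "expectation (\<lambda>\<omega>. U \<omega> ^ (n + 2)) = 0" "expectation (\<lambda>\<omega>. U \<omega> ^ n) = 0"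
        unfolding n2 by (rule od) (simp only: n od)
      thus ?thesis by simp
    qed
    moreover have "expectation U = 0" using od[of 0] by simp
    ultimately show ?thesis using am by simp
  qed
  thus "all_moments M U" "expectation U = 0" "?rec" by blast+
qed

text \<open>The recursion for the moments of the normal variable \<open>L + s Z\<close> is differentiated at \<open>s = 0\<close>.\<close>
lemma stein_power:
  assumes L: "L \<in> G" and Z: "Z \<in> G"
  shows "expectation (\<lambda>\<omega>. Z \<omega> * L \<omega> ^ n) =
           real n * expectation (\<lambda>\<omega>. Z \<omega> * L \<omega>) * expectation (\<lambda>\<omega>. L \<omega> ^ (n - 1))"
proof (induction n rule: less_induct)
  case (less n)
  note am = moments_G(1)[OF L] moments_G(1)[OF Z] all_moments_const[of 1]
  show ?case
  proof (cases n)
    case 0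
    thus ?thesis using moments_G(2)[OF Z] by simp
  next
    case (Suc k)
    let ?c = "expectation (\<lambda>\<omega>. Z \<omega> * L \<omega>)" and ?q = "expectation (\<lambda>\<omega>. (L \<omega>)\<^sup>2)"
    let ?M = "\<lambda>n. expectation (\<lambda>\<omega>. L \<omega> ^ n)" and ?D = "\<lambda>n. expectation (\<lambda>\<omega>. Z \<omega> * L \<omega> ^ n)"
    have d: "((\<lambda>s. expectation (\<lambda>\<omega>. (L \<omega> + s * Z \<omega>) ^ j))
           has_real_derivative real j * ?D (j - 1)) (at 0)" for j
      using deriv_expectation_power[OF am(3,1,2), of j] by simp
    have "(\<lambda>\<omega>. L \<omega> + s * Z \<omega>) \<in> G" for s by (intro add_G scale_G L Z)
    from moments_G(3)[OF this] have eq: "(\<lambda>s. expectation (\<lambda>\<omega>. (L \<omega> + s * Z \<omega>) ^ (k + 2))) =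
       (\<lambda>s. real (k + 1) * (expectation (\<lambda>\<omega>. (L \<omega> + s * Z \<omega>) ^ 2) *
             expectation (\<lambda>\<omega>. (L \<omega> + s * Z \<omega>) ^ k)))"
      by (simp add: fun_eq_iff mult.assoc)
    have "((\<lambda>s. real (k + 1) * (expectation (\<lambda>\<omega>. (L \<omega> + s * Z \<omega>) ^ 2) *
             expectation (\<lambda>\<omega>. (L \<omega> + s * Z \<omega>) ^ k))) has_real_derivative
         real (k + 1) * ((2 * ?c) * ?M k + (real k * ?D (k - 1)) * ?q)) (at 0)"
      using DERIV_cmult[OF DERIV_mult[OF d[of 2] d[of k]], of "real (k + 1)"] by simp
    with d[of "k + 2"] have e1: "real (k + 2) * ?D (k + 1) =
         real (k + 1) * ((2 * ?c) * ?M k + (real k * ?D (k - 1)) * ?q)"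
      using DERIV_unique[OF d[of "k + 2", unfolded eq]] by fastforce
    have e2: "real k * ?D (k - 1) * ?q = real k * ?c * ?M k"
    proof (cases "k \<le> 1")
      case True
      hence "k = 0 \<or> k = 1" by auto
      thus ?thesis using moments_G(2)[OF Z] moments_G(2)[OF L] by auto
    next
      case False
      then obtain j where j: "k = j + 2" by (auto simp: not_le dest!: less_imp_Suc_add)
      have "?D (k - 1) = real (k - 1) * ?c * ?M (k - 1 - 1)" using less.IH[of "k - 1"] Suc by simp
      moreover have "?M k = real (j + 1) * ?q * ?M j" using moments_G(3)[OF L, of j] j by simp
      ultimately show ?thesis using j by simp
    qed
    have "real (k + 2) * ?D (k + 1) = real (k + 2) * (real (k + 1) * ?c * ?M k)"
      unfolding e1 e2 by (simp add: algebra_simps)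
    hence "?D (k + 1) = real (k + 1) * ?c * ?M k" by (simp only: mult_cancel_left) auto
    thus ?thesis using Suc by simp
  qed
qed

text \<open>\<open>F\<close> is a polynomial in members of \<open>G\<close>, and \<open>D\<close> is its derivative in the direction in which each \<open>U\<close>
  grows at the rate \<open>E (Z * U)\<close>. A relation is used because the same random variable may have many
  representations as a polynomial, with different formal derivatives.\<close>
inductive poly_deriv :: "('a \<Rightarrow> real) \<Rightarrow> ('a \<Rightarrow> real) \<Rightarrow> ('a \<Rightarrow> real) \<Rightarrow> bool" for Z where
  poly_deriv_const: "poly_deriv Z (\<lambda>_. c) (\<lambda>_. 0)"
| poly_deriv_lmult: "poly_deriv Z F D \<Longrightarrow> U \<in> G \<Longrightarrow>
    poly_deriv Z (\<lambda>\<omega>. U \<omega> * F \<omega>) (\<lambda>\<omega>. expectation (\<lambda>\<omega>. Z \<omega> * U \<omega>) * F \<omega> + U \<omega> * D \<omega>)"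
| poly_deriv_add: "poly_deriv Z F D \<Longrightarrow> poly_deriv Z F' D' \<Longrightarrow>
    poly_deriv Z (\<lambda>\<omega>. F \<omega> + F' \<omega>) (\<lambda>\<omega>. D \<omega> + D' \<omega>)"

lemma poly_deriv_linear: "U \<in> G \<Longrightarrow> poly_deriv Z U (\<lambda>_. expectation (\<lambda>\<omega>. Z \<omega> * U \<omega>))"
  using poly_deriv_lmult[OF poly_deriv_const[of Z 1], of U] by simp

lemma poly_deriv_scale: "poly_deriv Z F D \<Longrightarrow> poly_deriv Z (\<lambda>\<omega>. c * F \<omega>) (\<lambda>\<omega>. c * D \<omega>)"
proof (induction rule: poly_deriv.induct)
  case (poly_deriv_const c')
  show ?case using poly_deriv.poly_deriv_const[of Z "c * c'"] by simp
next
  case (poly_deriv_lmult F D U)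
  show ?case using poly_deriv.poly_deriv_lmult[OF poly_deriv_lmult.IH poly_deriv_lmult.hyps(2)] by (simp add: algebra_simps)
next
  case (poly_deriv_add F D F' D')
  show ?case using poly_deriv.poly_deriv_add[OF poly_deriv_add.IH] by (simp add: algebra_simps)
qed

lemma poly_deriv_mult:
  assumes "poly_deriv Z F D" and FD': "poly_deriv Z F' D'"
  shows "poly_deriv Z (\<lambda>\<omega>. F \<omega> * F' \<omega>) (\<lambda>\<omega>. D \<omega> * F' \<omega> + F \<omega> * D' \<omega>)"
  using assms(1)
proof (induction rule: poly_deriv.induct)
  case (poly_deriv_const c)
  show ?case using poly_deriv_scale[OF FD', of c] by simp
next
  case (poly_deriv_lmult F D U)
  show ?case using poly_deriv.poly_deriv_lmult[OF poly_deriv_lmult.IH poly_deriv_lmult.hyps(2)] by (simp add: algebra_simps)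
next
  case (poly_deriv_add F D F'' D'')
  show ?case using poly_deriv.poly_deriv_add[OF poly_deriv_add.IH] by (simp add: algebra_simps)
qed

lemma poly_deriv_sum:
  "(\<And>i. i \<in> I \<Longrightarrow> poly_deriv Z (F i) (D i)) \<Longrightarrow> poly_deriv Z (\<lambda>\<omega>. \<Sum>i\<in>I. F i \<omega>) (\<lambda>\<omega>. \<Sum>i\<in>I. D i \<omega>)"
  by (induction I rule: infinite_finite_induct) (auto intro: poly_deriv_add poly_deriv_const)

lemma poly_deriv_moments: "poly_deriv Z F D \<Longrightarrow> all_moments M F \<and> all_moments M D"
  by (induction rule: poly_deriv.induct) (use moments_G(1) in \<open>auto intro!: all_moments_intros\<close>)

text \<open>Induction on the polynomial \<open>F\<close>. A new linear factor \<open>U\<close> arises by replacing \<open>L\<close> by \<open>L + s U\<close> in the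
  induction hypothesis for the exponent \<open>n + 1\<close> and differentiating at \<open>s = 0\<close>; the power of \<open>L\<close> is carried
  along only to make this step possible.\<close>
lemma stein_times_power:
  assumes "poly_deriv Z F D" and Z: "Z \<in> G"
  shows "L \<in> G \<Longrightarrow> expectation (\<lambda>\<omega>. Z \<omega> * F \<omega> * L \<omega> ^ n) = expectation (\<lambda>\<omega>. D \<omega> * L \<omega> ^ n) +
     real n * expectation (\<lambda>\<omega>. Z \<omega> * L \<omega>) * expectation (\<lambda>\<omega>. F \<omega> * L \<omega> ^ (n - 1))"
  using assms(1)
proof (induction arbitrary: L n rule: poly_deriv.induct)
  case (poly_deriv_const c)
  show ?case using stein_power[OF poly_deriv_const.prems Z, of n]
    by (simp add: mult.commute[of _ c] mult.left_commute[of _ c] mult.assoc)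
next
  case (poly_deriv_add F D F' D')
  note am = poly_deriv_moments[OF poly_deriv_add.hyps(1)] poly_deriv_moments[OF poly_deriv_add.hyps(2)]
    moments_G(1)[OF Z] moments_G(1)[OF poly_deriv_add.prems]
  have i: "integrable M (\<lambda>\<omega>. Z \<omega> * F \<omega> * L \<omega> ^ j)" "integrable M (\<lambda>\<omega>. Z \<omega> * F' \<omega> * L \<omega> ^ j)"
    "integrable M (\<lambda>\<omega>. D \<omega> * L \<omega> ^ j)" "integrable M (\<lambda>\<omega>. D' \<omega> * L \<omega> ^ j)"
    "integrable M (\<lambda>\<omega>. F \<omega> * L \<omega> ^ j)" "integrable M (\<lambda>\<omega>. F' \<omega> * L \<omega> ^ j)" for j
    using am by (auto intro!: all_moments_integrable intro: all_moments_intros)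
  show ?case
    using poly_deriv_add.IH[OF poly_deriv_add.prems, of n]
    by (simp only: distrib_left distrib_right Bochner_Integration.integral_add[OF i(1,2)]
        Bochner_Integration.integral_add[OF i(3,4)] Bochner_Integration.integral_add[OF i(5,6)])
next
  case (poly_deriv_lmult F D U)
  note L = poly_deriv_lmult.prems and U = poly_deriv_lmult.hyps(2)
  note am = poly_deriv_moments[OF poly_deriv_lmult.hyps(1)] moments_G(1)[OF Z] moments_G(1)[OF L] moments_G(1)[OF U]
  let ?m = "real (n + 1)"
  let ?zl = "expectation (\<lambda>\<omega>. Z \<omega> * L \<omega>)" and ?zu = "expectation (\<lambda>\<omega>. Z \<omega> * U \<omega>)"
    and ?fl = "expectation (\<lambda>\<omega>. F \<omega> * L \<omega> ^ n)"
    and ?dl = "expectation (\<lambda>\<omega>. D \<omega> * U \<omega> * L \<omega> ^ n)"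
    and ?fu = "expectation (\<lambda>\<omega>. F \<omega> * U \<omega> * L \<omega> ^ (n - 1))"
  have amF: "all_moments M F" "all_moments M D" "all_moments M (\<lambda>\<omega>. Z \<omega> * F \<omega>)"
    using am by (auto intro: all_moments_intros)
  have LU: "(\<lambda>\<omega>. L \<omega> + s * U \<omega>) \<in> G" for s by (intro add_G scale_G L U)
  have iZ: "integrable M (\<lambda>\<omega>. Z \<omega> * L \<omega>)" "integrable M (\<lambda>\<omega>. Z \<omega> * U \<omega>)"
    using am by (auto intro!: all_moments_integrable intro: all_moments_intros)
  have c: "expectation (\<lambda>\<omega>. Z \<omega> * (L \<omega> + s * U \<omega>)) =
      ?zl + s * ?zu" for s
    using iZ by (simp add: distrib_left mult.left_commute[of _ s])
  have IH: "expectation (\<lambda>\<omega>. Z \<omega> * F \<omega> * (L \<omega> + s * U \<omega>) ^ (n + 1)) =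
     expectation (\<lambda>\<omega>. D \<omega> * (L \<omega> + s * U \<omega>) ^ (n + 1)) +
     ?m * ((?zl + s * ?zu)
        * expectation (\<lambda>\<omega>. F \<omega> * (L \<omega> + s * U \<omega>) ^ n))" for s
    using poly_deriv_lmult.IH[OF LU, of s "n + 1"] by (simp only: c mult.assoc add_diff_cancel_right')
  have eq: "(\<lambda>s. expectation (\<lambda>\<omega>. Z \<omega> * F \<omega> * (L \<omega> + s * U \<omega>) ^ (n + 1))) =
     (\<lambda>s. expectation (\<lambda>\<omega>. D \<omega> * (L \<omega> + s * U \<omega>) ^ (n + 1)) +
     ?m * ((?zl + s * ?zu)
        * expectation (\<lambda>\<omega>. F \<omega> * (L \<omega> + s * U \<omega>) ^ n)))"
    unfolding IH ..
  have d1: "((\<lambda>s. expectation (\<lambda>\<omega>. Z \<omega> * F \<omega> * (L \<omega> + s * U \<omega>) ^ (n + 1))) has_real_derivative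
      ?m * expectation (\<lambda>\<omega>. Z \<omega> * F \<omega> * U \<omega> * L \<omega> ^ n)) (at 0)"
    using deriv_expectation_power[of "\<lambda>\<omega>. Z \<omega> * F \<omega>" L U "n + 1"] am amF by simp
  have dl: "((\<lambda>s. ?zl + s * ?zu)
      has_real_derivative ?zu) (at 0)"
    by (auto intro!: derivative_eq_intros)
  have d2: "((\<lambda>s. expectation (\<lambda>\<omega>. D \<omega> * (L \<omega> + s * U \<omega>) ^ (n + 1)) +
     ?m * ((?zl + s * ?zu)
        * expectation (\<lambda>\<omega>. F \<omega> * (L \<omega> + s * U \<omega>) ^ n))) has_real_derivative
     ?m * ?dl +
     ?m * (?zu * ?fl +
       (real n * ?fu) * ?zl)) (at 0)"
    using DERIV_add[OF deriv_expectation_power[of D L U "n + 1"]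
        DERIV_cmult[OF DERIV_mult[OF dl deriv_expectation_power[of F L U n]], of ?m]] am amF
    by simp
  have "?m * expectation (\<lambda>\<omega>. Z \<omega> * F \<omega> * U \<omega> * L \<omega> ^ n) =
     ?m * (?dl +
       (?zu * ?fl +
       (real n * ?fu) * ?zl))"
    using DERIV_unique[OF d1[unfolded eq] d2] by (simp only: distrib_left)
  hence main: "expectation (\<lambda>\<omega>. Z \<omega> * F \<omega> * U \<omega> * L \<omega> ^ n) =
     (?dl +
       (?zu * ?fl +
       (real n * ?fu) * ?zl))"
    by (simp only: mult_cancel_left) auto
  have i: "integrable M (\<lambda>\<omega>. F \<omega> * L \<omega> ^ n)" "integrable M (\<lambda>\<omega>. D \<omega> * U \<omega> * L \<omega> ^ n)"
    using am by (auto intro!: all_moments_integrable intro: all_moments_intros)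
  have sp: "expectation (\<lambda>\<omega>. (?zu * F \<omega> + U \<omega> * D \<omega>) * L \<omega> ^ n) =
    ?zu * ?fl + ?dl"
  proof -
    have "(?zu * F \<omega> + U \<omega> * D \<omega>) * L \<omega> ^ n =
      ?zu * (F \<omega> * L \<omega> ^ n) + D \<omega> * U \<omega> * L \<omega> ^ n" for \<omega>
      by (simp add: algebra_simps)
    thus ?thesis using i by simp
  qed
  show ?case unfolding sp using main by (simp add: mult_ac)
qed

lemma stein:
  assumes "poly_deriv Z F D" "Z \<in> G"
  shows "expectation (\<lambda>\<omega>. Z \<omega> * F \<omega>) = expectation D"
  using stein_times_power[OF assms(1,2,2), of 0] by simp

lemma isserlis:
  assumes "A \<in> G" "B \<in> G" "C \<in> G" "D \<in> G"
  shows "expectation (\<lambda>\<omega>. A \<omega> * (B \<omega> * (C \<omega> * D \<omega>))) =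
     expectation (\<lambda>\<omega>. A \<omega> * B \<omega>) * expectation (\<lambda>\<omega>. C \<omega> * D \<omega>) +
     expectation (\<lambda>\<omega>. A \<omega> * C \<omega>) * expectation (\<lambda>\<omega>. B \<omega> * D \<omega>) +
     expectation (\<lambda>\<omega>. A \<omega> * D \<omega>) * expectation (\<lambda>\<omega>. B \<omega> * C \<omega>)"
proof -
  have i: "integrable M (\<lambda>\<omega>. C \<omega> * D \<omega>)" "integrable M (\<lambda>\<omega>. B \<omega> * D \<omega>)" "integrable M (\<lambda>\<omega>. B \<omega> * C \<omega>)"
    using assms by (auto intro!: all_moments_integrable intro: all_moments_intros moments_G(1))
  let ?E = "\<lambda>U V. expectation (\<lambda>\<omega>. U \<omega> * V \<omega>)"
  have "expectation (\<lambda>\<omega>. A \<omega> * (B \<omega> * (C \<omega> * D \<omega>))) =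
    expectation (\<lambda>\<omega>. ?E A B * (C \<omega> * D \<omega>) + B \<omega> * (?E A C * D \<omega> + C \<omega> * ?E A D))"
    by (rule stein[OF poly_deriv_lmult[OF poly_deriv_lmult[OF poly_deriv_linear[OF assms(4)] assms(3)] assms(2)] assms(1)])
  also have "\<dots> = expectation (\<lambda>\<omega>. ?E A B * (C \<omega> * D \<omega>) + (?E A C * (B \<omega> * D \<omega>) + ?E A D * (B \<omega> * C \<omega>)))"
    by (intro arg_cong[where f = expectation]) (simp add: fun_eq_iff algebra_simps)
  also have "\<dots> = ?E A B * ?E C D + (?E A C * ?E B D + ?E A D * ?E B C)"
    using i by simp
  finally show ?thesis by simp
qed

end

lemma integral_double_sum:
  fixes F :: "'b \<Rightarrow> 'c \<Rightarrow> 'a \<Rightarrow> real"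
  assumes "\<And>p q. p \<in> P \<Longrightarrow> q \<in> Q \<Longrightarrow> integrable M (F p q)"
  shows "(\<integral>\<omega>. (\<Sum>p\<in>P. \<Sum>q\<in>Q. c p q * F p q \<omega>) \<partial>M) = (\<Sum>p\<in>P. \<Sum>q\<in>Q. c p q * (\<integral>\<omega>. F p q \<omega> \<partial>M))"
proof -
  have "(\<integral>\<omega>. (\<Sum>p\<in>P. \<Sum>q\<in>Q. c p q * F p q \<omega>) \<partial>M) = (\<Sum>p\<in>P. (\<integral>\<omega>. (\<Sum>q\<in>Q. c p q * F p q \<omega>) \<partial>M))"
    using assms by (intro Bochner_Integration.integral_sum) auto
  also have "\<dots> = (\<Sum>p\<in>P. \<Sum>q\<in>Q. (\<integral>\<omega>. c p q * F p q \<omega> \<partial>M))"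
    using assms by (intro sum.cong refl Bochner_Integration.integral_sum) auto
  finally show ?thesis by simp
qed

context gaussian_space begin

lemma bilinear_second_moment:
  assumes "\<And>p. p \<in> P \<Longrightarrow> A p \<in> G" "\<And>p. p \<in> P \<Longrightarrow> B p \<in> G"
  shows "expectation (\<lambda>\<omega>. (\<Sum>p\<in>P. c p * (A p \<omega> * B p \<omega>))\<^sup>2) =
    (\<Sum>p\<in>P. c p * expectation (\<lambda>\<omega>. A p \<omega> * B p \<omega>))\<^sup>2 +
    (\<Sum>p\<in>P. \<Sum>q\<in>P. c p * c q *
        (expectation (\<lambda>\<omega>. A p \<omega> * A q \<omega>) * expectation (\<lambda>\<omega>. B p \<omega> * B q \<omega>)
         + expectation (\<lambda>\<omega>. A p \<omega> * B q \<omega>) * expectation (\<lambda>\<omega>. B p \<omega> * A q \<omega>)))"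
proof -
  let ?E = "\<lambda>U V. expectation (\<lambda>\<omega>. U \<omega> * V \<omega>)"
  have i: "integrable M (\<lambda>\<omega>. A p \<omega> * (B p \<omega> * (A q \<omega> * B q \<omega>)))" if "p \<in> P" "q \<in> P" for p q
    using assms that by (intro all_moments_integrable all_moments_intros moments_G(1)) auto
  have "expectation (\<lambda>\<omega>. (\<Sum>p\<in>P. c p * (A p \<omega> * B p \<omega>))\<^sup>2) =
    expectation (\<lambda>\<omega>. \<Sum>p\<in>P. \<Sum>q\<in>P. c p * c q * (A p \<omega> * (B p \<omega> * (A q \<omega> * B q \<omega>))))"
    unfolding power2_eq_square sum_product
    by (intro Bochner_Integration.integral_cong refl sum.cong) (simp add: mult_ac)
  also have "\<dots> = (\<Sum>p\<in>P. \<Sum>q\<in>P. c p * c q * expectation (\<lambda>\<omega>. A p \<omega> * (B p \<omega> * (A q \<omega> * B q \<omega>))))"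
    using i by (intro integral_double_sum)
  also have "\<dots> = (\<Sum>p\<in>P. \<Sum>q\<in>P. (c p * ?E (A p) (B p)) * (c q * ?E (A q) (B q)) +
     c p * c q * (?E (A p) (A q) * ?E (B p) (B q) + ?E (A p) (B q) * ?E (B p) (A q)))"
    using assms by (intro sum.cong refl) (simp add: isserlis algebra_simps)
  also have "\<dots> = (\<Sum>p\<in>P. c p * ?E (A p) (B p))\<^sup>2 + (\<Sum>p\<in>P. \<Sum>q\<in>P. c p * c q *
     (?E (A p) (A q) * ?E (B p) (B q) + ?E (A p) (B q) * ?E (B p) (A q)))"
    by (simp only: sum.distrib power2_eq_square sum_product)
  finally show ?thesis .
qed

text \<open>Integration by parts in one factor of each square gives \<open>E S^4 = 6 E (Q S\<^sup>2)\<close> with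
  \<open>Q = \<Sum> \<Gamma> p q * W p * W q\<close>. Since \<open>6 Q S\<^sup>2 \<le> 18 Q\<^sup>2 + S^4 / 2\<close>, the fourth moment is at most
  \<open>36 E Q\<^sup>2\<close>, and Isserlis' formula bounds \<open>E Q\<^sup>2\<close> by three times the square of \<open>\<Sum> (\<Gamma> p q)\<^sup>2\<close>.\<close>
lemma sum_squares_fourth_moment:
  assumes W: "\<And>p. p \<in> J \<Longrightarrow> W p \<in> G" and fin: "finite J"
  defines "\<Gamma> \<equiv> \<lambda>p q. expectation (\<lambda>\<omega>. W p \<omega> * W q \<omega>)"
  shows "expectation (\<lambda>\<omega>. (\<Sum>p\<in>J. (W p \<omega>)\<^sup>2 - \<Gamma> p p) ^ 4) \<le> 108 * (\<Sum>p\<in>J. \<Sum>q\<in>J. (\<Gamma> p q)\<^sup>2)\<^sup>2"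
proof -
  define S where "S = (\<lambda>\<omega>. \<Sum>p\<in>J. (W p \<omega>)\<^sup>2 - \<Gamma> p p)"
  define D where "D = (\<lambda>t \<omega>. \<Sum>p\<in>J. 2 * (\<Gamma> t p * W p \<omega>))"
  define Q where "Q = (\<lambda>\<omega>. \<Sum>z\<in>J\<times>J. \<Gamma> (fst z) (snd z) * (W (fst z) \<omega> * W (snd z) \<omega>))"
  have Qe: "Q \<omega> = (\<Sum>t\<in>J. \<Sum>p\<in>J. \<Gamma> t p * (W t \<omega> * W p \<omega>))" for \<omega>
    by (simp add: Q_def sum.cartesian_product case_prod_beta')
  define K where "K = (\<Sum>p\<in>J. \<Sum>q\<in>J. (\<Gamma> p q)\<^sup>2)"
  have sym: "\<Gamma> p q = \<Gamma> q p" for p q by (simp add: \<Gamma>_def mult.commute)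
  have amW: "all_moments M (W p)" if "p \<in> J" for p using moments_G(1)[OF W[OF that]] .
  have amS: "all_moments M S" unfolding S_def by (intro all_moments_intros amW)
  have amQ: "all_moments M Q" unfolding Q_def by (intro all_moments_intros amW) auto
  have amD: "all_moments M (D t)" for t unfolding D_def by (intro all_moments_intros amW)
  have gS: "poly_deriv (W t) S (D t)" for t
  proof -
    have "poly_deriv (W t) (\<lambda>\<omega>. W p \<omega> * W p \<omega> + (- \<Gamma> p p))
        (\<lambda>\<omega>. (\<Gamma> t p * W p \<omega> + W p \<omega> * \<Gamma> t p) + 0)" if "p \<in> J" for p
      unfolding \<Gamma>_def by (intro poly_deriv_add poly_deriv_lmult poly_deriv_linear poly_deriv_const W that)
    thus ?thesis unfolding S_def D_def using poly_deriv_sum[of J "W t"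
        "\<lambda>p \<omega>. W p \<omega> * W p \<omega> + (- \<Gamma> p p)" "\<lambda>p \<omega>. (\<Gamma> t p * W p \<omega> + W p \<omega> * \<Gamma> t p) + 0"]
      by (simp add: power2_eq_square mult.commute)
  qed
  have st: "expectation (\<lambda>\<omega>. W t \<omega> * (W t \<omega> * S \<omega> ^ 3)) =
      \<Gamma> t t * expectation (\<lambda>\<omega>. S \<omega> ^ 3) + expectation (\<lambda>\<omega>. 3 * (W t \<omega> * D t \<omega> * (S \<omega>)\<^sup>2))"
    if "t \<in> J" for t
  proof -
    have "expectation (\<lambda>\<omega>. W t \<omega> * (W t \<omega> * (S \<omega> * (S \<omega> * S \<omega>)))) =
      expectation (\<lambda>\<omega>. \<Gamma> t t * (S \<omega> * (S \<omega> * S \<omega>)) +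
        W t \<omega> * (D t \<omega> * (S \<omega> * S \<omega>) + S \<omega> * (D t \<omega> * S \<omega> + S \<omega> * D t \<omega>)))"
      unfolding \<Gamma>_def by (intro stein poly_deriv_lmult poly_deriv_mult gS W that)
    also have "\<dots> = expectation (\<lambda>\<omega>. \<Gamma> t t * S \<omega> ^ 3 + 3 * (W t \<omega> * D t \<omega> * (S \<omega>)\<^sup>2))"
      by (intro arg_cong[where f = expectation]) (simp add: fun_eq_iff algebra_simps power_numeral_reduce)
    also have "\<dots> = \<Gamma> t t * expectation (\<lambda>\<omega>. S \<omega> ^ 3) + expectation (\<lambda>\<omega>. 3 * (W t \<omega> * D t \<omega> * (S \<omega>)\<^sup>2))"
      by (subst Bochner_Integration.integral_add)
         (auto intro!: all_moments_integrable all_moments_intros amS amD amW that simp del: mult_numeral_left)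
    finally show ?thesis by (simp add: power_numeral_reduce)
  qed
  have "expectation (\<lambda>\<omega>. S \<omega> ^ 4) =
     expectation (\<lambda>\<omega>. \<Sum>t\<in>J. W t \<omega> * (W t \<omega> * S \<omega> ^ 3) - \<Gamma> t t * S \<omega> ^ 3)"
  proof (intro arg_cong[where f = expectation] ext)
    fix \<omega>
    have "S \<omega> ^ 4 = S \<omega> * S \<omega> ^ 3" by (simp add: eval_nat_numeral)
    also have "\<dots> = (\<Sum>t\<in>J. ((W t \<omega>)\<^sup>2 - \<Gamma> t t) * S \<omega> ^ 3)"
      by (subst (1) S_def) (simp add: sum_distrib_right)
    also have "\<dots> = (\<Sum>t\<in>J. W t \<omega> * (W t \<omega> * S \<omega> ^ 3) - \<Gamma> t t * S \<omega> ^ 3)"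
      by (simp add: power2_eq_square left_diff_distrib mult.assoc)
    finally show "S \<omega> ^ 4 = (\<Sum>t\<in>J. W t \<omega> * (W t \<omega> * S \<omega> ^ 3) - \<Gamma> t t * S \<omega> ^ 3)" .
  qed
  also have "\<dots> = (\<Sum>t\<in>J. expectation (\<lambda>\<omega>. W t \<omega> * (W t \<omega> * S \<omega> ^ 3)) - \<Gamma> t t * expectation (\<lambda>\<omega>. S \<omega> ^ 3))"
    by (subst Bochner_Integration.integral_sum)
       (auto intro!: all_moments_integrable all_moments_intros amS amW sum.cong Bochner_Integration.integral_diff[THEN trans])
  also have "\<dots> = (\<Sum>t\<in>J. expectation (\<lambda>\<omega>. 3 * (W t \<omega> * D t \<omega> * (S \<omega>)\<^sup>2)))"
    using st by simp
  also have "\<dots> = expectation (\<lambda>\<omega>. \<Sum>t\<in>J. 3 * (W t \<omega> * D t \<omega> * (S \<omega>)\<^sup>2))"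
    by (subst Bochner_Integration.integral_sum)
       (auto intro!: all_moments_integrable all_moments_intros amS amW amD simp del: mult_numeral_left)
  also have "\<dots> = expectation (\<lambda>\<omega>. 6 * (Q \<omega> * (S \<omega>)\<^sup>2))"
    by (intro arg_cong[where f = expectation] ext)
       (simp add: Qe D_def sum_distrib_left sum_distrib_right mult_ac)
  also have "\<dots> \<le> expectation (\<lambda>\<omega>. 18 * (Q \<omega>)\<^sup>2 + (1/2) * S \<omega> ^ 4)"
  proof (rule integral_mono)
    show "integrable M (\<lambda>\<omega>. 6 * (Q \<omega> * (S \<omega>)\<^sup>2))"
      by (intro all_moments_integrable all_moments_intros amS amQ)
    show "integrable M (\<lambda>\<omega>. 18 * (Q \<omega>)\<^sup>2 + (1/2) * S \<omega> ^ 4)"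
      by (intro all_moments_integrable all_moments_intros amS amQ)
    fix \<omega>
    have "0 \<le> (1/2) * (6 * Q \<omega> - (S \<omega>)\<^sup>2)\<^sup>2" by simp
    also have "\<dots> = 18 * (Q \<omega>)\<^sup>2 + (1/2) * S \<omega> ^ 4 - 6 * (Q \<omega> * (S \<omega>)\<^sup>2)"
      by (simp add: power2_eq_square power4_eq_xxxx algebra_simps)
    finally show "6 * (Q \<omega> * (S \<omega>)\<^sup>2) \<le> 18 * (Q \<omega>)\<^sup>2 + (1/2) * S \<omega> ^ 4" by simp
  qed
  also have "\<dots> = 18 * expectation (\<lambda>\<omega>. (Q \<omega>)\<^sup>2) + (1/2) * expectation (\<lambda>\<omega>. S \<omega> ^ 4)"
  proof -
    have "integrable M (\<lambda>\<omega>. (Q \<omega>)\<^sup>2)" "integrable M (\<lambda>\<omega>. S \<omega> ^ 4)"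
      by (intro all_moments_integrable all_moments_intros amS amQ)+
    thus ?thesis by simp
  qed
  finally have 1: "expectation (\<lambda>\<omega>. S \<omega> ^ 4) \<le> 36 * expectation (\<lambda>\<omega>. (Q \<omega>)\<^sup>2)" by simp
  have KK: "(\<Sum>z\<in>J\<times>J. \<Gamma> (fst z) (snd z) * \<Gamma> (fst z) (snd z)) = K"
    by (simp add: K_def sum.cartesian_product case_prod_beta' power2_eq_square)
  have "expectation (\<lambda>\<omega>. (Q \<omega>)\<^sup>2) = K\<^sup>2 + (\<Sum>z\<in>J\<times>J. \<Sum>y\<in>J\<times>J.
      \<Gamma> (fst z) (snd z) * \<Gamma> (fst y) (snd y) *
        (\<Gamma> (fst z) (fst y) * \<Gamma> (snd z) (snd y) + \<Gamma> (fst z) (snd y) * \<Gamma> (snd z) (fst y)))"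
    unfolding Q_def KK[symmetric] unfolding \<Gamma>_def
    by (rule bilinear_second_moment) (auto intro: W)
  also have "\<dots> \<le> K\<^sup>2 + (\<Sum>z\<in>J\<times>J. \<Sum>y\<in>J\<times>J.
      (\<Gamma> (fst z) (snd z))\<^sup>2 * (\<Gamma> (fst y) (snd y))\<^sup>2 + 
      ((\<Gamma> (fst z) (fst y))\<^sup>2 * (\<Gamma> (snd z) (snd y))\<^sup>2 / 2 + (\<Gamma> (fst z) (snd y))\<^sup>2 * (\<Gamma> (snd z) (fst y))\<^sup>2 / 2))"
  proof (intro add_left_mono sum_mono)
    fix z y
    have am: "u * w * (x + x') \<le> u\<^sup>2 * w\<^sup>2 + (x\<^sup>2/2 + x'\<^sup>2/2)" for u w x x' :: real
    proof -
      have "0 \<le> (u * w - x)\<^sup>2 + (u * w - x')\<^sup>2" by simp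
      thus ?thesis by (simp add: power2_eq_square algebra_simps)
    qed
    show "\<Gamma> (fst z) (snd z) * \<Gamma> (fst y) (snd y) *
        (\<Gamma> (fst z) (fst y) * \<Gamma> (snd z) (snd y) + \<Gamma> (fst z) (snd y) * \<Gamma> (snd z) (fst y)) \<le> 
      (\<Gamma> (fst z) (snd z))\<^sup>2 * (\<Gamma> (fst y) (snd y))\<^sup>2 + 
      ((\<Gamma> (fst z) (fst y))\<^sup>2 * (\<Gamma> (snd z) (snd y))\<^sup>2 / 2 + (\<Gamma> (fst z) (snd y))\<^sup>2 * (\<Gamma> (snd z) (fst y))\<^sup>2 / 2)"
      using am[of "\<Gamma> (fst z) (snd z)" "\<Gamma> (fst y) (snd y)" "\<Gamma> (fst z) (fst y) * \<Gamma> (snd z) (snd y)"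
        "\<Gamma> (fst z) (snd y) * \<Gamma> (snd z) (fst y)"] by (simp only: power_mult_distrib)
  qed
  also have "\<dots> = 3 * K\<^sup>2"
  proof -
    have k2: "K\<^sup>2 = (\<Sum>a\<in>J. \<Sum>b\<in>J. \<Sum>c\<in>J. \<Sum>d\<in>J. (\<Gamma> a c)\<^sup>2 * (\<Gamma> b d)\<^sup>2)"
      by (simp only: K_def power2_eq_square[of "\<Sum>p\<in>J. \<Sum>q\<in>J. (\<Gamma> p q)\<^sup>2"] sum_product)
    have k: "K\<^sup>2 = (\<Sum>a\<in>J. \<Sum>b\<in>J. \<Sum>c\<in>J. \<Sum>d\<in>J. (\<Gamma> a b)\<^sup>2 * (\<Gamma> c d)\<^sup>2)"
      unfolding k2 by (rule sum.cong[OF refl], rule sum.swap)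
    have k3: "K\<^sup>2 = (\<Sum>a\<in>J. \<Sum>b\<in>J. \<Sum>c\<in>J. \<Sum>d\<in>J. (\<Gamma> a d)\<^sup>2 * (\<Gamma> b c)\<^sup>2)"
      unfolding k2 by (rule sum.cong[OF refl], rule sum.cong[OF refl], rule sum.swap)
    have pairs: "(\<Sum>a\<in>J. \<Sum>b\<in>J. \<Sum>c\<in>J. \<Sum>d\<in>J. g a b c d) =
        (\<Sum>z\<in>J\<times>J. \<Sum>y\<in>J\<times>J. g (fst z) (snd z) (fst y) (snd y))" for g :: "_ \<Rightarrow> _ \<Rightarrow> _ \<Rightarrow> _ \<Rightarrow> real"
    proof -
      have pair: "(\<Sum>a\<in>J. \<Sum>b\<in>J. f a b) = (\<Sum>z\<in>J\<times>J. f (fst z) (snd z))" for f :: "_ \<Rightarrow> _ \<Rightarrow> real"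
        by (simp add: sum.cartesian_product case_prod_beta')
      show ?thesis by (subst pair, rule sum.cong[OF refl], rule pair)
    qed
    show ?thesis
      by (simp only: sum.distrib sum_divide_distrib[symmetric] k[unfolded pairs, symmetric]
            k2[unfolded pairs, symmetric] k3[unfolded pairs, symmetric])
  qed
  finally show ?thesis using 1 unfolding S_def K_def by simp
qed

text \<open>For a stationary family the rows of the squared covariance matrix have uniformly bounded sums, so that the
  fourth moment grows only quadratically in the number of variables.\<close>
lemma fourth_moment_from_cov:
  assumes W: "\<And>p. p \<in> J \<Longrightarrow> W p \<in> G" and fin: "finite J"
    and row: "\<And>p. p \<in> J \<Longrightarrow> (\<Sum>q\<in>J. (expectation (\<lambda>\<omega>. W p \<omega> * W q \<omega>))\<^sup>2) \<le> K"
    and card: "real (card J) \<le> t"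
  shows "expectation (\<lambda>\<omega>. (\<Sum>p\<in>J. (W p \<omega>)\<^sup>2 - expectation (\<lambda>\<omega>. W p \<omega> * W p \<omega>)) ^ 4) \<le> 108 * K\<^sup>2 * t\<^sup>2"
proof (cases "J = {}")
  case False
  then obtain p where "p \<in> J" by auto
  have "0 \<le> (\<Sum>q\<in>J. (expectation (\<lambda>\<omega>. W p \<omega> * W q \<omega>))\<^sup>2)" by (intro sum_nonneg) auto
  hence K0: "K \<ge> 0" using row[OF \<open>p \<in> J\<close>] by linarith
  have "(\<Sum>p\<in>J. \<Sum>q\<in>J. (expectation (\<lambda>\<omega>. W p \<omega> * W q \<omega>))\<^sup>2) \<le> (\<Sum>p\<in>J. K)"
    by (intro sum_mono row)
  also have "\<dots> \<le> t * K" using card K0 by (simp add: mult_right_mono)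
  finally have "(\<Sum>p\<in>J. \<Sum>q\<in>J. (expectation (\<lambda>\<omega>. W p \<omega> * W q \<omega>))\<^sup>2)\<^sup>2 \<le> (t * K)\<^sup>2"
    by (intro power_mono sum_nonneg) auto
  moreover have "expectation (\<lambda>\<omega>. (\<Sum>p\<in>J. (W p \<omega>)\<^sup>2 - expectation (\<lambda>\<omega>. W p \<omega> * W p \<omega>)) ^ 4)
      \<le> 108 * (\<Sum>p\<in>J. \<Sum>q\<in>J. (expectation (\<lambda>\<omega>. W p \<omega> * W q \<omega>))\<^sup>2)\<^sup>2"
    by (rule sum_squares_fourth_moment) (use W fin in auto)
  ultimately show ?thesis by (simp add: power_mult_distrib mult_ac)
qed simp

end

section \<open>A spectral lower bound for Toeplitz forms\<close>

lemma integral_cos_period: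
  "has_bochner_integral lborel (\<lambda>x. cos (of_int h * x) * indicator {- pi..pi} x) (if h = 0 then 2 * pi else 0)"
proof (cases "h = 0")
  case True
  have "has_bochner_integral lborel (\<lambda>x. 1 * indicator {- pi..pi} x) (pi - (- pi) :: real)"
    by (rule has_bochner_integral_FTC_Icc_real[where F = "\<lambda>x. x"]) auto
  thus ?thesis using True by simp
next
  case False
  have "has_bochner_integral lborel (\<lambda>x. cos (of_int h * x) * indicator {- pi..pi} x)
     (sin (of_int h * pi) / of_int h - sin (of_int h * (- pi)) / of_int h)"
    by (rule has_bochner_integral_FTC_Icc_real[where F = "\<lambda>x. sin (of_int h * x) / of_int h"])
       (use False in \<open>auto intro!: derivative_eq_intros\<close>)
  thus ?thesis using False by (simp add: sin_zero_iff_int2 mult.commute)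
qed

lemma spectral_density_cos:
  assumes "spectral_density \<sigma> f"
  shows "integrable lborel (\<lambda>x. indicator {- pi..pi} x * f x)"
    and "\<sigma> h = (\<integral>x. indicator {- pi..pi} x * f x * cos (of_int h * x) \<partial>lborel)"
proof -
  let ?g = "\<lambda>x. indicator {- pi..pi} x * f x"
  show i: "integrable lborel ?g"
    using assms by (simp add: spectral_density_def set_integrable_def)
  hence [measurable]: "?g \<in> borel_measurable lborel" by (rule borel_measurable_integrable)
  have c: "integrable lborel (\<lambda>x. complex_of_real (?g x) * cis (of_int h * x))"
  proof (rule Bochner_Integration.integrable_bound[OF i])
    have "(\<lambda>x. cis (of_int h * x)) \<in> borel_measurable borel"
      by (intro borel_measurable_continuous_onI continuous_intros)
    thus "(\<lambda>x. complex_of_real (?g x) * cis (of_int h * x)) \<in> borel_measurable lborel"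
      by measurable
  qed (auto simp: norm_mult)
  have "complex_of_real (\<sigma> h) = (\<integral>x. complex_of_real (?g x) * cis (of_int h * x) \<partial>lborel)"
    using assms unfolding spectral_density_def set_lebesgue_integral_def
    by (auto intro!: Bochner_Integration.integral_cong simp: scaleR_conv_of_real mult.assoc)
  hence "\<sigma> h = Re (\<integral>x. complex_of_real (?g x) * cis (of_int h * x) \<partial>lborel)"
    by (metis Re_complex_of_real)
  also have "\<dots> = (\<integral>x. Re (complex_of_real (?g x) * cis (of_int h * x)) \<partial>lborel)"
    by (rule integral_Re[OF c, symmetric])
  also have "\<dots> = (\<integral>x. ?g x * cos (of_int h * x) \<partial>lborel)" by simp
  finally show "\<sigma> h = (\<integral>x. ?g x * cos (of_int h * x) \<partial>lborel)" .
qed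

text \<open>The Toeplitz form is the integral of \<open>f\<close> against a nonnegative trigonometric polynomial, whose
  integral with respect to Lebesgue measure is \<open>2 * pi * (\<Sum>i. (x i)\<^sup>2)\<close> by orthogonality.\<close>
lemma spectral_lower_bound:
  assumes sd: "spectral_density \<sigma> f" and m: "AE x in lborel. x \<in> {- pi..pi} \<longrightarrow> m \<le> f x"
  shows "2 * pi * m * (\<Sum>i=1..k. (x i)\<^sup>2) \<le> toeplitz_form \<sigma> k x"
proof -
  let ?I = "indicator {- pi..pi} :: real \<Rightarrow> real"
  define g where "g = (\<lambda>t. ?I t * f t)"
  define p where "p = (\<lambda>t. (\<Sum>i=1..k. \<Sum>j=1..k. x i * x j * cos (of_int (int i - int j) * t)))"
  have p: "p t = (\<Sum>i=1..k. x i * cos (real i * t))\<^sup>2 + (\<Sum>i=1..k. x i * sin (real i * t))\<^sup>2" for t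
    unfolding p_def power2_eq_square sum_product sum.distrib[symmetric]
    by (intro sum.cong refl) (simp add: left_diff_distrib cos_diff algebra_simps)
  hence p0: "p t \<ge> 0" for t by simp
  have ig: "integrable lborel (\<lambda>t. g t * cos (of_int h * t))" for h :: int
  proof (rule Bochner_Integration.integrable_bound)
    show "integrable lborel g" unfolding g_def by (rule spectral_density_cos[OF sd])
    thus "(\<lambda>t. g t * cos (of_int h * t)) \<in> borel_measurable lborel" by measurable
  qed (auto simp: abs_mult mult_left_le)
  have Ip: "?I t * p t = (\<Sum>i=1..k. \<Sum>j=1..k. x i * x j * (?I t * cos (of_int (int i - int j) * t)))" for t
    by (simp add: p_def sum_distrib_left mult_ac)
  have im: "integrable lborel (\<lambda>t. ?I t * cos (of_int h * t))" for h :: int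
    using integral_cos_period[of h] by (auto simp: has_bochner_integral_iff mult.commute)
  have "2 * pi * m * (\<Sum>i=1..k. (x i)\<^sup>2) = m * (\<Sum>i=1..k. \<Sum>j=1..k. x i * x j * (if i = j then 2 * pi else 0))"
    by (simp add: if_distrib[of "\<lambda>z. _ * z"] sum.delta sum_distrib_left power2_eq_square mult_ac cong: if_cong)
  also have "\<dots> = m * (\<Sum>i=1..k. \<Sum>j=1..k. x i * x j * (\<integral>t. ?I t * cos (of_int (int i - int j) * t) \<partial>lborel))"
  proof -
    have "(\<integral>t. ?I t * cos (of_int (int i - int j) * t) \<partial>lborel) = (if i = j then 2 * pi else 0)" for i j
      using integral_cos_period[of "int i - int j"] by (simp add: has_bochner_integral_iff mult.commute)
    thus ?thesis by presburger
  qed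
  also have "\<dots> = m * (\<integral>t. (\<Sum>i=1..k. \<Sum>j=1..k. x i * x j * (?I t * cos (of_int (int i - int j) * t))) \<partial>lborel)"
  proof -
    have "(\<integral>t. (\<Sum>i=1..k. \<Sum>j=1..k. x i * x j * (?I t * cos (of_int (int i - int j) * t))) \<partial>lborel) =
      (\<Sum>i=1..k. \<Sum>j=1..k. x i * x j * (\<integral>t. ?I t * cos (of_int (int i - int j) * t) \<partial>lborel))"
      by (rule integral_double_sum) (rule im)
    thus ?thesis by simp
  qed
  also have "\<dots> = (\<integral>t. m * (?I t * p t) \<partial>lborel)"
    unfolding Ip[symmetric] by simp
  also have "\<dots> \<le> (\<integral>t. g t * p t \<partial>lborel)"
  proof (rule integral_mono_AE)
    have "integrable lborel (\<lambda>t. \<Sum>i=1..k. \<Sum>j=1..k. x i * x j * (?I t * cos (of_int (int i - int j) * t)))"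
      by (intro Bochner_Integration.integrable_sum integrable_mult_right im)
    hence "integrable lborel (\<lambda>t. ?I t * p t)"
      by (simp add: p_def sum_distrib_left mult_ac)
    thus "integrable lborel (\<lambda>t. m * (?I t * p t))" by simp
    have "integrable lborel (\<lambda>t. \<Sum>i=1..k. \<Sum>j=1..k. x i * x j * (g t * cos (of_int (int i - int j) * t)))"
      by (intro Bochner_Integration.integrable_sum integrable_mult_right ig)
    thus "integrable lborel (\<lambda>t. g t * p t)"
      by (simp add: p_def sum_distrib_left mult_ac)
    show "AE t in lborel. m * (?I t * p t) \<le> g t * p t"
      using m
    proof eventually_elim
      case (elim t)
      show ?case
      proof (cases "t \<in> {- pi..pi}")
        case True
        hence "m * p t \<le> f t * p t" using elim p0 by (intro mult_right_mono) auto
        thus ?thesis using True by (simp add: g_def)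
      qed (simp add: g_def)
    qed
  qed
  also have "\<dots> = (\<integral>t. (\<Sum>i=1..k. \<Sum>j=1..k. x i * x j * (g t * cos (of_int (int i - int j) * t))) \<partial>lborel)"
    by (simp add: p_def sum_distrib_left mult_ac)
  also have "\<dots> = (\<Sum>i=1..k. \<Sum>j=1..k. x i * x j * (\<integral>t. g t * cos (of_int (int i - int j) * t) \<partial>lborel))"
    by (rule integral_double_sum) (rule ig)
  also have "\<dots> = toeplitz_form \<sigma> k x"
    unfolding toeplitz_form_def g_def by (simp add: spectral_density_cos(2)[OF sd])
  finally show ?thesis .
qed

section \<open>Convolutions with long-memory autocovariances\<close>

lemma sum_lags_le:
  fixes g :: "nat \<Rightarrow> real"
  assumes F: "finite F" "\<And>n. n \<in> F \<Longrightarrow> a \<le> nat \<bar>n\<bar> \<and> nat \<bar>n\<bar> \<le> b" and g: "\<And>j. g j \<ge> 0"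
  shows "(\<Sum>n\<in>F. g (nat \<bar>n\<bar>)) \<le> 2 * (\<Sum>j=a..b. g j)"
proof -
  have sub: "F \<subseteq> int ` {a..b} \<union> (\<lambda>j. - int j) ` {a..b}"
  proof
    fix n assume "n \<in> F"
    hence "n = int (nat \<bar>n\<bar>) \<or> n = - int (nat \<bar>n\<bar>)" "nat \<bar>n\<bar> \<in> {a..b}" using F(2) by auto
    thus "n \<in> int ` {a..b} \<union> (\<lambda>j. - int j) ` {a..b}" by (metis UnI1 UnI2 image_eqI)
  qed
  have "(\<Sum>n\<in>F. g (nat \<bar>n\<bar>)) \<le> (\<Sum>n\<in>int ` {a..b} \<union> (\<lambda>j. - int j) ` {a..b}. g (nat \<bar>n\<bar>))"
    by (rule sum_mono2[OF _ sub]) (use g in auto)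
  also have "\<dots> \<le> (\<Sum>n\<in>int ` {a..b}. g (nat \<bar>n\<bar>)) + (\<Sum>n\<in>(\<lambda>j. - int j) ` {a..b}. g (nat \<bar>n\<bar>))"
    by (subst sum_Un) (auto intro!: sum_nonneg g)
  also have "\<dots> = 2 * (\<Sum>j=a..b. g j)"
    by (subst (1 2) sum.reindex) (auto simp: inj_on_def)
  finally show ?thesis .
qed

text \<open>The three lemmas that follow are Young's inequality for convolutions on the integers, stated with bounds
  on finite partial sums. Each is the Cauchy--Schwarz inequality with the weights distributed
  differently.\<close>
lemma convolution_l1_l2:
  fixes w :: "nat \<Rightarrow> real" and s :: "int \<Rightarrow> real"
  assumes w: "\<And>i. w i \<ge> 0" and s: "\<And>F. finite F \<Longrightarrow> (\<Sum>n\<in>F. (s n)\<^sup>2) \<le> K" and fin: "finite I" "finite F"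
  shows "(\<Sum>n\<in>F. (\<Sum>i\<in>I. w i * s (n - int i))\<^sup>2) \<le> (\<Sum>i\<in>I. w i)\<^sup>2 * K"
proof -
  have shift: "(\<Sum>n\<in>F. (s (n - int i))\<^sup>2) \<le> K" for i
  proof -
    have "(\<Sum>n\<in>F. (s (n - int i))\<^sup>2) = (\<Sum>n\<in>(\<lambda>n. n - int i) ` F. (s n)\<^sup>2)"
      by (subst sum.reindex) (auto simp: inj_on_def)
    also have "\<dots> \<le> K" using fin by (intro s) auto
    finally show ?thesis .
  qed
  have "(\<Sum>n\<in>F. (\<Sum>i\<in>I. w i * s (n - int i))\<^sup>2) \<le> (\<Sum>n\<in>F. (\<Sum>i\<in>I. w i) * (\<Sum>i\<in>I. w i * (s (n - int i))\<^sup>2))"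
  proof (rule sum_mono)
    fix n
    have "(\<Sum>i\<in>I. sqrt (w i) * (sqrt (w i) * s (n - int i)))\<^sup>2 \<le>
       (\<Sum>i\<in>I. (sqrt (w i))\<^sup>2) * (\<Sum>i\<in>I. (sqrt (w i) * s (n - int i))\<^sup>2)"
      by (rule Cauchy_Schwarz_ineq_sum)
    thus "(\<Sum>i\<in>I. w i * s (n - int i))\<^sup>2 \<le> (\<Sum>i\<in>I. w i) * (\<Sum>i\<in>I. w i * (s (n - int i))\<^sup>2)"
      using w by (simp add: power_mult_distrib mult.assoc[symmetric])
  qed
  also have "\<dots> = (\<Sum>i\<in>I. w i) * (\<Sum>i\<in>I. w i * (\<Sum>n\<in>F. (s (n - int i))\<^sup>2))"
    unfolding sum_distrib_left[symmetric] by (subst sum.swap) (simp add: sum_distrib_left)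
  also have "\<dots> \<le> (\<Sum>i\<in>I. w i) * (\<Sum>i\<in>I. w i * K)"
    using w shift by (intro mult_left_mono sum_mono sum_nonneg) auto
  also have "\<dots> = (\<Sum>i\<in>I. w i)\<^sup>2 * K" by (simp add: power2_eq_square sum_distrib_right[symmetric])
  finally show ?thesis .
qed

lemma convolution_l2_l1:
  fixes w :: "nat \<Rightarrow> real" and s :: "int \<Rightarrow> real"
  assumes s0: "\<And>n. s n \<ge> 0" and s: "\<And>F. finite F \<Longrightarrow> (\<Sum>n\<in>F. s n) \<le> K" and fin: "finite I" "finite F"
  shows "(\<Sum>n\<in>F. (\<Sum>i\<in>I. w i * s (n - int i))\<^sup>2) \<le> (\<Sum>i\<in>I. (w i)\<^sup>2) * K\<^sup>2"
proof -
  have K: "K \<ge> 0" using s[of "{}"] by simp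
  have sI: "(\<Sum>i\<in>I. s (n - int i)) \<le> K" for n
  proof -
    have "(\<Sum>i\<in>I. s (n - int i)) = (\<Sum>m\<in>(\<lambda>i. n - int i) ` I. s m)"
      by (subst sum.reindex) (auto simp: inj_on_def)
    also have "\<dots> \<le> K" using fin by (intro s) auto
    finally show ?thesis .
  qed
  have sF: "(\<Sum>n\<in>F. s (n - int i)) \<le> K" for i
  proof -
    have "(\<Sum>n\<in>F. s (n - int i)) = (\<Sum>m\<in>(\<lambda>n. n - int i) ` F. s m)"
      by (subst sum.reindex) (auto simp: inj_on_def)
    also have "\<dots> \<le> K" using fin by (intro s) auto
    finally show ?thesis .
  qed
  have "(\<Sum>n\<in>F. (\<Sum>i\<in>I. w i * s (n - int i))\<^sup>2) \<le> (\<Sum>n\<in>F. K * (\<Sum>i\<in>I. (w i)\<^sup>2 * s (n - int i)))"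
  proof (rule sum_mono)
    fix n
    have "(\<Sum>i\<in>I. sqrt (s (n - int i)) * (w i * sqrt (s (n - int i))))\<^sup>2 \<le>
       (\<Sum>i\<in>I. (sqrt (s (n - int i)))\<^sup>2) * (\<Sum>i\<in>I. (w i * sqrt (s (n - int i)))\<^sup>2)"
      by (rule Cauchy_Schwarz_ineq_sum)
    also have "\<dots> = (\<Sum>i\<in>I. s (n - int i)) * (\<Sum>i\<in>I. (w i)\<^sup>2 * s (n - int i))"
      using s0 by (simp add: power_mult_distrib)
    also have "\<dots> \<le> K * (\<Sum>i\<in>I. (w i)\<^sup>2 * s (n - int i))"
      using sI s0 by (intro mult_right_mono sum_nonneg) auto
    finally show "(\<Sum>i\<in>I. w i * s (n - int i))\<^sup>2 \<le> K * (\<Sum>i\<in>I. (w i)\<^sup>2 * s (n - int i))"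
      using s0 by (simp add: mult.left_commute)
  qed
  also have "\<dots> = K * (\<Sum>i\<in>I. (w i)\<^sup>2 * (\<Sum>n\<in>F. s (n - int i)))"
    unfolding sum_distrib_left[symmetric] by (subst sum.swap) (simp add: sum_distrib_left)
  also have "\<dots> \<le> K * (\<Sum>i\<in>I. (w i)\<^sup>2 * K)"
    using sF K by (intro mult_left_mono sum_mono) auto
  also have "\<dots> = (\<Sum>i\<in>I. (w i)\<^sup>2) * K\<^sup>2" by (simp add: power2_eq_square sum_distrib_right[symmetric])
  finally show ?thesis .
qed

lemma convolution_l2_l2:
  fixes w :: "nat \<Rightarrow> real" and s :: "int \<Rightarrow> real"
  assumes s: "\<And>F. finite F \<Longrightarrow> (\<Sum>n\<in>F. (s n)\<^sup>2) \<le> K" and fin: "finite I" "finite F"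
  shows "(\<Sum>n\<in>F. (\<Sum>i\<in>I. w i * s (n - int i))\<^sup>2) \<le> (\<Sum>i\<in>I. (w i)\<^sup>2) * (real (card I) * K)"
proof -
  have sF: "(\<Sum>n\<in>F. (s (n - int i))\<^sup>2) \<le> K" for i
  proof -
    have "(\<Sum>n\<in>F. (s (n - int i))\<^sup>2) = (\<Sum>m\<in>(\<lambda>n. n - int i) ` F. (s m)\<^sup>2)"
      by (subst sum.reindex) (auto simp: inj_on_def)
    also have "\<dots> \<le> K" using fin by (intro s) auto
    finally show ?thesis .
  qed
  have "(\<Sum>n\<in>F. (\<Sum>i\<in>I. w i * s (n - int i))\<^sup>2) \<le> (\<Sum>n\<in>F. (\<Sum>i\<in>I. (w i)\<^sup>2) * (\<Sum>i\<in>I. (s (n - int i))\<^sup>2))"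
    by (intro sum_mono Cauchy_Schwarz_ineq_sum)
  also have "\<dots> = (\<Sum>i\<in>I. (w i)\<^sup>2) * (\<Sum>i\<in>I. \<Sum>n\<in>F. (s (n - int i))\<^sup>2)"
    unfolding sum_distrib_left[symmetric] by (subst sum.swap) simp
  also have "\<dots> \<le> (\<Sum>i\<in>I. (w i)\<^sup>2) * (\<Sum>i\<in>I. K)"
    using sF by (intro mult_left_mono sum_mono sum_nonneg) auto
  finally show ?thesis by simp
qed

text \<open>The parameter \<open>c\<close> majorizes the autocovariances non-asymptotically, at all lags.\<close>
locale long_memory_lags =
  fixes \<sigma> :: "int \<Rightarrow> real" and d c :: real
  assumes d: "0 < d" "d < 1 / 4"
    and even: "\<sigma> (- h) = \<sigma> h"
    and zero: "\<bar>\<sigma> 0\<bar> \<le> c"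
    and decay: "j \<ge> 1 \<Longrightarrow> \<bar>\<sigma> (int j)\<bar> \<le> c * real j powr (2 * d - 1)"
begin

lemma c_nonneg: "0 \<le> c" using zero abs_ge_zero order_trans by blast

lemma decay_int: "n \<noteq> 0 \<Longrightarrow> \<bar>\<sigma> n\<bar> \<le> c * real (nat \<bar>n\<bar>) powr (2 * d - 1)"
  using decay[of "nat \<bar>n\<bar>"] even[of n] by (cases "n \<ge> 0") auto

lemma sum_abs_lags_le:
  assumes "k \<ge> 1" "finite F" "\<And>n. n \<in> F \<Longrightarrow> \<bar>n\<bar> \<le> int k"
  shows "(\<Sum>n\<in>F. \<bar>\<sigma> n\<bar>) \<le> (c + c / d) * real k powr (2 * d)"
proof -
  have "(\<Sum>n\<in>F. \<bar>\<sigma> n\<bar>) \<le> (\<Sum>n\<in>insert 0 (F - {0}). \<bar>\<sigma> n\<bar>)"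
    by (rule sum_mono2) (use assms in auto)
  also have "\<dots> = \<bar>\<sigma> 0\<bar> + (\<Sum>n\<in>F - {0}. \<bar>\<sigma> n\<bar>)"
    using assms by (simp add: sum.insert_remove)
  also have "(\<Sum>n\<in>F - {0}. \<bar>\<sigma> n\<bar>) \<le> (\<Sum>n\<in>F - {0}. c * real (nat \<bar>n\<bar>) powr (2 * d - 1))"
    by (rule sum_mono) (use decay_int in auto)
  also have "\<dots> \<le> 2 * (\<Sum>j=1..k. c * real j powr (2 * d - 1))"
  proof (rule sum_lags_le)
    fix n assume "n \<in> F - {0}"
    thus "1 \<le> nat \<bar>n\<bar> \<and> nat \<bar>n\<bar> \<le> k" using assms(3)[of n] by auto
  qed (use assms c_nonneg in auto)
  also have "\<dots> = 2 * c * (\<Sum>j=1..k. real j powr (2 * d - 1))"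
    by (simp add: sum_distrib_left mult.assoc)
  also have "\<dots> \<le> 2 * c * (real k powr (2 * d) / (2 * d))"
    using d c_nonneg by (intro mult_left_mono sum_powr_le) auto
  also have "\<dots> = c / d * real k powr (2 * d)" by simp
  also have "\<bar>\<sigma> 0\<bar> \<le> c * real k powr (2 * d)"
  proof -
    have "1 \<le> real k powr (2 * d)" using assms(1) d by (intro ge_one_powr_ge_zero) auto
    hence "c * 1 \<le> c * real k powr (2 * d)" using c_nonneg by (intro mult_left_mono)
    thus ?thesis using zero by simp
  qed
  finally show ?thesis by (simp add: algebra_simps)
qed

lemma sum_sq_lags_le:
  assumes "k \<ge> 1" "finite F" "\<And>n. n \<in> F \<Longrightarrow> \<bar>n\<bar> > int k"
  shows "(\<Sum>n\<in>F. (\<sigma> n)\<^sup>2) \<le> 2 * c\<^sup>2 / (1 - 4 * d) * real k powr (4 * d - 1)"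
proof -
  define N where "N = Max (insert 0 ((\<lambda>n. nat \<bar>n\<bar>) ` F))"
  have "(\<Sum>n\<in>F. (\<sigma> n)\<^sup>2) \<le> (\<Sum>n\<in>F. c\<^sup>2 * real (nat \<bar>n\<bar>) powr (- (1 - 4 * d) - 1))"
  proof (rule sum_mono)
    fix n assume n: "n \<in> F"
    hence "n \<noteq> 0" using assms by force
    have "(\<sigma> n)\<^sup>2 \<le> (c * real (nat \<bar>n\<bar>) powr (2 * d - 1))\<^sup>2"
      using decay_int[OF \<open>n \<noteq> 0\<close>] by (metis abs_ge_zero power2_abs power_mono)
    thus "(\<sigma> n)\<^sup>2 \<le> c\<^sup>2 * real (nat \<bar>n\<bar>) powr (- (1 - 4 * d) - 1)"
      by (simp add: power_mult_distrib power2_eq_square powr_add[symmetric] algebra_simps)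
  qed
  also have "\<dots> \<le> 2 * (\<Sum>j=Suc k..N. c\<^sup>2 * real j powr (- (1 - 4 * d) - 1))"
  proof (rule sum_lags_le)
    fix n assume n: "n \<in> F"
    hence "nat \<bar>n\<bar> \<le> N" unfolding N_def using assms(2) by (intro Max_ge) auto
    moreover have "Suc k \<le> nat \<bar>n\<bar>" using assms(3)[OF n] by linarith
    ultimately show "Suc k \<le> nat \<bar>n\<bar> \<and> nat \<bar>n\<bar> \<le> N" by simp
  qed (use assms in auto)
  also have "\<dots> = 2 * c\<^sup>2 * (\<Sum>j=Suc k..N. real j powr (- (1 - 4 * d) - 1))"
    by (simp add: sum_distrib_left mult.assoc)
  also have "\<dots> \<le> 2 * c\<^sup>2 * (real k powr (- (1 - 4 * d)) / (1 - 4 * d))"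
    using d assms by (intro mult_left_mono sum_powr_tail_le) auto
  also have "\<dots> = 2 * c\<^sup>2 / (1 - 4 * d) * real k powr (4 * d - 1)" by simp
  finally show ?thesis .
qed

text \<open>The lags \<open>- 1\<close>, \<open>0\<close>, \<open>1\<close> contribute at most \<open>3 * c\<^sup>2\<close>; the second summand is the tail beyond lag 1.\<close>
definition sq_sum_bound :: real where "sq_sum_bound = 3 * c\<^sup>2 + 2 * c\<^sup>2 / (1 - 4 * d)"

lemma abs_le_c: "\<bar>\<sigma> n\<bar> \<le> c"
proof (cases "n = 0")
  case False
  have "real (nat \<bar>n\<bar>) powr (2 * d - 1) \<le> 1 powr (2 * d - 1)"
    using d False by (intro powr_mono2') auto
  hence "c * real (nat \<bar>n\<bar>) powr (2 * d - 1) \<le> c * 1" using c_nonneg by (intro mult_left_mono) auto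
  thus ?thesis using decay_int[OF False] by simp
qed (use zero in simp)

lemma sum_sq_le: "finite F \<Longrightarrow> (\<Sum>n\<in>F. (\<sigma> n)\<^sup>2) \<le> sq_sum_bound"
proof -
  assume F: "finite F"
  have "(\<Sum>n\<in>F. (\<sigma> n)\<^sup>2) \<le> (\<Sum>n\<in>{-1,0,1} \<union> (F - {-1,0,1}). (\<sigma> n)\<^sup>2)"
    by (rule sum_mono2) (use F in auto)
  also have "\<dots> = (\<Sum>n\<in>{-1,0,1}. (\<sigma> n)\<^sup>2) + (\<Sum>n\<in>F - {-1,0,1}. (\<sigma> n)\<^sup>2)"
    by (rule sum.union_disjoint) (use F in auto)
  also have "(\<Sum>n\<in>{-1,0,1}. (\<sigma> n)\<^sup>2) \<le> (\<Sum>n\<in>{-1,0,1::int}. c\<^sup>2)"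
    by (intro sum_mono) (metis abs_le_c abs_ge_zero power2_abs power_mono)
  also have "(\<Sum>n\<in>{-1,0,1::int}. c\<^sup>2) = 3 * c\<^sup>2" by simp
  also have "(\<Sum>n\<in>F - {-1,0,1}. (\<sigma> n)\<^sup>2) \<le> 2 * c\<^sup>2 / (1 - 4 * d) * real 1 powr (4 * d - 1)"
    by (rule sum_sq_lags_le) (use F in auto)
  finally show ?thesis by (simp add: sq_sum_bound_def)
qed

text \<open>Here \<open>u\<close> is the finite prediction error filter and \<open>a\<close> the autoregressive one. The difference has
  only \<open>l\<^sup>2\<close> norm of order \<open>k powr (- 2 d)\<close>, and \<open>\<sigma>\<close> is not summable. Lags up to \<open>k\<close> have absolute sum of order
  \<open>k powr (2 d)\<close>; for the larger lags the \<open>l\<^sup>1\<close> norm of the difference is at most \<open>sqrt (k + 1)\<close> times its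
  \<open>l\<^sup>2\<close> norm, against an \<open>l\<^sup>2\<close> tail of order \<open>k powr (2 d - 1 / 2)\<close>. Both products are bounded.\<close>
lemma convolution_bound:
  fixes u a :: "nat \<Rightarrow> real"
  assumes k: "k \<ge> 1" and F: "finite F"
    and a: "(\<Sum>i\<le>k. \<bar>a i\<bar>) \<le> A" and h: "(\<Sum>i\<le>k. (u i - a i)\<^sup>2) \<le> H * real k powr (- 4 * d)"
  shows "(\<Sum>n\<in>F. (\<Sum>i\<le>k. \<bar>u i\<bar> * \<bar>\<sigma> (n - int i)\<bar>)\<^sup>2) \<le>
     3 * (A\<^sup>2 * sq_sum_bound + H * (c + c / d)\<^sup>2 + 4 * H * c\<^sup>2 / (1 - 4 * d))"
proof -
  define h where "h = (\<lambda>i. \<bar>u i - a i\<bar>)"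
  \<comment> \<open>The autocovariances are cut at lag \<open>k\<close>: \<open>s1\<close> is treated by its \<open>l\<^sup>1\<close> norm, \<open>s2\<close> by its \<open>l\<^sup>2\<close> norm.\<close>
  define s1 where "s1 = (\<lambda>n. if \<bar>n\<bar> \<le> int k then \<bar>\<sigma> n\<bar> else 0)"
  define s2 where "s2 = (\<lambda>n. if \<bar>n\<bar> \<le> int k then 0 else \<bar>\<sigma> n\<bar>)"
  let ?U = "\<lambda>n. \<Sum>i\<le>k. \<bar>u i\<bar> * \<bar>\<sigma> (n - int i)\<bar>" and ?A = "\<lambda>n. \<Sum>i\<le>k. \<bar>a i\<bar> * \<bar>\<sigma> (n - int i)\<bar>"
    and ?S1 = "\<lambda>n. \<Sum>i\<le>k. h i * s1 (n - int i)" and ?S2 = "\<lambda>n. \<Sum>i\<le>k. h i * s2 (n - int i)"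
  let ?K = "real k powr (- 4 * d)"
  have H: "(\<Sum>i\<le>k. (h i)\<^sup>2) \<le> H * ?K" using h by (simp add: h_def)
  have Kpos: "?K > 0" using k by simp
  have H0: "0 \<le> H * ?K" using H sum_nonneg[of "{..k}" "\<lambda>i. (h i)\<^sup>2"] by simp
  have A0: "0 \<le> (\<Sum>i\<le>k. \<bar>a i\<bar>)" by (intro sum_nonneg) auto
  have b1: "(\<Sum>n\<in>F. (?A n)\<^sup>2) \<le> A\<^sup>2 * sq_sum_bound"
  proof -
    have "(\<Sum>n\<in>F. (?A n)\<^sup>2) \<le> (\<Sum>i\<le>k. \<bar>a i\<bar>)\<^sup>2 * sq_sum_bound"
      by (rule convolution_l1_l2) (use F sum_sq_le in auto)
    also have "\<dots> \<le> A\<^sup>2 * sq_sum_bound"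
      using a A0 sum_sq_le[of "{}"] by (intro mult_right_mono power_mono) auto
    finally show ?thesis .
  qed
  have b2: "(\<Sum>n\<in>F. (?S1 n)\<^sup>2) \<le> H * (c + c / d)\<^sup>2"
  proof -
    have "(\<Sum>n\<in>F. (?S1 n)\<^sup>2) \<le> (\<Sum>i\<le>k. (h i)\<^sup>2) * ((c + c / d) * real k powr (2 * d))\<^sup>2"
    proof (rule convolution_l2_l1)
      fix G :: "int set" assume G: "finite G"
      have "(\<Sum>n\<in>G. s1 n) = (\<Sum>n\<in>{n\<in>G. \<bar>n\<bar> \<le> int k}. \<bar>\<sigma> n\<bar>)"
        unfolding s1_def using G by (simp add: sum.inter_filter)
      also have "\<dots> \<le> (c + c / d) * real k powr (2 * d)"
        using G k by (intro sum_abs_lags_le) auto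
      finally show "(\<Sum>n\<in>G. s1 n) \<le> (c + c / d) * real k powr (2 * d)" .
    qed (use F in \<open>auto simp: s1_def\<close>)
    also have "\<dots> \<le> (H * ?K) * ((c + c / d) * real k powr (2 * d))\<^sup>2"
      using H by (intro mult_right_mono) auto
    also have "\<dots> = H * (c + c / d)\<^sup>2 * (?K * real k powr (4 * d))"
      by (simp add: power_mult_distrib power2_eq_square[of "_ powr _"] powr_add[symmetric])
    also have "?K * real k powr (4 * d) = 1" using k by (simp add: powr_add[symmetric])
    finally show ?thesis by simp
  qed
  have b3: "(\<Sum>n\<in>F. (?S2 n)\<^sup>2) \<le> 4 * H * c\<^sup>2 / (1 - 4 * d)"
  proof -
    let ?L = "2 * c\<^sup>2 / (1 - 4 * d) * real k powr (4 * d - 1)"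
    have L0: "?L \<ge> 0" using d by simp
    have "(\<Sum>n\<in>F. (?S2 n)\<^sup>2) \<le> (\<Sum>i\<le>k. (h i)\<^sup>2) * (real (card {..k}) * ?L)"
    proof (rule convolution_l2_l2)
      fix G :: "int set" assume G: "finite G"
      have "(\<Sum>n\<in>G. (s2 n)\<^sup>2) = (\<Sum>n\<in>{n\<in>G. \<bar>n\<bar> > int k}. (\<sigma> n)\<^sup>2)"
        unfolding s2_def using G by (subst sum.inter_filter) (auto intro!: sum.cong)
      also have "\<dots> \<le> ?L"
        using G k by (intro sum_sq_lags_le) auto
      finally show "(\<Sum>n\<in>G. (s2 n)\<^sup>2) \<le> ?L" .
    qed (use F in auto)
    also have "\<dots> \<le> (H * ?K) * (2 * real k * ?L)"
    proof -
      have cc: "real (card {..k}) * ?L \<le> 2 * real k * ?L" using k L0 by (intro mult_right_mono) auto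
      have cc0: "0 \<le> real (card {..k}) * ?L" by (rule mult_nonneg_nonneg[OF of_nat_0_le_iff L0])
      show ?thesis by (rule mult_mono[OF H cc H0 cc0])
    qed
    also have "\<dots> = 4 * H * c\<^sup>2 / (1 - 4 * d) * (?K * (real k powr 1 * real k powr (4 * d - 1)))"
      using k by simp
    also have "?K * (real k powr 1 * real k powr (4 * d - 1)) = 1"
      using k by (simp only: powr_add[symmetric]) simp
    finally show ?thesis by simp
  qed
  have "(\<Sum>n\<in>F. (?U n)\<^sup>2) \<le>
    (\<Sum>n\<in>F. 3 * ((?A n)\<^sup>2 + (?S1 n)\<^sup>2
       + (?S2 n)\<^sup>2))"
  proof (rule sum_mono)
    fix n
    have sq: "(x + y + z)\<^sup>2 \<le> 3 * (x\<^sup>2 + y\<^sup>2 + z\<^sup>2)" for x y z :: real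
    proof -
      have "0 \<le> (x - y)\<^sup>2 + (y - z)\<^sup>2 + (x - z)\<^sup>2" by simp
      thus ?thesis by (simp add: power2_eq_square algebra_simps)
    qed
    have "?U n \<le>
        (\<Sum>i\<le>k. \<bar>a i\<bar> * \<bar>\<sigma> (n - int i)\<bar> + h i * s1 (n - int i) + h i * s2 (n - int i))"
    proof (rule sum_mono)
      fix i
      have "\<bar>u i\<bar> * \<bar>\<sigma> (n - int i)\<bar> \<le> (\<bar>a i\<bar> + h i) * \<bar>\<sigma> (n - int i)\<bar>"
        unfolding h_def by (intro mult_right_mono) auto
      also have "\<dots> = \<bar>a i\<bar> * \<bar>\<sigma> (n - int i)\<bar> + h i * s1 (n - int i) + h i * s2 (n - int i)"
        by (simp add: s1_def s2_def algebra_simps)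
      finally show "\<bar>u i\<bar> * \<bar>\<sigma> (n - int i)\<bar> \<le> \<bar>a i\<bar> * \<bar>\<sigma> (n - int i)\<bar> + h i * s1 (n - int i) + h i * s2 (n - int i)" .
    qed
    also have "\<dots> = ?A n + ?S1 n + ?S2 n" by (simp add: sum.distrib)
    finally have "(?U n)\<^sup>2 \<le> (?A n + ?S1 n + ?S2 n)\<^sup>2"
      by (intro power_mono sum_nonneg) auto
    also note sq
    finally show "(?U n)\<^sup>2 \<le> 3 * ((?A n)\<^sup>2 + (?S1 n)\<^sup>2 + (?S2 n)\<^sup>2)" .
  qed
  also have "\<dots> = 3 * ((\<Sum>n\<in>F. (?A n)\<^sup>2) +
     (\<Sum>n\<in>F. (?S1 n)\<^sup>2) + (\<Sum>n\<in>F. (?S2 n)\<^sup>2))"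
    by (simp only: sum_distrib_left[symmetric] sum.distrib)
  also have "\<dots> \<le> 3 * (A\<^sup>2 * sq_sum_bound + H * (c + c / d)\<^sup>2 + 4 * H * c\<^sup>2 / (1 - 4 * d))"
    using b1 b2 b3 by simp
  finally show ?thesis .
qed

text \<open>This is the variance of the tail of the autoregression. For \<open>i < j\<close> the row sums are split at
  \<open>j = 2 i\<close>: below, \<open>a j\<close> is comparable with \<open>a i\<close> and the autocovariances are summed; above, both factors
  decay in \<open>j - i\<close>. Either part is of order \<open>i powr (- 1 / 2 - d)\<close>.\<close>
lemma tail_quadratic_form_le:
  fixes a :: "nat \<Rightarrow> real"
  assumes k: "k \<ge> 1" and a: "\<And>j. j \<ge> 1 \<Longrightarrow> \<bar>a j\<bar> \<le> A * real j powr (- 1/2 - 3 * d)"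
  shows "\<bar>\<Sum>i=Suc k..N. \<Sum>j=Suc k..N. a i * a j * \<sigma> (int i - int j)\<bar>
     \<le> A\<^sup>2 * c * (1 + 2 * (1 / (2 * d) + 1 / (1/2 + d))) / (4 * d) * real k powr (- 4 * d)"
proof -
  define w where "w = (\<lambda>j::nat. real j powr (- 1/2 - 3 * d))"
  define s where "s = (\<lambda>u::nat. real u powr (2 * d - 1))"
  define G where "G = 1 / (2 * d) + 1 / (1/2 + d)"
  have A0: "0 \<le> A" using a[of 1] by simp
  have row: "(\<Sum>j=Suc i..N. w j * s (j - i)) \<le> G * real i powr (- 1/2 - d)" if i: "i \<ge> 1" for i
  proof -
    have "(\<Sum>j=Suc i..N. w j * s (j - i)) = (\<Sum>u=1..N - i. w (u + i) * s u)"
      by (rule sum.reindex_bij_witness[of _ "\<lambda>u. u + i" "\<lambda>j. j - i"]) auto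
    also have "\<dots> \<le> (\<Sum>u\<in>{1..i} \<union> {Suc i..N}. w (u + i) * s u)"
      by (rule sum_mono2) (auto simp: w_def s_def)
    also have "\<dots> = (\<Sum>u=1..i. w (u + i) * s u) + (\<Sum>u=Suc i..N. w (u + i) * s u)"
      by (rule sum.union_disjoint) auto
    also have "(\<Sum>u=1..i. w (u + i) * s u) \<le> (\<Sum>u=1..i. w i * s u)"
      using d i by (intro sum_mono mult_right_mono) (auto simp: w_def s_def intro!: powr_mono2')
    also have "\<dots> = w i * (\<Sum>u=1..i. s u)" by (simp add: sum_distrib_left)
    also have "\<dots> \<le> w i * (real i powr (2 * d) / (2 * d))"
      unfolding s_def using d by (intro mult_left_mono sum_powr_le) (auto simp: w_def)
    also have "\<dots> = 1 / (2 * d) * (real i powr (- 1/2 - 3 * d) * real i powr (2 * d))"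
      by (simp add: w_def)
    also have "real i powr (- 1/2 - 3 * d) * real i powr (2 * d) = real i powr (- 1/2 - d)"
    proof -
      have "- 1/2 - 3 * d + 2 * d = - 1/2 - d" by simp
      thus ?thesis by (simp only: powr_add[symmetric])
    qed
    also have "(\<Sum>u=Suc i..N. w (u + i) * s u) \<le> (\<Sum>u=Suc i..N. real u powr (- (1/2 + d) - 1))"
    proof (rule sum_mono)
      fix u assume u: "u \<in> {Suc i..N}"
      have "w (u + i) * s u \<le> w u * s u"
        using d i u by (intro mult_right_mono) (auto simp: w_def s_def intro!: powr_mono2')
      also have "\<dots> = real u powr (- (1/2 + d) - 1)"
        by (simp add: w_def s_def powr_add[symmetric] algebra_simps)
      finally show "w (u + i) * s u \<le> real u powr (- (1/2 + d) - 1)" .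
    qed
    also have "\<dots> \<le> real i powr (- (1/2 + d)) / (1/2 + d)"
      using d i by (intro sum_powr_tail_le) auto
    also have "\<dots> = 1 / (1/2 + d) * real i powr (- 1/2 - d)"
    proof -
      have "- (1/2 + d) = - 1/2 - d" by simp
      thus ?thesis by (simp only: times_divide_eq_left mult_1)
    qed
    finally show ?thesis by (simp add: G_def algebra_simps)
  qed
  have diag: "\<bar>a i * a i * \<sigma> 0\<bar> \<le> A\<^sup>2 * c * real i powr (- (4 * d) - 1)" if i: "i \<ge> 1" for i
  proof -
    have "\<bar>a i * a i * \<sigma> 0\<bar> = \<bar>a i\<bar> * \<bar>a i\<bar> * \<bar>\<sigma> 0\<bar>" by (simp add: abs_mult)
    also have "\<dots> \<le> (A * w i) * (A * w i) * c"
      unfolding w_def using a[OF i] zero A0 by (intro mult_mono) auto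
    also have "\<dots> = A\<^sup>2 * c * real i powr (- 1 - 6 * d)"
      by (simp add: w_def power2_eq_square mult_ac powr_add[symmetric])
    also have "\<dots> \<le> A\<^sup>2 * c * real i powr (- (4 * d) - 1)"
      using d i c_nonneg by (intro mult_left_mono powr_mono) auto
    finally show ?thesis .
  qed
  have off: "(\<Sum>j=Suc i..N. \<bar>a i * a j * \<sigma> (int i - int j)\<bar>) \<le> A\<^sup>2 * c * G * real i powr (- (4 * d) - 1)"
    if i: "i \<ge> 1" for i
  proof -
    have "(\<Sum>j=Suc i..N. \<bar>a i * a j * \<sigma> (int i - int j)\<bar>) \<le> (\<Sum>j=Suc i..N. (A * w i) * (A * w j) * (c * s (j - i)))"
    proof (rule sum_mono)
      fix j assume j: "j \<in> {Suc i..N}"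
      have "\<bar>\<sigma> (int i - int j)\<bar> = \<bar>\<sigma> (int (j - i))\<bar>" using even[of "int i - int j"] j by (simp add: of_nat_diff)
      also have "\<dots> \<le> c * s (j - i)" unfolding s_def using j by (intro decay) auto
      finally have "\<bar>\<sigma> (int i - int j)\<bar> \<le> c * s (j - i)" .
      thus "\<bar>a i * a j * \<sigma> (int i - int j)\<bar> \<le> (A * w i) * (A * w j) * (c * s (j - i))"
        unfolding abs_mult w_def using a[OF i] a[of j] j A0 by (intro mult_mono) auto
    qed
    also have "\<dots> = A\<^sup>2 * c * w i * (\<Sum>j=Suc i..N. w j * s (j - i))"
      by (simp add: sum_distrib_left power2_eq_square mult_ac)
    also have "\<dots> \<le> A\<^sup>2 * c * w i * (G * real i powr (- 1/2 - d))"
      using row[OF i] c_nonneg by (intro mult_left_mono) (auto simp: w_def)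
    also have "\<dots> = A\<^sup>2 * c * G * (real i powr (- 1/2 - 3 * d) * real i powr (- 1/2 - d))"
      by (simp add: w_def)
    also have "real i powr (- 1/2 - 3 * d) * real i powr (- 1/2 - d) = real i powr (- (4 * d) - 1)"
    proof -
      have "- 1/2 - 3 * d + (- 1/2 - d) = - (4 * d) - 1" by simp
      thus ?thesis by (simp only: powr_add[symmetric])
    qed
    finally show ?thesis .
  qed
  define T where "T = (\<lambda>i j. \<bar>a i * a j * \<sigma> (int i - int j)\<bar>)"
  have symT: "T i j = T j i" for i j
    using even[of "int i - int j"] by (simp add: T_def mult.commute)
  have G0: "G \<ge> 0" using d by (simp add: G_def)
  have "\<bar>\<Sum>i=Suc k..N. \<Sum>j=Suc k..N. a i * a j * \<sigma> (int i - int j)\<bar> \<le> (\<Sum>i=Suc k..N. \<Sum>j=Suc k..N. T i j)"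
    unfolding T_def by (intro order_trans[OF sum_abs] sum_mono sum_abs)
  also have "\<dots> = (\<Sum>i=Suc k..N. \<Sum>j=Suc k..N. (if j = i then T i i else 0) +
     ((if j > i then T i j else 0) + (if i > j then T j i else 0)))"
    by (intro sum.cong refl) (auto simp: symT)
  also have "\<dots> = (\<Sum>i=Suc k..N. T i i) +
     2 * (\<Sum>i=Suc k..N. \<Sum>j=Suc k..N. if j > i then T i j else 0)"
  proof -
    have "(\<Sum>i=Suc k..N. \<Sum>j=Suc k..N. if i > j then T j i else 0) =
      (\<Sum>i=Suc k..N. \<Sum>j=Suc k..N. if j > i then T i j else 0)" by (rule sum.swap)
    thus ?thesis by (simp add: sum.distrib)
  qed
  also have "(\<Sum>i=Suc k..N. \<Sum>j=Suc k..N. if j > i then T i j else 0) = (\<Sum>i=Suc k..N. \<Sum>j=Suc i..N. T i j)"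
  proof (rule sum.cong[OF refl])
    fix i assume i: "i \<in> {Suc k..N}"
    have "(\<Sum>j=Suc k..N. if j > i then T i j else 0) = (\<Sum>j\<in>{j\<in>{Suc k..N}. j > i}. T i j)"
      by (rule sum.inter_filter[symmetric]) simp
    also have "{j\<in>{Suc k..N}. j > i} = {Suc i..N}" using i by auto
    finally show "(\<Sum>j=Suc k..N. if j > i then T i j else 0) = (\<Sum>j=Suc i..N. T i j)" .
  qed
  also have "(\<Sum>i=Suc k..N. T i i) + 2 * (\<Sum>i=Suc k..N. \<Sum>j=Suc i..N. T i j) \<le>
     (\<Sum>i=Suc k..N. A\<^sup>2 * c * real i powr (- (4 * d) - 1)) +
     2 * (\<Sum>i=Suc k..N. A\<^sup>2 * c * G * real i powr (- (4 * d) - 1))"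
    using diag off unfolding T_def by (intro add_mono mult_left_mono sum_mono) auto
  also have "\<dots> = A\<^sup>2 * c * (1 + 2 * G) * (\<Sum>i=Suc k..N. real i powr (- (4 * d) - 1))"
    by (simp add: sum_distrib_left[symmetric] algebra_simps)
  also have "\<dots> \<le> A\<^sup>2 * c * (1 + 2 * G) * (real k powr (- (4 * d)) / (4 * d))"
    using d k c_nonneg G0 by (intro mult_left_mono sum_powr_tail_le) auto
  finally show ?thesis by (simp add: G_def)
qed

end

section \<open>Finite predictors and the infinite autoregression\<close>

lemma L2_mult_integrable:
  assumes "L2_var M U" "L2_var M V"
  shows "integrable M (\<lambda>\<omega>. U \<omega> * V \<omega>)"
proof (rule Bochner_Integration.integrable_bound)
  show "integrable M (\<lambda>\<omega>. (U \<omega>)\<^sup>2 + (V \<omega>)\<^sup>2)" using assms by (simp add: L2_var_def)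
  show "(\<lambda>\<omega>. U \<omega> * V \<omega>) \<in> borel_measurable M" using assms by (auto simp: L2_var_def)
  show "AE \<omega> in M. norm (U \<omega> * V \<omega>) \<le> norm ((U \<omega>)\<^sup>2 + (V \<omega>)\<^sup>2)"
  proof (rule AE_I2)
    fix \<omega>
    have "2 * (\<bar>U \<omega>\<bar> * \<bar>V \<omega>\<bar>) \<le> (U \<omega>)\<^sup>2 + (V \<omega>)\<^sup>2"
      using sum_squares_bound[of "\<bar>U \<omega>\<bar>" "\<bar>V \<omega>\<bar>"] by (simp add: mult.assoc)
    moreover have "0 \<le> \<bar>U \<omega>\<bar> * \<bar>V \<omega>\<bar>" by simp
    ultimately show "norm (U \<omega> * V \<omega>) \<le> norm ((U \<omega>)\<^sup>2 + (V \<omega>)\<^sup>2)"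
      unfolding real_norm_def abs_mult by linarith
  qed
qed

lemma L2_add:
  assumes "L2_var M U" "L2_var M V"
  shows "L2_var M (\<lambda>\<omega>. U \<omega> + V \<omega>)"
proof -
  have "integrable M (\<lambda>\<omega>. (U \<omega>)\<^sup>2 + 2 * (U \<omega> * V \<omega>) + (V \<omega>)\<^sup>2)"
    using assms L2_mult_integrable[OF assms] by (simp add: L2_var_def)
  also have "(\<lambda>\<omega>. (U \<omega>)\<^sup>2 + 2 * (U \<omega> * V \<omega>) + (V \<omega>)\<^sup>2) = (\<lambda>\<omega>. (U \<omega> + V \<omega>)\<^sup>2)"
    by (simp add: power2_sum fun_eq_iff)
  finally show ?thesis using assms by (auto simp: L2_var_def)
qed

lemma L2_scale: "L2_var M U \<Longrightarrow> L2_var M (\<lambda>\<omega>. c * U \<omega>)"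
  by (auto simp: L2_var_def power_mult_distrib)

lemma L2_diff: "L2_var M U \<Longrightarrow> L2_var M V \<Longrightarrow> L2_var M (\<lambda>\<omega>. U \<omega> - V \<omega>)"
  using L2_add[OF _ L2_scale[of M V "-1"]] by simp

lemma L2_sum: "(\<And>i. i \<in> I \<Longrightarrow> L2_var M (U i)) \<Longrightarrow> L2_var M (\<lambda>\<omega>. \<Sum>i\<in>I. U i \<omega>)"
  by (induction I rule: infinite_finite_induct) (auto intro: L2_add simp: L2_var_def[of _ "\<lambda>_. 0"])

context long_memory_model
begin

lemma L2_X: "L2_var M (X n)" and L2_noise: "L2_var M (\<epsilon> n)"
  using stationary noise by (auto simp: weakly_stationary_def white_noise_def)

lemma expectation_X_mult: "expectation (\<lambda>\<omega>. X m \<omega> * X n \<omega>) = autocov M X (n - m)"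
proof -
  have "covariance M (X (0 + m)) (X ((n - m) + m)) = covariance M (X 0) (X (n - m))"
    using stationary unfolding weakly_stationary_def by blast
  thus ?thesis by (simp add: covariance_def mean_zero autocov_def)
qed

lemma autocov_even: "autocov M X (- h) = autocov M X h"
  using expectation_X_mult[of 0 h] expectation_X_mult[of h 0] by (simp add: mult.commute)

text \<open>The past value is a mean-square limit of combinations of earlier noise variables, each of which is uncorrelated
  with \<open>\<epsilon> t\<close>.\<close>
lemma noise_orthogonal_past:
  assumes "s < t"
  shows "expectation (\<lambda>\<omega>. \<epsilon> t \<omega> * X s \<omega>) = 0"
proof -
  let ?v = "expectation (\<lambda>\<omega>. (\<epsilon> t \<omega>)\<^sup>2)"
    and ?x = "expectation (\<lambda>\<omega>. \<epsilon> t \<omega> * X s \<omega>)"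
  define S where "S = (\<lambda>N \<omega>. \<Sum>j<N. b j * \<epsilon> (s - int j) \<omega>)"
  define e where "e = (\<lambda>N. expectation (\<lambda>\<omega>. (X s \<omega> - S N \<omega>)\<^sup>2))"
  have lim: "e \<longlonglongrightarrow> 0"
    using moving_average[of s] unfolding L2_sums_def e_def S_def by simp
  have L2S: "L2_var M (S N)" for N unfolding S_def by (intro L2_sum L2_scale L2_noise)
  have zero: "expectation (\<lambda>\<omega>. \<epsilon> t \<omega> * S N \<omega>) = 0" for N
  proof -
    have "expectation (\<lambda>\<omega>. \<epsilon> t \<omega> * \<epsilon> (s - int j) \<omega>) = 0" for j
    proof -
      have "covariance M (\<epsilon> t) (\<epsilon> (s - int j)) = 0"
        using noise assms by (simp add: white_noise_def)
      thus ?thesis using noise by (simp add: covariance_def white_noise_def)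
    qed
    moreover have "(\<lambda>\<omega>. \<epsilon> t \<omega> * S N \<omega>) = (\<lambda>\<omega>. \<Sum>j<N. b j * (\<epsilon> t \<omega> * \<epsilon> (s - int j) \<omega>))"
      by (simp add: S_def sum_distrib_left mult_ac)
    ultimately show ?thesis
      by (simp add: Bochner_Integration.integral_sum L2_mult_integrable L2_noise)
  qed
  have bound: "\<bar>?x\<bar> \<le> c * ?v" if c: "c > 0" for c
  proof -
    have "\<bar>?x\<bar> \<le> c * ?v + e N / c" for N
    proof -
      have L: "L2_var M (\<lambda>\<omega>. X s \<omega> - S N \<omega>)" by (intro L2_diff L2_X L2S)
      have "?x = expectation (\<lambda>\<omega>. \<epsilon> t \<omega> * (X s \<omega> - S N \<omega>))"
        by (simp add: right_diff_distrib L2_mult_integrable L2_noise L2_X L2S zero)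
      also have "\<bar>\<dots>\<bar> \<le> expectation (\<lambda>\<omega>. \<bar>\<epsilon> t \<omega> * (X s \<omega> - S N \<omega>)\<bar>)"
        by (rule integral_abs_bound)
      also have "\<dots> \<le> expectation (\<lambda>\<omega>. c * (\<epsilon> t \<omega>)\<^sup>2 + (X s \<omega> - S N \<omega>)\<^sup>2 / c)"
      proof (rule integral_mono)
        show "integrable M (\<lambda>\<omega>. \<bar>\<epsilon> t \<omega> * (X s \<omega> - S N \<omega>)\<bar>)"
          by (intro integrable_abs L2_mult_integrable L2_noise L)
        show "integrable M (\<lambda>\<omega>. c * (\<epsilon> t \<omega>)\<^sup>2 + (X s \<omega> - S N \<omega>)\<^sup>2 / c)"
          using L L2_noise[of t] by (simp add: L2_var_def)
        fix \<omega>
        have am: "u * w \<le> c * u\<^sup>2 + w\<^sup>2 / c" if "u \<ge> 0" "w \<ge> 0" for u w :: real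
        proof -
          have "0 \<le> (c * u - w)\<^sup>2 + c * u * w" using c that by simp
          thus ?thesis using c by (simp add: field_simps power2_eq_square)
        qed
        show "\<bar>\<epsilon> t \<omega> * (X s \<omega> - S N \<omega>)\<bar> \<le> c * (\<epsilon> t \<omega>)\<^sup>2 + (X s \<omega> - S N \<omega>)\<^sup>2 / c"
          using am[of "\<bar>\<epsilon> t \<omega>\<bar>" "\<bar>X s \<omega> - S N \<omega>\<bar>"] by (simp add: abs_mult)
      qed
      also have "\<dots> = c * ?v + e N / c"
        using L L2_noise[of t] by (simp add: L2_var_def e_def)
      finally show ?thesis .
    qed
    moreover have "(\<lambda>N. c * ?v + e N / c) \<longlonglongrightarrow> c * ?v + 0 / c"
      using c by (intro tendsto_intros lim) auto
    ultimately show ?thesis by (intro LIMSEQ_le_const[of _ _]) auto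
  qed
  have "(\<lambda>n. 1 / real (Suc n) * ?v) \<longlonglongrightarrow> 0 * ?v"
    using LIMSEQ_inverse_real_of_nat by (intro tendsto_intros) (simp add: inverse_eq_divide)
  hence "\<bar>?x\<bar> \<le> 0 * ?v"
    by (rule LIMSEQ_le_const) (intro exI allI impI bound, simp)
  thus ?thesis by simp
qed

lemma expectation_lin_comb_sq:
  "expectation (\<lambda>\<omega>. (\<Sum>i\<in>I. w i * X (- int i) \<omega>)\<^sup>2) =
     (\<Sum>i\<in>I. \<Sum>j\<in>I. w i * w j * autocov M X (int i - int j))"
proof -
  have "expectation (\<lambda>\<omega>. (\<Sum>i\<in>I. w i * X (- int i) \<omega>)\<^sup>2) =
     expectation (\<lambda>\<omega>. \<Sum>i\<in>I. \<Sum>j\<in>I. w i * w j * (X (- int i) \<omega> * X (- int j) \<omega>))"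
    unfolding power2_eq_square sum_product by (simp add: mult_ac)
  also have "\<dots> = (\<Sum>i\<in>I. \<Sum>j\<in>I. w i * w j * expectation (\<lambda>\<omega>. X (- int i) \<omega> * X (- int j) \<omega>))"
    by (rule integral_double_sum) (intro L2_mult_integrable L2_X)
  finally show ?thesis by (simp add: expectation_X_mult add.commute)
qed

text \<open>Let \<open>Z\<close> be the error of the finite predictor, \<open>P\<close> the truncated autoregression and \<open>D = Z - P\<close>. Both
  \<open>Z\<close> and the noise \<open>\<epsilon> 0\<close> are orthogonal to the \<open>k\<close> past values of which \<open>D\<close> is a combination. Hence
  \<open>E D\<^sup>2 = E (D * (\<epsilon> 0 - P))\<close>, and \<open>\<epsilon> 0 - P\<close> is the tail of the autoregression.\<close>
lemma finite_predictor_close_to_AR: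
  assumes yw: "yule_walker (autocov M X) k \<alpha>"
    and R: "\<And>N. (\<Sum>i=Suc k..N. \<Sum>j=Suc k..N. a i * a j * autocov M X (int i - int j)) \<le> R"
  shows "toeplitz_form (autocov M X) k (\<lambda>i. - \<alpha> i - a i) \<le> 2 * R"
proof -
  define h where "h = (\<lambda>i. - \<alpha> i - a i)"
  define D where "D = (\<lambda>\<omega>. \<Sum>i=1..k. h i * X (- int i) \<omega>)"
  define Z where "Z = (\<lambda>\<omega>. X 0 \<omega> - (\<Sum>i=1..k. \<alpha> i * X (- int i) \<omega>))"
  define P where "P = (\<lambda>N \<omega>. \<Sum>i<N. a i * X (- int i) \<omega>)"
  have L2: "L2_var M D" "L2_var M Z" "L2_var M (P N)" "L2_var M (\<epsilon> 0)" for N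
    unfolding D_def Z_def P_def by (intro L2_diff L2_sum L2_scale L2_X L2_noise)+
  have L2e: "L2_var M (\<lambda>\<omega>. \<epsilon> 0 \<omega> - P N \<omega>)" for N by (intro L2_diff L2)
  have DZP: "D \<omega> = Z \<omega> - P (Suc k) \<omega>" for \<omega>
  proof -
    have "P (Suc k) \<omega> = X 0 \<omega> + (\<Sum>i=1..k. a i * X (- int i) \<omega>)"
      by (simp add: P_def lessThan_Suc_atMost atMost_atLeast0 sum.atLeast_Suc_atMost a_0)
    thus ?thesis by (simp add: D_def Z_def h_def left_diff_distrib sum_subtractf sum_negf)
  qed
  have DZ: "expectation (\<lambda>\<omega>. D \<omega> * Z \<omega>) = 0"
  proof -
    have XZ: "expectation (\<lambda>\<omega>. X (- int j) \<omega> * Z \<omega>) = 0" if j: "j \<in> {1..k}" for j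
    proof -
      have "(\<lambda>\<omega>. X (- int j) \<omega> * Z \<omega>) =
        (\<lambda>\<omega>. X (- int j) \<omega> * X 0 \<omega> - (\<Sum>i=1..k. \<alpha> i * (X (- int j) \<omega> * X (- int i) \<omega>)))"
        by (simp add: Z_def right_diff_distrib sum_distrib_left mult_ac)
      hence "expectation (\<lambda>\<omega>. X (- int j) \<omega> * Z \<omega>) =
        autocov M X (int j) - (\<Sum>i=1..k. \<alpha> i * autocov M X (int j - int i))"
        by (simp add: Bochner_Integration.integral_sum L2_mult_integrable L2_X expectation_X_mult add.commute)
      also have "\<dots> = autocov M X (int j) - (\<Sum>i=1..k. \<alpha> i * autocov M X (int i - int j))"
        using autocov_even[of "int _ - int j"] by simp
      also have "\<dots> = 0" using yw j by (simp add: yule_walker_def)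
      finally show ?thesis .
    qed
    have "(\<lambda>\<omega>. D \<omega> * Z \<omega>) = (\<lambda>\<omega>. \<Sum>j=1..k. h j * (X (- int j) \<omega> * Z \<omega>))"
      by (simp add: D_def sum_distrib_right mult.assoc)
    thus ?thesis by (simp add: Bochner_Integration.integral_sum L2_mult_integrable L2_X L2 XZ)
  qed
  have De: "expectation (\<lambda>\<omega>. D \<omega> * \<epsilon> 0 \<omega>) = 0"
  proof -
    have "expectation (\<lambda>\<omega>. X (- int j) \<omega> * \<epsilon> 0 \<omega>) = 0" if "j \<in> {1..k}" for j
      using noise_orthogonal_past[of "- int j" 0] that by (simp add: mult.commute)
    moreover have "(\<lambda>\<omega>. D \<omega> * \<epsilon> 0 \<omega>) = (\<lambda>\<omega>. \<Sum>j=1..k. h j * (X (- int j) \<omega> * \<epsilon> 0 \<omega>))"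
      by (simp add: D_def sum_distrib_right mult.assoc)
    ultimately show ?thesis by (simp add: Bochner_Integration.integral_sum L2_mult_integrable L2_X L2)
  qed
  have iD: "integrable M (\<lambda>\<omega>. (D \<omega>)\<^sup>2)" and ie: "integrable M (\<lambda>\<omega>. (\<epsilon> 0 \<omega> - P N \<omega>)\<^sup>2)" for N
    using L2(1) L2e by (auto simp: L2_var_def)
  \<comment> \<open>The inner product of \<open>D\<close> with the tail is absorbed by \<open>u w \<le> u\<^sup>2 / 2 + w\<^sup>2 / 2\<close>.\<close>
  have "expectation (\<lambda>\<omega>. (D \<omega>)\<^sup>2) \<le>
      expectation (\<lambda>\<omega>. (D \<omega> * Z \<omega> - D \<omega> * \<epsilon> 0 \<omega>) + ((D \<omega>)\<^sup>2 / 2 + (\<epsilon> 0 \<omega> - P (Suc k) \<omega>)\<^sup>2 / 2))"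
  proof (rule integral_mono[OF iD])
    show "integrable M (\<lambda>\<omega>. (D \<omega> * Z \<omega> - D \<omega> * \<epsilon> 0 \<omega>) + ((D \<omega>)\<^sup>2 / 2 + (\<epsilon> 0 \<omega> - P (Suc k) \<omega>)\<^sup>2 / 2))"
      using iD ie by (intro Bochner_Integration.integrable_add Bochner_Integration.integrable_diff
          L2_mult_integrable L2 integrable_divide) auto
    fix \<omega>
    have "u * w \<le> u\<^sup>2 / 2 + w\<^sup>2 / 2" for u w :: real
      using sum_squares_bound[of u w] by simp
    from this[of "D \<omega>" "\<epsilon> 0 \<omega> - P (Suc k) \<omega>"]
    have "D \<omega> * (\<epsilon> 0 \<omega> - P (Suc k) \<omega>) \<le> (D \<omega>)\<^sup>2 / 2 + (\<epsilon> 0 \<omega> - P (Suc k) \<omega>)\<^sup>2 / 2" .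
    moreover have "(D \<omega>)\<^sup>2 = D \<omega> * Z \<omega> - D \<omega> * \<epsilon> 0 \<omega> + D \<omega> * (\<epsilon> 0 \<omega> - P (Suc k) \<omega>)"
      by (simp add: DZP power2_eq_square algebra_simps)
    ultimately show "(D \<omega>)\<^sup>2 \<le> (D \<omega> * Z \<omega> - D \<omega> * \<epsilon> 0 \<omega>) + ((D \<omega>)\<^sup>2 / 2 + (\<epsilon> 0 \<omega> - P (Suc k) \<omega>)\<^sup>2 / 2)"
      by linarith
  qed
  also have "\<dots> = expectation (\<lambda>\<omega>. (D \<omega>)\<^sup>2) / 2 + expectation (\<lambda>\<omega>. (\<epsilon> 0 \<omega> - P (Suc k) \<omega>)\<^sup>2) / 2"
    by (simp add: L2_mult_integrable L2 iD ie DZ De)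
  finally have 1: "expectation (\<lambda>\<omega>. (D \<omega>)\<^sup>2) \<le> expectation (\<lambda>\<omega>. (\<epsilon> 0 \<omega> - P (Suc k) \<omega>)\<^sup>2)" by simp
  define e where "e = (\<lambda>N. expectation (\<lambda>\<omega>. (\<epsilon> 0 \<omega> - P N \<omega>)\<^sup>2))"
  have lim: "e \<longlonglongrightarrow> 0"
    using autoregression[of 0] unfolding L2_sums_def e_def P_def by simp
  have "expectation (\<lambda>\<omega>. (\<epsilon> 0 \<omega> - P (Suc k) \<omega>)\<^sup>2) \<le> 2 * e (Suc N) + 2 * R" if N: "N \<ge> k" for N
  proof -
    define T where "T = (\<lambda>\<omega>. \<Sum>i=Suc k..N. a i * X (- int i) \<omega>)"
    have L2T: "L2_var M T" unfolding T_def by (intro L2_sum L2_scale L2_X)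
    have PT: "P (Suc N) \<omega> = P (Suc k) \<omega> + T \<omega>" for \<omega>
    proof -
      have "P (Suc N) \<omega> = (\<Sum>i\<in>{..<Suc k} \<union> {Suc k..N}. a i * X (- int i) \<omega>)"
        unfolding P_def using N by (intro sum.cong) auto
      also have "\<dots> = P (Suc k) \<omega> + T \<omega>"
        unfolding P_def T_def by (rule sum.union_disjoint) auto
      finally show ?thesis .
    qed
    have "expectation (\<lambda>\<omega>. (\<epsilon> 0 \<omega> - P (Suc k) \<omega>)\<^sup>2) \<le>
       expectation (\<lambda>\<omega>. 2 * (\<epsilon> 0 \<omega> - P (Suc N) \<omega>)\<^sup>2 + 2 * (T \<omega>)\<^sup>2)"
    proof (rule integral_mono[OF ie])
      show "integrable M (\<lambda>\<omega>. 2 * (\<epsilon> 0 \<omega> - P (Suc N) \<omega>)\<^sup>2 + 2 * (T \<omega>)\<^sup>2)"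
        using ie L2T by (simp add: L2_var_def)
      fix \<omega>
      have "0 \<le> (\<epsilon> 0 \<omega> - P (Suc N) \<omega> - T \<omega>)\<^sup>2" by simp
      thus "(\<epsilon> 0 \<omega> - P (Suc k) \<omega>)\<^sup>2 \<le> 2 * (\<epsilon> 0 \<omega> - P (Suc N) \<omega>)\<^sup>2 + 2 * (T \<omega>)\<^sup>2"
        by (simp add: PT power2_eq_square algebra_simps)
    qed
    also have "\<dots> = 2 * e (Suc N) + 2 * expectation (\<lambda>\<omega>. (T \<omega>)\<^sup>2)"
      using ie L2T by (simp add: L2_var_def e_def)
    also have "expectation (\<lambda>\<omega>. (T \<omega>)\<^sup>2) \<le> R"
      unfolding T_def expectation_lin_comb_sq by (rule R)
    finally show ?thesis by simp
  qed
  moreover have "(\<lambda>N. 2 * e (Suc N) + 2 * R) \<longlonglongrightarrow> 2 * 0 + 2 * R"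
    by (intro tendsto_intros LIMSEQ_Suc lim)
  ultimately have "expectation (\<lambda>\<omega>. (\<epsilon> 0 \<omega> - P (Suc k) \<omega>)\<^sup>2) \<le> 2 * 0 + 2 * R"
    by (intro LIMSEQ_le_const) auto
  moreover have "expectation (\<lambda>\<omega>. (D \<omega>)\<^sup>2) = toeplitz_form (autocov M X) k h"
    unfolding D_def expectation_lin_comb_sq toeplitz_form_def ..
  ultimately show ?thesis using 1 by (simp add: h_def)
qed

text \<open>The exponent \<open>\<eta> = 1 / 2 - 2 d\<close> in the coefficient bounds is positive for \<open>d < 1 / 4\<close>, and it makes the
  tail of the autoregression have variance of the order \<open>k powr (- 4 d)\<close> that \<open>convolution_bound\<close> needs.\<close>
lemma finite_predictor_coefficients:
  assumes d: "0 < d" "d < 1 / 4"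
    and lags: "long_memory_lags (autocov M X) d c"
    and \<mu>: "\<mu> > 0" "\<And>k x. \<mu> * (\<Sum>i=1..k. (x i)\<^sup>2) \<le> toeplitz_form (autocov M X) k x"
  shows "\<exists>H. \<forall>k\<ge>1. \<forall>\<alpha>. yule_walker (autocov M X) k \<alpha> \<longrightarrow>
    (\<Sum>i\<le>k. ((if i = 0 then 1 else - \<alpha> i) - a i)\<^sup>2) \<le> H * real k powr (- 4 * d)"
proof -
  interpret lg: long_memory_lags "autocov M X" d c by (rule lags)
  obtain A C2 where "\<forall>j\<ge>1. \<bar>a j\<bar> \<le> A * real j powr (- d - 1 + (1/2 - 2 * d)) \<and>
      \<bar>b j\<bar> \<le> C2 * real j powr (d - 1 + (1/2 - 2 * d))"
    using coefficient_bounds[of "1/2 - 2 * d"] d by auto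
  moreover have "- d - 1 + (1/2 - 2 * d) = - 1/2 - 3 * d" by simp
  ultimately have A: "\<bar>a j\<bar> \<le> A * real j powr (- 1/2 - 3 * d)" if "j \<ge> 1" for j using that by metis
  define C where "C = A\<^sup>2 * c * (1 + 2 * (1 / (2 * d) + 1 / (1/2 + d))) / (4 * d)"
  show ?thesis
  proof (intro exI[of _ "2 * C / \<mu>"] allI impI)
    fix k :: nat and \<alpha> assume k: "1 \<le> k" and yw: "yule_walker (autocov M X) k \<alpha>"
    let ?h = "\<lambda>i. - \<alpha> i - a i"
    have "\<mu> * (\<Sum>i=1..k. (?h i)\<^sup>2) \<le> toeplitz_form (autocov M X) k ?h" by (rule \<mu>)
    also have "\<dots> \<le> 2 * (C * real k powr (- 4 * d))"
    proof (rule finite_predictor_close_to_AR[OF yw])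
      fix N show "(\<Sum>i=Suc k..N. \<Sum>j=Suc k..N. a i * a j * autocov M X (int i - int j)) \<le> C * real k powr (- 4 * d)"
        using lg.tail_quadratic_form_le[OF k A, of N] unfolding C_def by (rule abs_le_D1)
    qed
    finally have "(\<Sum>i=1..k. (?h i)\<^sup>2) \<le> 2 * C / \<mu> * real k powr (- 4 * d)"
      using \<mu>(1) by (simp add: field_simps)
    moreover have "(\<Sum>i\<le>k. ((if i = 0 then 1 else - \<alpha> i) - a i)\<^sup>2) = (\<Sum>i=1..k. (?h i)\<^sup>2)"
      by (simp add: atMost_atLeast0 sum.atLeast_Suc_atMost a_0)
    ultimately show "(\<Sum>i\<le>k. ((if i = 0 then 1 else - \<alpha> i) - a i)\<^sup>2) \<le> 2 * C / \<mu> * real k powr (- 4 * d)"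
      by simp
  qed
qed

end

section \<open>Moments of the empirical autocovariances\<close>

locale gaussian_long_memory = gaussian_space M G + long_memory_lags \<sigma> d c
  for M :: "'a measure" and G and \<sigma> d c +
  fixes Y :: "int \<Rightarrow> 'a \<Rightarrow> real"
  assumes Y_in_G: "Y n \<in> G"
    and Y_cov: "(\<integral>\<omega>. Y m \<omega> * Y n \<omega> \<partial>M) = \<sigma> (n - m)"
begin

lemma sum_sq_shift_le:
  assumes "finite F" "inj_on f F"
  shows "(\<Sum>n\<in>F. (\<sigma> (f n))\<^sup>2) \<le> sq_sum_bound"
proof -
  have "(\<Sum>n\<in>F. (\<sigma> (f n))\<^sup>2) = (\<Sum>n\<in>f ` F. (\<sigma> n)\<^sup>2)" by (subst sum.reindex[OF assms(2)]) simp
  also have "\<dots> \<le> sq_sum_bound" using assms by (intro sum_sq_le) auto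
  finally show ?thesis .
qed

text \<open>The factors 8 and 27 are those of convexity of the fourth power for two and three summands, and 16 comes from the
  halves in the polarization identity. The variables \<open>Y t + Y (t + h)\<close> have covariances that are sums of
  four autocovariances, whence the factor 18.\<close>
definition fourth_moment_const :: "nat \<Rightarrow> real" where
  "fourth_moment_const h = 8 * (27 / 16 * (108 * (18 * sq_sum_bound)\<^sup>2 + 2 * (108 * sq_sum_bound\<^sup>2)) + (real h * c) ^ 4)"

lemma all_moments_Y: "all_moments M (Y n)"
  by (rule moments_G(1)[OF Y_in_G])

lemma all_moments_emp: "all_moments M (\<lambda>\<omega>. emp_autocov T (sample_path Y \<omega>) h)"
proof -
  have "all_moments M (\<lambda>\<omega>. 1 / real T * (\<Sum>t\<in>{1..int T - \<bar>h\<bar>}. Y t \<omega> * Y (t + \<bar>h\<bar>) \<omega>))"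
    by (intro all_moments_intros all_moments_Y)
  thus ?thesis by (simp add: emp_autocov_def sample_path_def)
qed

text \<open>By polarization, \<open>2 Y t Y (t + h) = (Y t + Y (t + h))\<^sup>2 - (Y t)\<^sup>2 - (Y (t + h))\<^sup>2\<close>, so the centred
  empirical autocovariance is a combination of three sums of centred squares. The term with
  \<open>real h * c\<close> in the constant is the bias caused by dividing \<open>T - h\<close> products by \<open>T\<close>.\<close>
lemma emp_autocov_fourth_moment:
  assumes T: "T > h"
  shows "expectation (\<lambda>\<omega>. (emp_autocov T (sample_path Y \<omega>) (int h) - \<sigma> (int h)) ^ 4)
     \<le> fourth_moment_const h / (real T)\<^sup>2"
proof -
  define J where "J = {1..int T - int h}"
  have J: "finite J" "real (card J) = real T - real h" using T by (auto simp: J_def)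
  have cJ: "real (card J) \<le> real T" using J by simp
  define V where "V = (\<lambda>t. \<lambda>\<omega>. Y t \<omega> + Y (t + int h) \<omega>)"
  define S1 where "S1 = (\<lambda>\<omega>. \<Sum>t\<in>J. (V t \<omega>)\<^sup>2 - (2 * \<sigma> 0 + 2 * \<sigma> (int h)))"
  define S2 where "S2 = (\<lambda>\<omega>. \<Sum>t\<in>J. (Y t \<omega>)\<^sup>2 - \<sigma> 0)"
  define S3 where "S3 = (\<lambda>\<omega>. \<Sum>t\<in>J. (Y (t + int h) \<omega>)\<^sup>2 - \<sigma> 0)"
  note amY = all_moments_Y
  let ?e4 = "\<lambda>\<omega>. (emp_autocov T (sample_path Y \<omega>) (int h) - \<sigma> (int h)) ^ 4"
    and ?b4 = "\<lambda>\<omega>. 8 * (27 / 16 * (S1 \<omega> ^ 4 + S2 \<omega> ^ 4 + S3 \<omega> ^ 4) + (real h * c) ^ 4) / real T ^ 4"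
  have am: "all_moments M S1" "all_moments M S2" "all_moments M S3"
    unfolding S1_def S2_def S3_def V_def by (intro all_moments_intros amY)+
  have VV: "expectation (\<lambda>\<omega>. V p \<omega> * V q \<omega>) = 2 * \<sigma> (q - p) + \<sigma> (q + int h - p) + \<sigma> (q - p - int h)" for p q
  proof -
    have i: "integrable M (\<lambda>\<omega>. Y m \<omega> * Y n \<omega>)" for m n
      by (intro all_moments_integrable all_moments_intros amY)
    have "expectation (\<lambda>\<omega>. V p \<omega> * V q \<omega>) = expectation (\<lambda>\<omega>. Y p \<omega> * Y q \<omega> + Y p \<omega> * Y (q + int h) \<omega>
       + (Y (p + int h) \<omega> * Y q \<omega> + Y (p + int h) \<omega> * Y (q + int h) \<omega>))"
      by (simp add: V_def algebra_simps)
    also have "\<dots> = \<sigma> (q - p) + \<sigma> (q + int h - p) + (\<sigma> (q - (p + int h)) + \<sigma> (q - p))"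
      by (simp add: i Y_cov)
    finally show ?thesis by (simp add: algebra_simps)
  qed
  have m1: "expectation (\<lambda>\<omega>. S1 \<omega> ^ 4) \<le> 108 * (18 * sq_sum_bound)\<^sup>2 * (real T)\<^sup>2"
  proof -
    have "expectation (\<lambda>\<omega>. (\<Sum>p\<in>J. (V p \<omega>)\<^sup>2 - expectation (\<lambda>\<omega>. V p \<omega> * V p \<omega>)) ^ 4)
      \<le> 108 * (18 * sq_sum_bound)\<^sup>2 * (real T)\<^sup>2"
    proof (rule fourth_moment_from_cov[OF _ J(1) _ cJ])
      show "V p \<in> G" for p unfolding V_def by (intro add_G Y_in_G)
      fix p
      have sq: "(2 * x + y + z)\<^sup>2 \<le> 12 * x\<^sup>2 + 3 * y\<^sup>2 + 3 * z\<^sup>2" for x y z :: real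
      proof -
        have "0 \<le> (2 * x - y)\<^sup>2 + (y - z)\<^sup>2 + (2 * x - z)\<^sup>2" by simp
        thus ?thesis by (simp add: power2_eq_square algebra_simps)
      qed
      have "(\<Sum>q\<in>J. (expectation (\<lambda>\<omega>. V p \<omega> * V q \<omega>))\<^sup>2) \<le> (\<Sum>q\<in>J. 12 * (\<sigma> (q - p))\<^sup>2
          + 3 * (\<sigma> (q + int h - p))\<^sup>2 + 3 * (\<sigma> (q - p - int h))\<^sup>2)"
        unfolding VV by (intro sum_mono sq)
      also have "\<dots> = 12 * (\<Sum>q\<in>J. (\<sigma> (q - p))\<^sup>2) + 3 * (\<Sum>q\<in>J. (\<sigma> (q + int h - p))\<^sup>2)
          + 3 * (\<Sum>q\<in>J. (\<sigma> (q - p - int h))\<^sup>2)" by (simp add: sum.distrib sum_distrib_left)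
      also have "\<dots> \<le> 12 * sq_sum_bound + 3 * sq_sum_bound + 3 * sq_sum_bound"
        using J(1) by (intro add_mono mult_left_mono sum_sq_shift_le) (auto simp: inj_on_def)
      finally show "(\<Sum>q\<in>J. (expectation (\<lambda>\<omega>. V p \<omega> * V q \<omega>))\<^sup>2) \<le> 18 * sq_sum_bound" by simp
    qed
    moreover have "expectation (\<lambda>\<omega>. V p \<omega> * V p \<omega>) = 2 * \<sigma> 0 + 2 * \<sigma> (int h)" for p
      unfolding VV using even[of "int h"] by simp
    ultimately show ?thesis unfolding S1_def by simp
  qed
  have m23: "expectation (\<lambda>\<omega>. (\<Sum>t\<in>J. (Y (t + s) \<omega>)\<^sup>2 - \<sigma> 0) ^ 4) \<le> 108 * sq_sum_bound\<^sup>2 * (real T)\<^sup>2" for s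
  proof -
    have "expectation (\<lambda>\<omega>. (\<Sum>p\<in>J. (Y (p + s) \<omega>)\<^sup>2 - expectation (\<lambda>\<omega>. Y (p + s) \<omega> * Y (p + s) \<omega>)) ^ 4)
      \<le> 108 * sq_sum_bound\<^sup>2 * (real T)\<^sup>2"
    proof (rule fourth_moment_from_cov[OF _ J(1) _ cJ])
      show "Y (p + s) \<in> G" for p by (rule Y_in_G)
      show "(\<Sum>q\<in>J. (expectation (\<lambda>\<omega>. Y (p + s) \<omega> * Y (q + s) \<omega>))\<^sup>2) \<le> sq_sum_bound" for p
        unfolding Y_cov using J(1) by (intro sum_sq_shift_le) (auto simp: inj_on_def)
    qed
    thus ?thesis by (simp add: Y_cov)
  qed
  have m2: "expectation (\<lambda>\<omega>. S2 \<omega> ^ 4) \<le> 108 * sq_sum_bound\<^sup>2 * (real T)\<^sup>2"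
    using m23[of 0] by (simp add: S2_def)
  have m3: "expectation (\<lambda>\<omega>. S3 \<omega> ^ 4) \<le> 108 * sq_sum_bound\<^sup>2 * (real T)\<^sup>2"
    using m23[of "int h"] by (simp add: S3_def)
  have rep: "emp_autocov T (sample_path Y \<omega>) (int h) - \<sigma> (int h) =
      ((S1 \<omega> - S2 \<omega> - S3 \<omega>) / 2 - real h * \<sigma> (int h)) / real T" for \<omega>
  proof -
    have "(S1 \<omega> - S2 \<omega> - S3 \<omega>) / 2 = (\<Sum>t\<in>J. Y t \<omega> * Y (t + int h) \<omega> - \<sigma> (int h))"
      unfolding S1_def S2_def S3_def sum_subtractf[symmetric] sum_divide_distrib
      by (intro sum.cong refl) (simp add: V_def power2_eq_square field_simps)
    also have "\<dots> = real T * emp_autocov T (sample_path Y \<omega>) (int h) - (real T - real h) * \<sigma> (int h)"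
      using T J(2) by (simp add: emp_autocov_def sample_path_def J_def sum_subtractf)
    finally show ?thesis using T by (simp add: field_simps)
  qed
  have pw: "?e4 \<omega> \<le>
     ?b4 \<omega>" for \<omega>
  proof -
    have p2: "(x - y) ^ 4 \<le> 8 * (x ^ 4 + y ^ 4)" for x y :: real
    proof -
      have 1: "(x - y)\<^sup>2 \<le> 2 * (x\<^sup>2 + y\<^sup>2)" using zero_le_power2[of "x + y"] by (simp add: power2_eq_square algebra_simps)
      have 2: "(x\<^sup>2 + y\<^sup>2)\<^sup>2 \<le> 2 * (x ^ 4 + y ^ 4)"
        using zero_le_power2[of "x\<^sup>2 - y\<^sup>2"] by (simp add: power2_eq_square power4_eq_xxxx algebra_simps)
      have "(x - y) ^ 4 = ((x - y)\<^sup>2)\<^sup>2" by simp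
      also have "\<dots> \<le> (2 * (x\<^sup>2 + y\<^sup>2))\<^sup>2" using 1 by (intro power_mono) auto
      also have "\<dots> = 4 * (x\<^sup>2 + y\<^sup>2)\<^sup>2" by (simp add: power_mult_distrib del: distrib_left_numeral)
      finally show ?thesis using 2 by simp
    qed
    have p3: "(x - y - z) ^ 4 \<le> 27 * (x ^ 4 + y ^ 4 + z ^ 4)" for x y z :: real
    proof -
      have sq3: "(u + v + w)\<^sup>2 \<le> 3 * (u\<^sup>2 + v\<^sup>2 + w\<^sup>2)" for u v w :: real
      proof -
        have "0 \<le> (u - v)\<^sup>2 + (v - w)\<^sup>2 + (u - w)\<^sup>2" by simp
        thus ?thesis by (simp add: power2_eq_square algebra_simps)
      qed
      have "(x - y - z) ^ 4 = ((x + (- y) + (- z))\<^sup>2)\<^sup>2" by simp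
      also have "\<dots> \<le> (3 * (x\<^sup>2 + y\<^sup>2 + z\<^sup>2))\<^sup>2"
        using sq3[of x "- y" "- z"] by (intro power_mono) auto
      also have "\<dots> = 9 * (x\<^sup>2 + y\<^sup>2 + z\<^sup>2)\<^sup>2" by (simp add: power_mult_distrib del: distrib_left_numeral)
      also have "\<dots> \<le> 9 * (3 * ((x\<^sup>2)\<^sup>2 + (y\<^sup>2)\<^sup>2 + (z\<^sup>2)\<^sup>2))" by (intro mult_left_mono sq3) auto
      finally show ?thesis by simp
    qed
    have "?e4 \<omega> =
       ((S1 \<omega> - S2 \<omega> - S3 \<omega>) / 2 - real h * \<sigma> (int h)) ^ 4 / real T ^ 4"
      unfolding rep by (simp add: power_divide)
    also have "\<dots> \<le> 8 * (((S1 \<omega> - S2 \<omega> - S3 \<omega>) / 2) ^ 4 + (real h * \<sigma> (int h)) ^ 4) / real T ^ 4"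
      by (intro divide_right_mono p2) auto
    also have "\<dots> \<le> ?b4 \<omega>"
    proof (intro divide_right_mono mult_left_mono add_mono)
      show "((S1 \<omega> - S2 \<omega> - S3 \<omega>) / 2) ^ 4 \<le> 27 / 16 * (S1 \<omega> ^ 4 + S2 \<omega> ^ 4 + S3 \<omega> ^ 4)"
        using p3[of "S1 \<omega>" "S2 \<omega>" "S3 \<omega>"] by (simp add: power_divide)
      have "\<bar>real h * \<sigma> (int h)\<bar> \<le> real h * c" using abs_le_c[of "int h"] by (simp add: abs_mult mult_left_mono)
      hence "\<bar>real h * \<sigma> (int h)\<bar> ^ 4 \<le> (real h * c) ^ 4" by (intro power_mono) auto
      thus "(real h * \<sigma> (int h)) ^ 4 \<le> (real h * c) ^ 4" by (simp only: power_even_abs_numeral even_numeral)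
    qed auto
    finally show ?thesis .
  qed
  have iS: "integrable M (\<lambda>\<omega>. S1 \<omega> ^ 4)" "integrable M (\<lambda>\<omega>. S2 \<omega> ^ 4)" "integrable M (\<lambda>\<omega>. S3 \<omega> ^ 4)"
    by (intro all_moments_integrable all_moments_intros am)+
  have "expectation (\<lambda>\<omega>. ?e4 \<omega>) \<le>
    expectation (\<lambda>\<omega>. ?b4 \<omega>)"
  proof (rule integral_mono[OF _ _ pw])
    show "integrable M (\<lambda>\<omega>. ?e4 \<omega>)"
      by (intro all_moments_integrable all_moments_intros all_moments_emp)
    show "integrable M (\<lambda>\<omega>. ?b4 \<omega>)"
      using iS by (intro integrable_divide integrable_mult_right Bochner_Integration.integrable_add) auto
  qed
  also have "\<dots> = 8 * (27 / 16 * (expectation (\<lambda>\<omega>. S1 \<omega> ^ 4) + expectation (\<lambda>\<omega>. S2 \<omega> ^ 4)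
      + expectation (\<lambda>\<omega>. S3 \<omega> ^ 4)) + (real h * c) ^ 4) / real T ^ 4"
    using iS by (simp add: prob_space)
  also have "\<dots> \<le> 8 * (27 / 16 * (108 * (18 * sq_sum_bound)\<^sup>2 * (real T)\<^sup>2 + 108 * sq_sum_bound\<^sup>2 * (real T)\<^sup>2
      + 108 * sq_sum_bound\<^sup>2 * (real T)\<^sup>2) + (real h * c) ^ 4 * (real T)\<^sup>2) / real T ^ 4"
  proof (intro divide_right_mono mult_left_mono add_mono m1 m2 m3)
    have "1 \<le> (real T)\<^sup>2" using T by (intro one_le_power) auto
    thus "(real h * c) ^ 4 \<le> (real h * c) ^ 4 * (real T)\<^sup>2"
      using mult_left_mono[of 1 "(real T)\<^sup>2" "(real h * c) ^ 4"] c_nonneg by simp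
  qed auto
  also have "\<dots> = fourth_moment_const h * (real T)\<^sup>2 / real T ^ 4"
    by (simp add: fourth_moment_const_def algebra_simps)
  also have "\<dots> = fourth_moment_const h / (real T)\<^sup>2"
    using T by (simp add: power2_eq_square power4_eq_xxxx)
  finally show ?thesis .
qed

text \<open>The residual is \<open>1 / T\<close> times a sum over pairs \<open>(q, i)\<close> of \<open>u i * Y q * Y (q + i - j)\<close>, with both times inside the
  observation window. Its mean would vanish by orthogonality if no time left the window, and
  for fixed \<open>k\<close> it is \<open>O(1 / T)\<close>. The two remaining pairings in Isserlis' formula are sums of products of
  values of the convolution \<open>U\<close> of \<open>\<bar>u\<bar>\<close> with \<open>\<bar>\<sigma>\<bar>\<close>, for fixed \<open>q\<close> bounded by its squared \<open>l\<^sup>2\<close> norm.\<close>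
lemma normal_equation_second_moment:
  fixes u :: "nat \<Rightarrow> real"
  assumes T: "T \<ge> 1" and j: "j \<in> {1..k}"
    and orth: "(\<Sum>i\<le>k. u i * \<sigma> (int i - int j)) = 0"
    and B: "\<And>F. finite F \<Longrightarrow> (\<Sum>n\<in>F. (\<Sum>i\<le>k. \<bar>u i\<bar> * \<bar>\<sigma> (n - int i)\<bar>)\<^sup>2) \<le> B"
  shows "expectation (\<lambda>\<omega>. (\<Sum>i\<le>k. u i * emp_autocov T (sample_path Y \<omega>) (int i - int j))\<^sup>2)
     \<le> ((real k * c * (\<Sum>i\<le>k. \<bar>u i\<bar>))\<^sup>2 + 2 * real T * B) / (real T)\<^sup>2"
proof -
  define Q where "Q = {1..int T}"
  define P where "P = {p \<in> Q \<times> {..k}. fst p + int (snd p) - int j \<in> Q}"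
  have fin: "finite P" "finite Q" "P \<subseteq> Q \<times> {..k}" by (auto simp: P_def Q_def)
  define A where "A = (\<lambda>p :: int \<times> nat. Y (fst p))"
  define A' where "A' = (\<lambda>p :: int \<times> nat. Y (fst p + int (snd p) - int j))"
  have rep: "real T * (\<Sum>i\<le>k. u i * emp_autocov T (sample_path Y \<omega>) (int i - int j)) =
     (\<Sum>p\<in>P. u (snd p) * (A p \<omega> * A' p \<omega>))" for \<omega>
  proof -
    have "real T * (\<Sum>i\<le>k. u i * emp_autocov T (sample_path Y \<omega>) (int i - int j)) =
      (\<Sum>i\<le>k. u i * (real T * emp_autocov T (sample_path Y \<omega>) (int i - int j)))"
      by (simp add: sum_distrib_left mult_ac)
    also have "\<dots> = (\<Sum>i\<le>k. \<Sum>q\<in>Q. if q + int i - int j \<in> Q then u i * (Y q \<omega> * Y (q + int i - int j) \<omega>) else 0)"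
      unfolding emp_autocov_window[OF T] sum_distrib_left Q_def sample_path_def
      by (intro sum.cong refl) (simp add: algebra_simps)
    also have "\<dots> = (\<Sum>p\<in>Q \<times> {..k}. if fst p + int (snd p) - int j \<in> Q then u (snd p) * (A p \<omega> * A' p \<omega>) else 0)"
      by (subst sum.swap) (simp add: sum.cartesian_product case_prod_beta' A_def A'_def cong: if_cong)
    also have "\<dots> = (\<Sum>p\<in>P. u (snd p) * (A p \<omega> * A' p \<omega>))"
      unfolding P_def using fin by (intro sum.inter_filter[symmetric]) auto
    finally show ?thesis .
  qed
  define U where "U = (\<lambda>n. \<Sum>i\<le>k. \<bar>u i\<bar> * \<bar>\<sigma> (n - int i)\<bar>)"
  have first: "\<bar>\<Sum>p\<in>P. u (snd p) * expectation (\<lambda>\<omega>. A p \<omega> * A' p \<omega>)\<bar> \<le> real k * c * (\<Sum>i\<le>k. \<bar>u i\<bar>)"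
  proof -
    \<comment> \<open>The number of times \<open>q\<close> for which lag \<open>i - j\<close> stays inside the window differs from \<open>T\<close> by at most \<open>k\<close>.\<close>
    define m where "m = (\<lambda>i. real (card {q \<in> Q. q + int i - int j \<in> Q}))"
    have "(\<Sum>p\<in>P. u (snd p) * expectation (\<lambda>\<omega>. A p \<omega> * A' p \<omega>)) = (\<Sum>p\<in>P. u (snd p) * \<sigma> (int (snd p) - int j))"
      by (intro sum.cong refl) (simp add: A_def A'_def Y_cov)
    also have "\<dots> = (\<Sum>p\<in>Q \<times> {..k}. if fst p + int (snd p) - int j \<in> Q then u (snd p) * \<sigma> (int (snd p) - int j) else 0)"
      unfolding P_def using fin by (intro sum.inter_filter) auto
    also have "\<dots> = (\<Sum>i\<le>k. \<Sum>q\<in>Q. if q + int i - int j \<in> Q then u i * \<sigma> (int i - int j) else 0)"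
      by (subst sum.swap) (simp add: sum.cartesian_product case_prod_beta')
    also have "\<dots> = (\<Sum>i\<le>k. u i * \<sigma> (int i - int j) * m i)"
      unfolding m_def using fin by (intro sum.cong refl, subst sum.inter_filter[symmetric]) auto
    also have "\<dots> = (\<Sum>i\<le>k. u i * \<sigma> (int i - int j) * m i) - real T * (\<Sum>i\<le>k. u i * \<sigma> (int i - int j))"
      using orth by simp
    also have "\<dots> = (\<Sum>i\<le>k. u i * \<sigma> (int i - int j) * (m i - real T))"
      by (simp add: sum_distrib_left sum_subtractf[symmetric] algebra_simps)
    also have "\<bar>\<dots>\<bar> \<le> (\<Sum>i\<le>k. \<bar>u i\<bar> * c * real k)"
    proof (rule order_trans[OF sum_abs sum_mono])
      fix i assume i: "i \<in> {..k}"
      have mT: "\<bar>m i - real T\<bar> \<le> real k"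
      proof -
        let ?G = "{q \<in> Q. q + int i - int j \<in> Q}"
        have "card Q = T" by (simp add: Q_def)
        have "?G \<subseteq> Q" by auto
        hence c1: "card (Q - ?G) = T - card ?G" "card ?G \<le> T"
          using fin \<open>card Q = T\<close> by (auto simp: card_Diff_subset card_mono finite_subset)
        have "Q - ?G \<subseteq> (if i \<ge> j then {int T - (int i - int j) + 1..int T} else {1..int j - int i})"
          by (auto simp: Q_def)
        hence "card (Q - ?G) \<le> card (if i \<ge> j then {int T - (int i - int j) + 1..int T} else {1..int j - int i})"
          by (rule card_mono[rotated]) auto
        also have "\<dots> \<le> k" using i j by auto
        finally show ?thesis using c1 unfolding m_def by linarith
      qed
      have "\<bar>u i * \<sigma> (int i - int j) * (m i - real T)\<bar> = \<bar>u i\<bar> * \<bar>\<sigma> (int i - int j)\<bar> * \<bar>m i - real T\<bar>"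
        by (simp add: abs_mult)
      also have "\<dots> \<le> \<bar>u i\<bar> * c * real k"
        using mT abs_le_c c_nonneg by (intro mult_mono mult_left_mono) auto
      finally show "\<bar>u i * \<sigma> (int i - int j) * (m i - real T)\<bar> \<le> \<bar>u i\<bar> * c * real k" .
    qed
    also have "\<dots> = real k * c * (\<Sum>i\<le>k. \<bar>u i\<bar>)" by (simp add: sum_distrib_left mult_ac)
    finally show ?thesis .
  qed
  have conv_a: "(\<Sum>q'\<in>Q. \<Sum>i\<le>k. \<Sum>i'\<le>k. \<bar>u i\<bar> * \<bar>u i'\<bar> * (\<bar>\<sigma> (q' - q)\<bar> * \<bar>\<sigma> (q' + int i' - q - int i)\<bar>)) \<le> B" (is "?lhs \<le> B")
    if q: "q \<in> Q" for q
  proof -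
    define F where "F = {- int T..int T + int k}"
    have "?lhs =
      (\<Sum>i\<le>k. \<Sum>i'\<le>k. \<Sum>q'\<in>Q. \<bar>u i\<bar> * \<bar>u i'\<bar> * (\<bar>\<sigma> (q' - q)\<bar> * \<bar>\<sigma> (q' + int i' - q - int i)\<bar>))"
      by (subst sum.swap) (intro sum.cong refl sum.swap)
    also have "\<dots> \<le> (\<Sum>i\<le>k. \<Sum>i'\<le>k. \<Sum>n\<in>F. \<bar>u i\<bar> * \<bar>u i'\<bar> * (\<bar>\<sigma> (n - int i)\<bar> * \<bar>\<sigma> (n - int i')\<bar>))"
    proof (intro sum_mono)
      fix i i' assume i: "i \<in> {..k}" "i' \<in> {..k}"
      let ?g = "\<lambda>n. \<bar>u i\<bar> * \<bar>u i'\<bar> * (\<bar>\<sigma> (n - int i)\<bar> * \<bar>\<sigma> (n - int i')\<bar>)"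
      have "(\<Sum>q'\<in>Q. \<bar>u i\<bar> * \<bar>u i'\<bar> * (\<bar>\<sigma> (q' - q)\<bar> * \<bar>\<sigma> (q' + int i' - q - int i)\<bar>)) =
         (\<Sum>q'\<in>Q. ?g (q - q' + int i))"
      proof (rule sum.cong[OF refl])
        fix q'
        have "\<sigma> (q' - q) = \<sigma> (q - q' + int i - int i)" using even[of "q - q'"] by simp
        moreover have "\<sigma> (q' + int i' - q - int i) = \<sigma> (q - q' + int i - int i')"
          using even[of "q - q' + int i - int i'"] by (simp add: algebra_simps)
        ultimately show "\<bar>u i\<bar> * \<bar>u i'\<bar> * (\<bar>\<sigma> (q' - q)\<bar> * \<bar>\<sigma> (q' + int i' - q - int i)\<bar>) = ?g (q - q' + int i)"
          by simp
      qed
      also have "\<dots> = (\<Sum>n\<in>(\<lambda>q'. q - q' + int i) ` Q. ?g n)"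
        by (subst sum.reindex) (auto simp: inj_on_def)
      also have "\<dots> \<le> (\<Sum>n\<in>F. ?g n)"
        using q i by (intro sum_mono2) (auto simp: F_def Q_def)
      finally show "(\<Sum>q'\<in>Q. \<bar>u i\<bar> * \<bar>u i'\<bar> * (\<bar>\<sigma> (q' - q)\<bar> * \<bar>\<sigma> (q' + int i' - q - int i)\<bar>)) \<le> (\<Sum>n\<in>F. ?g n)" .
    qed
    also have "\<dots> = (\<Sum>n\<in>F. \<Sum>i\<le>k. \<Sum>i'\<le>k. \<bar>u i\<bar> * \<bar>u i'\<bar> * (\<bar>\<sigma> (n - int i)\<bar> * \<bar>\<sigma> (n - int i')\<bar>))"
      by (simp only: sum.swap[where B = F])
    also have "\<dots> = (\<Sum>n\<in>F. (U n)\<^sup>2)"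
      by (simp add: U_def power2_eq_square sum_product mult_ac)
    also have "\<dots> \<le> B" unfolding U_def by (rule B) (simp add: F_def)
    finally show ?thesis .
  qed
  have conv_b: "(\<Sum>q'\<in>Q. \<Sum>i\<le>k. \<Sum>i'\<le>k. \<bar>u i\<bar> * \<bar>u i'\<bar> *
       (\<bar>\<sigma> (q' + int i' - int j - q)\<bar> * \<bar>\<sigma> (q' - (q + int i - int j))\<bar>)) \<le> B" (is "?lhs \<le> B") for q
  proof -
    have "?lhs =
       (\<Sum>q'\<in>Q. U (q' - q + int j) * U (q - q' + int j))"
      unfolding U_def sum_product
    proof (intro sum.cong refl)
      fix q' :: int and i i' :: nat
      have "\<sigma> (q' + int i' - int j - q) = \<sigma> (q - q' + int j - int i')"
        using even[of "q - q' + int j - int i'"] by (simp add: algebra_simps)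
      moreover have "\<sigma> (q' - (q + int i - int j)) = \<sigma> (q' - q + int j - int i)" by (simp add: algebra_simps)
      ultimately show "\<bar>u i\<bar> * \<bar>u i'\<bar> * (\<bar>\<sigma> (q' + int i' - int j - q)\<bar> * \<bar>\<sigma> (q' - (q + int i - int j))\<bar>) =
        \<bar>u i\<bar> * \<bar>\<sigma> (q' - q + int j - int i)\<bar> * (\<bar>u i'\<bar> * \<bar>\<sigma> (q - q' + int j - int i')\<bar>)" by simp
    qed
    also have "\<dots> \<le> (\<Sum>q'\<in>Q. (U (q' - q + int j))\<^sup>2 / 2 + (U (q - q' + int j))\<^sup>2 / 2)"
    proof (rule sum_mono)
      fix q'
      show "U (q' - q + int j) * U (q - q' + int j) \<le> (U (q' - q + int j))\<^sup>2 / 2 + (U (q - q' + int j))\<^sup>2 / 2"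
        using sum_squares_bound[of "U (q' - q + int j)" "U (q - q' + int j)"] by simp
    qed
    also have "\<dots> = (\<Sum>q'\<in>Q. (U (q' - q + int j))\<^sup>2) / 2 + (\<Sum>q'\<in>Q. (U (q - q' + int j))\<^sup>2) / 2"
      by (simp add: sum.distrib sum_divide_distrib)
    also have "\<dots> \<le> B / 2 + B / 2"
    proof -
      have inj: "inj_on (\<lambda>q'. q' - q + int j) Q" "inj_on (\<lambda>q'. q - q' + int j) Q" by (auto simp: inj_on_def)
      have "(\<Sum>q'\<in>Q. (U (q' - q + int j))\<^sup>2) = (\<Sum>n\<in>(\<lambda>q'. q' - q + int j) ` Q. (U n)\<^sup>2)"
        by (simp add: sum.reindex[OF inj(1)])
      also have "\<dots> \<le> B" unfolding U_def using fin by (intro B) auto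
      finally have 1: "(\<Sum>q'\<in>Q. (U (q' - q + int j))\<^sup>2) \<le> B" .
      have "(\<Sum>q'\<in>Q. (U (q - q' + int j))\<^sup>2) = (\<Sum>n\<in>(\<lambda>q'. q - q' + int j) ` Q. (U n)\<^sup>2)"
        by (simp add: sum.reindex[OF inj(2)])
      also have "\<dots> \<le> B" unfolding U_def using fin by (intro B) auto
      finally show ?thesis using 1 by simp
    qed
    finally show ?thesis by simp
  qed
  define g where "g = (\<lambda>p p' :: int \<times> nat. \<bar>u (snd p)\<bar> * \<bar>u (snd p')\<bar> *
     (\<bar>\<sigma> (fst p' - fst p)\<bar> * \<bar>\<sigma> (fst p' + int (snd p') - fst p - int (snd p))\<bar>
      + \<bar>\<sigma> (fst p' + int (snd p') - int j - fst p)\<bar> * \<bar>\<sigma> (fst p' - (fst p + int (snd p) - int j))\<bar>))"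
  have g0: "g p p' \<ge> 0" for p p' by (simp add: g_def)
  have second: "(\<Sum>p\<in>P. \<Sum>p'\<in>P. u (snd p) * u (snd p') *
        (expectation (\<lambda>\<omega>. A p \<omega> * A p' \<omega>) * expectation (\<lambda>\<omega>. A' p \<omega> * A' p' \<omega>)
         + expectation (\<lambda>\<omega>. A p \<omega> * A' p' \<omega>) * expectation (\<lambda>\<omega>. A' p \<omega> * A p' \<omega>))) \<le> 2 * real T * B"
    (is "?lhs \<le> _")
  proof -
    have "?lhs \<le>
      (\<Sum>p\<in>P. \<Sum>p'\<in>P. g p p')"
    proof (intro sum_mono)
      fix p p' :: "int \<times> nat"
      have le: "x * y * (z * w + z' * w') \<le> \<bar>x\<bar> * \<bar>y\<bar> * (\<bar>z\<bar> * \<bar>w\<bar> + \<bar>z'\<bar> * \<bar>w'\<bar>)" for x y z w z' w' :: real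
      proof -
        have "x * y * (z * w + z' * w') \<le> \<bar>x * y\<bar> * \<bar>z * w + z' * w'\<bar>"
          by (metis abs_ge_self abs_mult)
        also have "\<dots> \<le> \<bar>x * y\<bar> * (\<bar>z * w\<bar> + \<bar>z' * w'\<bar>)" by (intro mult_left_mono abs_triangle_ineq) auto
        finally show ?thesis by (simp add: abs_mult)
      qed
      have e: "fst p' + int (snd p') - int j - (fst p + int (snd p) - int j) = fst p' + int (snd p') - fst p - int (snd p)"
        by simp
      show "u (snd p) * u (snd p') *
        (expectation (\<lambda>\<omega>. A p \<omega> * A p' \<omega>) * expectation (\<lambda>\<omega>. A' p \<omega> * A' p' \<omega>)
         + expectation (\<lambda>\<omega>. A p \<omega> * A' p' \<omega>) * expectation (\<lambda>\<omega>. A' p \<omega> * A p' \<omega>)) \<le> g p p'"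
        unfolding A_def A'_def Y_cov g_def e by (rule le)
    qed
    also have "\<dots> \<le> (\<Sum>p\<in>Q \<times> {..k}. \<Sum>p'\<in>Q \<times> {..k}. g p p')"
    proof -
      have "(\<Sum>p\<in>P. \<Sum>p'\<in>P. g p p') \<le> (\<Sum>p\<in>P. \<Sum>p'\<in>Q \<times> {..k}. g p p')"
        using fin g0 by (intro sum_mono sum_mono2) auto
      also have "\<dots> \<le> (\<Sum>p\<in>Q \<times> {..k}. \<Sum>p'\<in>Q \<times> {..k}. g p p')"
        using fin g0 by (intro sum_mono2 sum_nonneg) auto
      finally show ?thesis .
    qed
    also have "\<dots> = (\<Sum>q\<in>Q. \<Sum>i\<le>k. \<Sum>q'\<in>Q. \<Sum>i'\<le>k. g (q, i) (q', i'))"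
      by (simp add: sum.cartesian_product')
    also have "\<dots> = (\<Sum>q\<in>Q. \<Sum>q'\<in>Q. \<Sum>i\<le>k. \<Sum>i'\<le>k. g (q, i) (q', i'))"
      by (intro sum.cong refl sum.swap)
    also have "\<dots> = (\<Sum>q\<in>Q.
        (\<Sum>q'\<in>Q. \<Sum>i\<le>k. \<Sum>i'\<le>k. \<bar>u i\<bar> * \<bar>u i'\<bar> * (\<bar>\<sigma> (q' - q)\<bar> * \<bar>\<sigma> (q' + int i' - q - int i)\<bar>))
      + (\<Sum>q'\<in>Q. \<Sum>i\<le>k. \<Sum>i'\<le>k. \<bar>u i\<bar> * \<bar>u i'\<bar> *
       (\<bar>\<sigma> (q' + int i' - int j - q)\<bar> * \<bar>\<sigma> (q' - (q + int i - int j))\<bar>)))"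
      by (simp only: g_def fst_conv snd_conv distrib_left sum.distrib)
    also have "\<dots> \<le> (\<Sum>q\<in>Q. B + B)" by (intro sum_mono add_mono conv_a conv_b)
    also have "\<dots> = 2 * real T * B" by (simp add: Q_def)
    finally show ?thesis .
  qed
  have "(real T)\<^sup>2 * expectation (\<lambda>\<omega>. (\<Sum>i\<le>k. u i * emp_autocov T (sample_path Y \<omega>) (int i - int j))\<^sup>2) =
     expectation (\<lambda>\<omega>. (\<Sum>p\<in>P. u (snd p) * (A p \<omega> * A' p \<omega>))\<^sup>2)"
    unfolding rep[symmetric] power_mult_distrib by simp
  also have "\<dots> = (\<Sum>p\<in>P. u (snd p) * expectation (\<lambda>\<omega>. A p \<omega> * A' p \<omega>))\<^sup>2 + (\<Sum>p\<in>P. \<Sum>p'\<in>P. u (snd p) * u (snd p') *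
        (expectation (\<lambda>\<omega>. A p \<omega> * A p' \<omega>) * expectation (\<lambda>\<omega>. A' p \<omega> * A' p' \<omega>)
         + expectation (\<lambda>\<omega>. A p \<omega> * A' p' \<omega>) * expectation (\<lambda>\<omega>. A' p \<omega> * A p' \<omega>)))"
    by (rule bilinear_second_moment) (auto simp: A_def A'_def Y_in_G)
  also have "\<dots> \<le> (real k * c * (\<Sum>i\<le>k. \<bar>u i\<bar>))\<^sup>2 + 2 * real T * B"
  proof (rule add_mono[OF _ second])
    show "(\<Sum>p\<in>P. u (snd p) * expectation (\<lambda>\<omega>. A p \<omega> * A' p \<omega>))\<^sup>2 \<le> (real k * c * (\<Sum>i\<le>k. \<bar>u i\<bar>))\<^sup>2"
      using power_mono[OF first, of 2] by simp
  qed
  finally show ?thesis using T by (simp add: field_simps)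
qed

end

section \<open>The mean square error of the plug-in predictor\<close>

definition lin_span :: "(int \<Rightarrow> 'a \<Rightarrow> real) \<Rightarrow> ('a \<Rightarrow> real) set" where
  "lin_span X = {Z. \<exists>I c. finite I \<and> Z = (\<lambda>\<omega>. \<Sum>n\<in>I. c n * X n \<omega>)}"

lemma lin_spanI: "finite I \<Longrightarrow> (\<lambda>\<omega>. \<Sum>n\<in>I. c n * X n \<omega>) \<in> lin_span X"
  unfolding lin_span_def by blast

lemma in_lin_span: "X n \<in> lin_span X"
  using lin_spanI[of "{n}" "\<lambda>_. 1" X] by simp

text \<open>The asymptotic bound holds from some lag \<open>N\<close> on; the finitely many earlier lags are absorbed in the
  constant.\<close>
lemma exists_lag_constant:
  fixes \<sigma> :: "int \<Rightarrow> real"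
  assumes d: "0 < d" "d < 1 / 4" and ev: "\<And>h. \<sigma> (- h) = \<sigma> h" and l: "l > 0"
    and asymp: "(\<lambda>j. \<sigma> (int j)) \<sim>[at_top] (\<lambda>j. l * real j powr (2 * d - 1))"
  shows "\<exists>c. long_memory_lags \<sigma> d c"
proof -
  let ?p = "\<lambda>j::nat. real j powr (2 * d - 1)"
  obtain C where C: "C > 0" "\<forall>\<^sub>F j in at_top. norm (\<sigma> (int j)) \<le> C * norm (l * ?p j)"
    using landau_o.bigE[OF asymp_equiv_imp_bigo[OF asymp]] by blast
  then obtain N where N: "\<And>j. j \<ge> N \<Longrightarrow> \<bar>\<sigma> (int j)\<bar> \<le> C * l * ?p j"
    using l by (auto simp: eventually_at_top_linorder abs_mult mult.assoc)
  define S where "S = (\<Sum>j\<in>{1..<N}. \<bar>\<sigma> (int j)\<bar> / ?p j)"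
  have S0: "S \<ge> 0" unfolding S_def by (intro sum_nonneg) auto
  define c where "c = C * l + \<bar>\<sigma> 0\<bar> + S"
  have "\<bar>\<sigma> (int j)\<bar> \<le> c * ?p j" if j: "j \<ge> 1" for j
  proof (cases "j \<ge> N")
    case True
    have "C * l * ?p j \<le> c * ?p j" using S0 by (intro mult_right_mono) (auto simp: c_def)
    thus ?thesis using N[OF True] by linarith
  next
    case False
    have "\<bar>\<sigma> (int j)\<bar> / ?p j \<le> S"
      unfolding S_def using False j by (intro member_le_sum) auto
    also have "S \<le> c" using C l by (simp add: c_def)
    finally show ?thesis using j by (simp add: field_simps)
  qed
  moreover have "\<bar>\<sigma> 0\<bar> \<le> c" using S0 C l by (simp add: c_def)
  ultimately show ?thesis using d ev by (intro exI[of _ c] long_memory_lags.intro)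
qed

lemma measurable_sample_path:
  "(\<And>n. X n \<in> borel_measurable M) \<Longrightarrow> sample_path X \<in> measurable M path_space"
  unfolding sample_path_def by (rule measurable_abs_UNIV)

lemma measurable_emp_autocov: "(\<lambda>y. emp_autocov T y h) \<in> borel_measurable path_space"
  unfolding emp_autocov_def by measurable

context long_memory_model
begin

lemma gaussian_space_lin_span:
  assumes g: "gaussian_process M X"
  shows "gaussian_space M (lin_span X)"
proof
  fix U V :: "'a \<Rightarrow> real" and c :: real
  have mX: "X n \<in> borel_measurable M" for n using L2_X[of n] by (simp add: L2_var_def)
  have iX: "integrable M (X n)" for n
    using L2_X[of n] unfolding L2_var_def by (auto intro: square_integrable_imp_integrable)
  assume U: "U \<in> lin_span X"
  then obtain I e where I: "finite I" "U = (\<lambda>\<omega>. \<Sum>n\<in>I. e n * X n \<omega>)" unfolding lin_span_def by blast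
  show "U \<in> borel_measurable M" unfolding I using mX by measurable
  show "(\<lambda>\<omega>. c * U \<omega>) \<in> lin_span X"
    using lin_spanI[OF I(1), of "\<lambda>n. c * e n" X] by (simp add: I(2) sum_distrib_left mult.assoc)
  have EU: "expectation U = 0"
    unfolding I(2) using iX by (simp add: Bochner_Integration.integral_sum mean_zero)
  from g[unfolded gaussian_process_def] I(1)
  consider \<mu> where "AE \<omega> in M. U \<omega> = \<mu>"
    | \<mu> s where "s > 0" "distributed M lborel U (normal_density \<mu> s)"
    unfolding I(2) by blast
  thus "(AE \<omega> in M. U \<omega> = 0) \<or> (\<exists>s>0. distributed M lborel U (normal_density 0 s))"
  proof cases
    case 1
    have "expectation U = expectation (\<lambda>_. \<mu>)"
      using 1 \<open>U \<in> borel_measurable M\<close> by (intro integral_cong_AE) auto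
    thus ?thesis using 1 EU by (simp add: prob_space)
  next
    case 2
    have "expectation U = \<mu>" by (rule normal_distributed_expectation[OF 2])
    thus ?thesis using 2 EU by auto
  qed
  assume "V \<in> lin_span X"
  then obtain J e' where J: "finite J" "V = (\<lambda>\<omega>. \<Sum>n\<in>J. e' n * X n \<omega>)" unfolding lin_span_def by blast
  have "U \<omega> + V \<omega> = (\<Sum>n\<in>I \<union> J. ((if n \<in> I then e n else 0) + (if n \<in> J then e' n else 0)) * X n \<omega>)" for \<omega>
  proof -
    have "(\<Sum>n\<in>I. e n * X n \<omega>) = (\<Sum>n\<in>I \<union> J. (if n \<in> I then e n else 0) * X n \<omega>)"
      using I J by (intro sum.mono_neutral_cong_left) auto
    moreover have "(\<Sum>n\<in>J. e' n * X n \<omega>) = (\<Sum>n\<in>I \<union> J. (if n \<in> J then e' n else 0) * X n \<omega>)"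
      using I J by (intro sum.mono_neutral_cong_left) auto
    ultimately show ?thesis by (simp add: I(2) J(2) distrib_right sum.distrib)
  qed
  thus "(\<lambda>\<omega>. U \<omega> + V \<omega>) \<in> lin_span X"
    using lin_spanI[of "I \<union> J" _ X] I(1) J(1) by simp
qed

text \<open>A nondegenerate normal variable has no atoms. The empirical autocovariances are thus almost surely
  positive definite.\<close>
lemma AE_nonzero:
  assumes g: "gaussian_process M X" and pos: "autocov M X 0 > 0"
  shows "AE \<omega> in M. X n \<omega> \<noteq> 0"
proof -
  interpret G: gaussian_space M "lin_span X" by (rule gaussian_space_lin_span[OF g])
  consider "AE \<omega> in M. X n \<omega> = 0" | s where "s > 0" "distributed M lborel (X n) (normal_density 0 s)"
    using G.normal_G[OF in_lin_span] by blast
  thus ?thesis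
  proof cases
    case 1
    have "expectation (\<lambda>\<omega>. X n \<omega> * X n \<omega>) = expectation (\<lambda>_. 0)"
      using 1 L2_X[of n] by (intro integral_cong_AE) (auto simp: L2_var_def)
    thus ?thesis using pos by (simp add: expectation_X_mult)
  next
    case 2
    have "AE x in density lborel (normal_density 0 s). x \<noteq> 0"
      using AE_lborel_singleton[of "0::real"] by (subst AE_density) auto
    hence "AE x in distr M lborel (X n). x \<noteq> 0"
      by (simp only: distributed_distr_eq_density[OF 2(2)])
    thus ?thesis by (rule AE_distrD[rotated]) (use distributed_measurable[OF 2(2)] in simp)
  qed
qed

text \<open>After expansion of the square, each term is a product of a bounded function of the path of \<open>Y\<close> and a product of
  two values of \<open>X\<close>.\<close>
lemma plug_in_error:
  fixes Y :: "int \<Rightarrow> 'a \<Rightarrow> real" and \<Delta> :: "nat \<Rightarrow> (int \<Rightarrow> real) \<Rightarrow> real"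
  assumes ind: "indep_var path_space (sample_path X) path_space (sample_path Y)"
    and m\<Delta>: "\<And>i. \<Delta> i \<in> borel_measurable path_space"
    and bd: "\<forall>i\<in>{1..k}. AE \<omega> in M. \<bar>\<Delta> i (sample_path Y \<omega>)\<bar> \<le> K"
  shows "integrable M (\<lambda>\<omega>. (\<Sum>i=1..k. \<Delta> i (sample_path Y \<omega>) * X (int k + 1 - int i) \<omega>)\<^sup>2)"
    and "integrable M (\<lambda>\<omega>. toeplitz_form (autocov M X) k (\<lambda>i. \<Delta> i (sample_path Y \<omega>)))"
    and "expectation (\<lambda>\<omega>. (\<Sum>i=1..k. \<Delta> i (sample_path Y \<omega>) * X (int k + 1 - int i) \<omega>)\<^sup>2) =
      expectation (\<lambda>\<omega>. toeplitz_form (autocov M X) k (\<lambda>i. \<Delta> i (sample_path Y \<omega>)))"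
proof -
  have mY: "sample_path Y \<in> measurable M path_space" using ind by (rule indep_var_rv2)
  let ?D = "\<lambda>i j \<omega>. \<Delta> i (sample_path Y \<omega>) * \<Delta> j (sample_path Y \<omega>)"
  let ?X = "\<lambda>i. X (int k + 1 - int i)"
  let ?sq = "\<lambda>\<omega>. (\<Sum>i=1..k. \<Delta> i (sample_path Y \<omega>) * X (int k + 1 - int i) \<omega>)\<^sup>2"
    and ?tf = "\<lambda>\<omega>. toeplitz_form (autocov M X) k (\<lambda>i. \<Delta> i (sample_path Y \<omega>))"
  have iD: "integrable M (?D i j)" if "i \<in> {1..k}" "j \<in> {1..k}" for i j
  proof (rule integrable_const_bound[where B = "K * K"])
    show "AE \<omega> in M. norm (?D i j \<omega>) \<le> K * K"
      using bd[rule_format, OF that(1)] bd[rule_format, OF that(2)]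
    proof eventually_elim
      case (elim \<omega>)
      have "0 \<le> K" using elim(1) abs_ge_zero order_trans by blast
      thus ?case using elim by (auto simp: abs_mult intro!: mult_mono)
    qed
    show "?D i j \<in> borel_measurable M"
      by (intro borel_measurable_times measurable_compose[OF mY] m\<Delta>)
  qed
  have iX: "integrable M (\<lambda>\<omega>. ?X i \<omega> * ?X j \<omega>)" for i j by (intro L2_mult_integrable L2_X)
  have indp: "indep_var borel (\<lambda>\<omega>. ?X i \<omega> * ?X j \<omega>) borel (?D i j)" for i j
  proof -
    have "indep_var borel ((\<lambda>x. x (int k + 1 - int i) * x (int k + 1 - int j)) \<circ> sample_path X)
       borel ((\<lambda>y. \<Delta> i y * \<Delta> j y) \<circ> sample_path Y)"
      by (rule indep_var_compose[OF ind])
         (auto intro!: borel_measurable_times m\<Delta> measurable_component_singleton)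
    thus ?thesis by (simp add: comp_def sample_path_def)
  qed
  have i: "integrable M (\<lambda>\<omega>. ?X i \<omega> * ?X j \<omega> * ?D i j \<omega>)"
      and e: "expectation (\<lambda>\<omega>. ?X i \<omega> * ?X j \<omega> * ?D i j \<omega>) = autocov M X (int i - int j) * expectation (?D i j)"
    if "i \<in> {1..k}" "j \<in> {1..k}" for i j
    using indep_var_integrable[OF indp iX iD[OF that]] indep_var_lebesgue_integral[OF indp iX iD[OF that]]
    by (simp_all add: expectation_X_mult)
  have sq: "(\<Sum>i=1..k. \<Delta> i (sample_path Y \<omega>) * ?X i \<omega>)\<^sup>2 = (\<Sum>i=1..k. \<Sum>j=1..k. 1 * (?X i \<omega> * ?X j \<omega> * ?D i j \<omega>))" for \<omega>
    unfolding power2_eq_square sum_product by (simp add: mult_ac)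
  show "integrable M (\<lambda>\<omega>. ?sq \<omega>)"
    unfolding sq by (intro Bochner_Integration.integrable_sum integrable_mult_right i)
  have q: "?tf \<omega> =
     (\<Sum>i=1..k. \<Sum>j=1..k. autocov M X (int i - int j) * ?D i j \<omega>)" for \<omega>
    by (simp add: toeplitz_form_def mult_ac)
  show "integrable M (\<lambda>\<omega>. ?tf \<omega>)"
    unfolding q by (intro Bochner_Integration.integrable_sum integrable_mult_right iD)
  have "expectation (\<lambda>\<omega>. ?sq \<omega>) =
     (\<Sum>i=1..k. \<Sum>j=1..k. 1 * (autocov M X (int i - int j) * expectation (?D i j)))"
    unfolding sq using i by (subst integral_double_sum) (auto simp: e intro!: sum.cong)
  also have "\<dots> = expectation (\<lambda>\<omega>. ?tf \<omega>)"
    unfolding q using iD by (subst integral_double_sum) auto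
  finally show "expectation (\<lambda>\<omega>. ?sq \<omega>) =
      expectation (\<lambda>\<omega>. ?tf \<omega>)" .
qed

end

lemma autocov_eq_of_same_law:
  assumes X: "long_memory_model M X \<epsilon> a b v d" and Y: "long_memory_model M Y \<epsilon>' a b v d"
    and law: "distr M path_space (sample_path X) = distr M path_space (sample_path Y)"
  shows "autocov M Y = autocov M X"
proof
  fix h
  interpret X: long_memory_model M X \<epsilon> a b v d by (rule X)
  interpret Y: long_memory_model M Y \<epsilon>' a b v d by (rule Y)
  have m: "X n \<in> borel_measurable M" "Y n \<in> borel_measurable M" for n
    using X.L2_X[of n] Y.L2_X[of n] by (auto simp: L2_var_def)
  have f: "(\<lambda>x. x 0 * x h) \<in> borel_measurable path_space"
    by (intro borel_measurable_times measurable_component_singleton) auto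
  have "autocov M Z h = (\<integral>x. x 0 * x h \<partial>distr M path_space (sample_path Z))"
    if "\<And>n. Z n \<in> borel_measurable M" "(\<integral>\<omega>. Z 0 \<omega> * Z h \<omega> \<partial>M) = autocov M Z h" for Z
    by (subst integral_distr[OF measurable_sample_path f]) (use that in \<open>auto simp: sample_path_def\<close>)
  from this[of X] this[of Y] show "autocov M Y h = autocov M X h"
    using m law X.expectation_X_mult[of 0 h] Y.expectation_X_mult[of 0 h] by simp
qed

text \<open>If all lags up to \<open>k\<close> have error at most \<open>\<delta> = \<mu> / (2 k)\<close>, the first summand suffices by stability.
  Otherwise one of the quotients of a fourth power by \<open>\<delta>^4\<close> exceeds 1, and the second summand exceeds the
  crude bound for the Toeplitz form.\<close>
lemma toeplitz_form_error_pointwise: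
  assumes \<mu>: "\<mu> > 0" and lower: "\<And>x. \<mu> * (\<Sum>i=1..k. (x i)\<^sup>2) \<le> toeplitz_form \<sigma> k x"
    and k: "k \<ge> 1" and ev: "\<And>h. \<sigma> (- h) = \<sigma> h" "\<And>h. \<gamma>' (- h) = \<gamma>' h"
    and c: "\<And>h. \<bar>\<sigma> h\<bar> \<le> c"
    and yw: "yule_walker \<gamma>' k g" and g: "\<And>i. i \<in> {1..k} \<Longrightarrow> \<bar>g i - \<alpha> i\<bar> \<le> K i"
  shows "toeplitz_form \<sigma> k (\<lambda>i. g i - \<alpha> i) \<le>
    4 / \<mu> * (\<Sum>j=1..k. (\<Sum>i\<le>k. (if i = 0 then 1 else - \<alpha> i) * \<gamma>' (int i - int j))\<^sup>2) +
    c * (\<Sum>i=1..k. K i)\<^sup>2 / (\<mu> / (2 * real k)) ^ 4 * (\<Sum>h\<le>k. (\<gamma>' (int h) - \<sigma> (int h)) ^ 4)"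
    (is "?q \<le> ?A + ?C / ?\<delta> ^ 4 * ?S")
proof -
  have \<delta>: "?\<delta> > 0" using \<mu> k by simp
  have c0: "c \<ge> 0" using c[of 0] abs_ge_zero order_trans by blast
  have A0: "?A \<ge> 0" using \<mu> by (intro mult_nonneg_nonneg sum_nonneg) auto
  have S0: "?S \<ge> 0" by (intro sum_nonneg) auto
  have C0: "?C \<ge> 0" using c0 by simp
  show ?thesis
  proof (cases "\<forall>h\<le>k. \<bar>\<gamma>' (int h) - \<sigma> (int h)\<bar> \<le> ?\<delta>")
    case True
    have "\<bar>\<gamma>' (int i - int j) - \<sigma> (int i - int j)\<bar> \<le> ?\<delta>" if "i \<in> {1..k}" "j \<in> {1..k}" for i j
    proof (cases "i \<ge> j")
      case T: True
      thus ?thesis using True that by (metis atLeastAtMost_iff diff_le_self le_trans of_nat_diff)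
    next
      case F: False
      hence "\<gamma>' (int i - int j) = \<gamma>' (int (j - i))" "\<sigma> (int i - int j) = \<sigma> (int (j - i))"
        using ev(1)[of "int i - int j"] ev(2)[of "int i - int j"] by (simp_all add: of_nat_diff)
      thus ?thesis using True that by (metis atLeastAtMost_iff diff_le_self le_trans)
    qed
    hence "?q \<le> 4 / \<mu> * (\<Sum>j=1..k. (\<gamma>' (int j) - (\<Sum>i=1..k. \<alpha> i * \<gamma>' (int i - int j)))\<^sup>2)"
      by (intro yule_walker_stability \<mu> lower yw)
    also have "\<dots> = ?A"
    proof -
      have "(\<Sum>i\<le>k. (if i = 0 then 1 else - \<alpha> i) * \<gamma>' (int i - int j)) =
        \<gamma>' (int j) - (\<Sum>i=1..k. \<alpha> i * \<gamma>' (int i - int j))" for j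
      proof -
        have "(\<Sum>i\<le>k. (if i = 0 then 1 else - \<alpha> i) * \<gamma>' (int i - int j)) =
          \<gamma>' (- int j) + (\<Sum>i=1..k. (if i = 0 then 1 else - \<alpha> i) * \<gamma>' (int i - int j))"
          unfolding atMost_atLeast0 by (subst sum.atLeast_Suc_atMost) auto
        also have "(\<Sum>i=1..k. (if i = 0 then 1 else - \<alpha> i) * \<gamma>' (int i - int j)) =
          (\<Sum>i=1..k. - (\<alpha> i * \<gamma>' (int i - int j)))" by (intro sum.cong) auto
        finally show ?thesis by (simp add: ev sum_negf)
      qed
      thus ?thesis by presburger
    qed
    also have "\<dots> \<le> ?A + ?C / ?\<delta> ^ 4 * ?S"
      using mult_nonneg_nonneg[OF divide_nonneg_pos[OF C0 zero_less_power[OF \<delta>, of 4]] S0] by linarith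
    finally show ?thesis .
  next
    case False
    then obtain h where h: "h \<le> k" "\<bar>\<gamma>' (int h) - \<sigma> (int h)\<bar> > ?\<delta>" by auto
    have "?\<delta> ^ 4 \<le> \<bar>\<gamma>' (int h) - \<sigma> (int h)\<bar> ^ 4" using h \<delta> by (intro power_mono) auto
    also have "\<dots> = (\<gamma>' (int h) - \<sigma> (int h)) ^ 4" by simp
    also have "\<dots> \<le> ?S" using h by (intro member_le_sum) auto
    finally have "1 \<le> ?S / ?\<delta> ^ 4" by (simp only: le_divide_eq_1_pos[OF zero_less_power[OF \<delta>]])
    hence "?C * 1 \<le> ?C * (?S / ?\<delta> ^ 4)" by (rule mult_left_mono[OF _ C0])
    moreover have "?q \<le> ?C"
    proof -
      have "?q \<le> c * (\<Sum>i=1..k. \<bar>g i - \<alpha> i\<bar>)\<^sup>2"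
        using c by (intro order_trans[OF abs_ge_self toeplitz_form_abs_le])
      also have "\<dots> \<le> ?C" using g c0 by (intro mult_left_mono power_mono sum_mono sum_nonneg) auto
      finally show ?thesis .
    qed
    ultimately show ?thesis using A0 by simp
  qed
qed

theorem theorem3p4p3:
  fixes M :: "'a measure"
    and X Y \<epsilon> \<epsilon>' :: "int \<Rightarrow> 'a \<Rightarrow> real"
    and a b :: "nat \<Rightarrow> real"
    and v d l \<delta> m :: real
    and f :: "real \<Rightarrow> real"
    and \<alpha> :: "nat \<Rightarrow> nat \<Rightarrow> real"
    and \<alpha>_est :: "nat \<Rightarrow> nat \<Rightarrow> nat \<Rightarrow> 'a \<Rightarrow> real"
  assumes d: "0 < d" "d < 1 / 4"
    and model_X: "long_memory_model M X \<epsilon> a b v d"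
    and model_Y: "long_memory_model M Y \<epsilon>' a b v d"
    and indep: "prob_space.indep_var M path_space (sample_path X) path_space (sample_path Y)"
    and same_law: "distr M path_space (sample_path X) = distr M path_space (sample_path Y)"
    and gaussian: "gaussian_process M X" "gaussian_process M Y"
    and autocov_asymp: "l > 0"
      "(\<lambda>j. autocov M X (int j)) \<sim>[at_top] (\<lambda>j. l * real j powr (2 * d - 1))"
    and b_asymp: "\<delta> > 0" "b \<sim>[at_top] (\<lambda>j. \<delta> * real j powr (d - 1))"
    and fourth_moment: "\<And>n. integrable M (\<lambda>\<omega>. \<epsilon> n \<omega> ^ 4)" "\<And>n. integrable M (\<lambda>\<omega>. \<epsilon>' n \<omega> ^ 4)"
    and density: "spectral_density (autocov M X) f"
    and density_below: "m > 0" "AE x in lborel. x \<in> {- pi..pi} \<longrightarrow> m \<le> f x"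
    and yw_true: "\<And>k. k \<ge> 1 \<Longrightarrow> yule_walker (autocov M X) k (\<alpha> k)"
    and est_measurable: "\<And>T k i. T \<ge> 1 \<Longrightarrow> i \<in> {1..k} \<Longrightarrow> \<alpha>_est T k i \<in> borel_measurable M"
    and yw_est: "\<And>T k. T \<ge> 1 \<Longrightarrow> k \<ge> 1 \<Longrightarrow>
      AE \<omega> in M. yule_walker (emp_autocov T (sample_path Y \<omega>)) k (\<lambda>i. \<alpha>_est T k i \<omega>)"
  shows "\<exists>C. \<forall>\<^sub>F k in sequentially. \<forall>\<^sub>F T in sequentially.
      integrable M (\<lambda>\<omega>. (predictor k (\<lambda>i. \<alpha>_est T k i \<omega>) (sample_path X \<omega>)
                          - predictor k (\<alpha> k) (sample_path X \<omega>))\<^sup>2) \<and>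
      (\<integral>\<omega>. (predictor k (\<lambda>i. \<alpha>_est T k i \<omega>) (sample_path X \<omega>)
            - predictor k (\<alpha> k) (sample_path X \<omega>))\<^sup>2 \<partial>M) \<le> C * (real k / real T)"
proof -
  let ?err = "\<lambda>k T \<omega>. (predictor k (\<lambda>i. \<alpha>_est T k i \<omega>) (sample_path X \<omega>)
                          - predictor k (\<alpha> k) (sample_path X \<omega>))\<^sup>2"
  interpret X: long_memory_model M X \<epsilon> a b v d by (rule model_X)
  interpret Y: long_memory_model M Y \<epsilon>' a b v d by (rule model_Y)
  define \<sigma> where "\<sigma> = autocov M X"
  have \<sigma>Y: "autocov M Y = \<sigma>"
    unfolding \<sigma>_def by (rule autocov_eq_of_same_law[OF model_X model_Y same_law])
  obtain c where lags: "long_memory_lags \<sigma> d c"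
    using exists_lag_constant[OF d X.autocov_even autocov_asymp] unfolding \<sigma>_def by blast
  interpret GL: gaussian_long_memory M "lin_span Y" \<sigma> d c Y
  proof (intro gaussian_long_memory.intro gaussian_long_memory_axioms.intro lags)
    show "gaussian_space M (lin_span Y)" by (rule Y.gaussian_space_lin_span[OF gaussian(2)])
  qed (auto simp: in_lin_span Y.expectation_X_mult \<sigma>Y)
  define \<mu> where "\<mu> = 2 * pi * m"
  have \<mu>: "\<mu> > 0" using density_below(1) by (simp add: \<mu>_def)
  have lower: "\<mu> * (\<Sum>i=1..k. (x i)\<^sup>2) \<le> toeplitz_form \<sigma> k x" for k x
    unfolding \<mu>_def \<sigma>_def by (rule spectral_lower_bound[OF density density_below(2)])
  have "\<sigma> 0 > 0" using lower[of "\<lambda>_. 1" 1] \<mu> by (simp add: toeplitz_form_def)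
  hence Y1: "AE \<omega> in M. Y 1 \<omega> \<noteq> 0" by (intro Y.AE_nonzero gaussian) (simp add: \<sigma>Y)
  define u where "u = (\<lambda>k i. if i = 0 then 1 else - \<alpha> k i)"
  obtain H where H: "\<And>k. k \<ge> 1 \<Longrightarrow> (\<Sum>i\<le>k. (u k i - a i)\<^sup>2) \<le> H * real k powr (- 4 * d)"
    using X.finite_predictor_coefficients[OF d lags[unfolded \<sigma>_def] \<mu> lower[unfolded \<sigma>_def]] yw_true
    unfolding u_def by blast
  define A where "A = (\<Sum>i. \<bar>a i\<bar>)"
  have A: "(\<Sum>i\<le>k. \<bar>a i\<bar>) \<le> A" for k
    unfolding A_def by (intro sum_le_suminf X.summable_a) auto
  define B where "B = 3 * (A\<^sup>2 * GL.sq_sum_bound + H * (c + c / d)\<^sup>2 + 4 * H * c\<^sup>2 / (1 - 4 * d))"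
  have B: "(\<Sum>n\<in>F. (\<Sum>i\<le>k. \<bar>u k i\<bar> * \<bar>\<sigma> (n - int i)\<bar>)\<^sup>2) \<le> B" if "k \<ge> 1" "finite F" for k F
    unfolding B_def by (rule GL.convolution_bound[OF that A H[OF that(1)]])
  \<comment> \<open>Beyond this threshold for \<open>T\<close>, all terms of order \<open>1 / T\<^sup>2\<close> together are at most \<open>1 / T \<le> k / T\<close>.\<close>
  define T0 where "T0 = (\<lambda>k. 4 / \<mu> * (real k * (real k * c * (\<Sum>i\<le>k. \<bar>u k i\<bar>))\<^sup>2) +
        c * (\<Sum>i=1..k. 2 ^ k + \<bar>\<alpha> k i\<bar>)\<^sup>2 / (\<mu> / (2 * real k)) ^ 4 * (\<Sum>h\<le>k. GL.fourth_moment_const h))"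
  have main: "integrable M (\<lambda>\<omega>. ?err k T \<omega>) \<and>
      (\<integral>\<omega>. ?err k T \<omega> \<partial>M) \<le> (8 * B / \<mu> + 1) * (real k / real T)"
    if k: "k \<ge> 1" and Tk: "T > k"
      and T0: "real T \<ge> T0 k" for k T
  proof -
    have T: "T \<ge> 1" using Tk by simp
    define E where "E = (\<lambda>\<omega>. emp_autocov T (sample_path Y \<omega>))"
    \<comment> \<open>The estimates agree almost surely with a measurable function of the path of \<open>Y\<close>.\<close>
    define g where "g = (\<lambda>i y. durbin_levinson (emp_autocov T y) k i)"
    define K where "K = (\<lambda>i. 2 ^ k + \<bar>\<alpha> k i\<bar>)"
    define \<Delta> where "\<Delta> = (\<lambda>i y. g i y - \<alpha> k i)"
    have m\<Delta>: "\<Delta> i \<in> borel_measurable path_space" for i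
      unfolding \<Delta>_def g_def
      by (intro borel_measurable_diff measurable_durbin_levinson measurable_emp_autocov) auto
    have AE_good: "AE \<omega> in M. pos_def_seq (E \<omega>)"
      using Y1 by eventually_elim (auto simp: E_def sample_path_def intro: emp_autocov_pos_def[OF T])
    have yw_g: "yule_walker (E \<omega>) k (\<lambda>i. g i (sample_path Y \<omega>))"
      and g_bd: "i \<in> {1..k} \<Longrightarrow> \<bar>\<Delta> i (sample_path Y \<omega>)\<bar> \<le> K i" if "pos_def_seq (E \<omega>)" for \<omega> i
      using durbin_levinson_yule_walker[of "E \<omega>" k] durbin_levinson_bound[of "E \<omega>" i k] that
      by (auto simp: E_def g_def K_def \<Delta>_def emp_autocov_even)
    have AE_est: "AE \<omega> in M. \<forall>i\<in>{1..k}. \<alpha>_est T k i \<omega> = g i (sample_path Y \<omega>)"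
      using AE_good yw_est[OF T k]
    proof eventually_elim
      case (elim \<omega>)
      have "emp_autocov T (sample_path Y \<omega>) = E \<omega>" by (simp add: E_def)
      thus ?case using yule_walker_unique[OF elim(1) _ yw_g[OF elim(1)]] elim(2) by metis
    qed
    have bd: "\<forall>i\<in>{1..k}. AE \<omega> in M. \<bar>\<Delta> i (sample_path Y \<omega>)\<bar> \<le> (\<Sum>i=1..k. K i)"
    proof
      fix i assume i: "i \<in> {1..k}"
      show "AE \<omega> in M. \<bar>\<Delta> i (sample_path Y \<omega>)\<bar> \<le> (\<Sum>i=1..k. K i)"
        using AE_good
      proof eventually_elim
        case (elim \<omega>)
        have "K i \<le> (\<Sum>i=1..k. K i)" using i by (intro member_le_sum) (auto simp: K_def)
        thus ?case using g_bd[OF elim i] by linarith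
      qed
    qed
    note pe = X.plug_in_error[OF indep m\<Delta> bd, folded \<sigma>_def]
    have AE_eq: "AE \<omega> in M. ?err k T \<omega> =
        (\<Sum>i=1..k. \<Delta> i (sample_path Y \<omega>) * X (int k + 1 - int i) \<omega>)\<^sup>2"
      using AE_est
    proof eventually_elim
      case (elim \<omega>)
      have "predictor k (\<lambda>i. \<alpha>_est T k i \<omega>) (sample_path X \<omega>) - predictor k (\<alpha> k) (sample_path X \<omega>)
        = (\<Sum>i=1..k. \<Delta> i (sample_path Y \<omega>) * X (int k + 1 - int i) \<omega>)"
        unfolding predictor_def sum_subtractf[symmetric] \<Delta>_def
        using elim by (intro sum.cong) (auto simp: sample_path_def left_diff_distrib)
      thus ?case by simp
    qed
    have meas: "(\<lambda>\<omega>. ?err k T \<omega>) \<in> borel_measurable M"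
    proof -
      have "X n \<in> borel_measurable M" for n using X.L2_X[of n] by (simp add: L2_var_def)
      thus ?thesis unfolding predictor_def sample_path_def
        using est_measurable[OF T] by (intro borel_measurable_power borel_measurable_diff borel_measurable_sum borel_measurable_times) auto
    qed
    have int: "integrable M (\<lambda>\<omega>. ?err k T \<omega>)"
      using pe(1) meas AE_eq borel_measurable_integrable[OF pe(1)] by (subst integrable_cong_AE) auto
    define W where "W = c * (\<Sum>i=1..k. K i)\<^sup>2 / (\<mu> / (2 * real k)) ^ 4"
    have W0: "W \<ge> 0" using GL.c_nonneg by (simp add: W_def)
    define r where "r = (\<lambda>j \<omega>. \<Sum>i\<le>k. u k i * E \<omega> (int i - int j))"
    define s where "s = (\<lambda>h \<omega>. E \<omega> (int h) - \<sigma> (int h))"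
    have pw: "AE \<omega> in M. toeplitz_form \<sigma> k (\<lambda>i. \<Delta> i (sample_path Y \<omega>)) \<le>
       4 / \<mu> * (\<Sum>j=1..k. (r j \<omega>)\<^sup>2) + W * (\<Sum>h\<le>k. s h \<omega> ^ 4)"
      using AE_good
    proof eventually_elim
      case (elim \<omega>)
      show ?case
        unfolding \<Delta>_def W_def r_def s_def u_def
        by (rule toeplitz_form_error_pointwise[OF \<mu> lower k GL.even _ GL.abs_le_c yw_g[OF elim]])
           (use g_bd[OF elim] in \<open>auto simp: E_def emp_autocov_even \<Delta>_def\<close>)
    qed
    have am: "all_moments M (r j)" "all_moments M (s h)" for j h
      unfolding r_def s_def E_def by (intro X.all_moments_intros GL.all_moments_emp)+
    have ir: "integrable M (\<lambda>\<omega>. (r j \<omega>)\<^sup>2)" "integrable M (\<lambda>\<omega>. s h \<omega> ^ 4)" for j h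
      by (intro all_moments_integrable X.all_moments_intros am)+
    have "(\<integral>\<omega>. ?err k T \<omega> \<partial>M)
       = X.expectation (\<lambda>\<omega>. (\<Sum>i=1..k. \<Delta> i (sample_path Y \<omega>) * X (int k + 1 - int i) \<omega>)\<^sup>2)"
      using meas AE_eq borel_measurable_integrable[OF pe(1)] by (intro integral_cong_AE) auto
    also have "\<dots> = X.expectation (\<lambda>\<omega>. toeplitz_form \<sigma> k (\<lambda>i. \<Delta> i (sample_path Y \<omega>)))" by (rule pe(3))
    also have "\<dots> \<le> X.expectation (\<lambda>\<omega>. 4 / \<mu> * (\<Sum>j=1..k. (r j \<omega>)\<^sup>2) + W * (\<Sum>h\<le>k. s h \<omega> ^ 4))"
      by (rule integral_mono_AE[OF pe(2) _ pw])
         (intro Bochner_Integration.integrable_add integrable_mult_right Bochner_Integration.integrable_sum ir)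
    also have "\<dots> = 4 / \<mu> * (\<Sum>j=1..k. X.expectation (\<lambda>\<omega>. (r j \<omega>)\<^sup>2)) + W * (\<Sum>h\<le>k. X.expectation (\<lambda>\<omega>. s h \<omega> ^ 4))"
      using ir by (simp add: Bochner_Integration.integral_sum)
    also have "\<dots> \<le> 4 / \<mu> * (\<Sum>j=1..k. ((real k * c * (\<Sum>i\<le>k. \<bar>u k i\<bar>))\<^sup>2 + 2 * real T * B) / (real T)\<^sup>2)
        + W * (\<Sum>h\<le>k. GL.fourth_moment_const h / (real T)\<^sup>2)"
    proof (intro add_mono mult_left_mono sum_mono W0)
      fix j assume j: "j \<in> {1..k}"
      have "(\<Sum>i\<le>k. u k i * \<sigma> (int i - int j)) = 0"
        using yw_true[OF k] j GL.even[of "int j"]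
        by (simp add: u_def atMost_atLeast0 sum.atLeast_Suc_atMost sum_negf yule_walker_def \<sigma>_def)
      thus "X.expectation (\<lambda>\<omega>. (r j \<omega>)\<^sup>2) \<le> ((real k * c * (\<Sum>i\<le>k. \<bar>u k i\<bar>))\<^sup>2 + 2 * real T * B) / (real T)\<^sup>2"
        unfolding r_def E_def by (intro GL.normal_equation_second_moment T j B k)
    next
      fix h assume "h \<in> {..k}"
      thus "X.expectation (\<lambda>\<omega>. s h \<omega> ^ 4) \<le> GL.fourth_moment_const h / (real T)\<^sup>2"
        unfolding s_def E_def using Tk by (intro GL.emp_autocov_fourth_moment) auto
    qed (use \<mu> in auto)
    also have "\<dots> = 8 * B / \<mu> * (real k / real T) +
        (4 / \<mu> * (real k * (real k * c * (\<Sum>i\<le>k. \<bar>u k i\<bar>))\<^sup>2) + W * (\<Sum>h\<le>k. GL.fourth_moment_const h)) / (real T)\<^sup>2"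
    proof -
      have alg: "4 / \<mu> * (x * ((L + 2 * t * B) / t\<^sup>2)) + W * (F / t\<^sup>2) =
          8 * B / \<mu> * (x / t) + (4 / \<mu> * (x * L) + W * F) / t\<^sup>2" if "t > 0" for x L t F :: real
        using that \<mu> by (simp add: field_simps power2_eq_square)
      show ?thesis using T by (simp only: sum_constant card_atLeastAtMost sum_divide_distrib[symmetric] diff_Suc_1 add_diff_cancel_right') (rule alg, simp)
    qed
    also have "\<dots> \<le> 8 * B / \<mu> * (real k / real T) + real T / (real T)\<^sup>2"
      using T0 by (intro add_left_mono divide_right_mono) (auto simp: W_def K_def T0_def)
    also have "\<dots> \<le> (8 * B / \<mu> + 1) * (real k / real T)"
    proof -
      have "real T / (real T)\<^sup>2 \<le> real k / real T"
        using T k by (simp add: power2_eq_square divide_right_mono)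
      thus ?thesis by (simp only: distrib_right mult_1 add_left_mono)
    qed
    finally show ?thesis by (rule conjI[OF int])
  qed
  show ?thesis
  proof (rule exI[of _ "8 * B / \<mu> + 1"], rule eventually_sequentiallyI[of 1])
    fix k :: nat assume k: "1 \<le> k"
    obtain N :: nat where N: "T0 k \<le> real N"
      using real_arch_simple by blast
    show "\<forall>\<^sub>F T in sequentially. integrable M (\<lambda>\<omega>. ?err k T \<omega>) \<and>
      (\<integral>\<omega>. ?err k T \<omega> \<partial>M) \<le> (8 * B / \<mu> + 1) * (real k / real T)"
    proof (rule eventually_sequentiallyI[of "max N (Suc k)"])
      fix T assume "max N (Suc k) \<le> T"
      hence "T > k" "real N \<le> real T" by auto
      thus "integrable M (\<lambda>\<omega>. ?err k T \<omega>) \<and>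
      (\<integral>\<omega>. ?err k T \<omega> \<partial>M) \<le> (8 * B / \<mu> + 1) * (real k / real T)"
        using main[OF k] N by (meson order_trans)
    qed
  qed
qed

end
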